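(* Let $d\ge 1$ and $p=1-q\in(0,1)$, and consider the East-like process $(\eta_s)_{s\ge0}$ on $\mathbb Z^d_+$ with parameter $q$ and minimal boundary condition. There exist $\kappa,\lambda>0$ and $\delta\in(0,1)$ such that, for all $x\in\mathbb Z^d_+$ and all $t\ge\kappa\|x\|_1$, $$\sup_\eta \mathbb P^{\rm min}_\eta\bigl(\mathcal T_t(x)\le\delta^d t\bigr)\le d\,e^{-\lambda\delta t},$$ where $\mathcal T_t(x)=\int_0^t \mathbf 1(\eta_s(x)=0)\,ds$. In particular $$\sup_\eta \mathbb P^{\rm min}_\eta(\tau_x\ge t)\le d\,e^{-\lambda\delta t},$$ where $\tau_x=\inf\{t:\ \eta_t(x)=0\}$. The suprema are over all initial configurations $\eta\in\{0,1\}^{\mathbb Z^d_+}$.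
   Context: $\mathbb Z^d_+=\{y\in\mathbb Z^d:\ y_i\ge 0,\ i=1,\dots,d\}$, $\|x\|_1=\sum_i|x_i|$, and $\mathcal B=\{e_1,\dots,e_d\}$ is the canonical basis. The East-like process on $\mathbb Z^d_+$ with minimal boundary condition is defined as follows. Fix some $e^*\in\mathcal B$ and let the boundary condition $\sigma$ assign to the sites $y\in\mathbb Z^d\setminus\mathbb Z^d_+$ with $y+e\in\mathbb Z^d_+$ for some $e\in\mathcal B$ the values $\sigma(-e^* )=0$ and $\sigma(y)=1$ for $y\ne -e^*$. For $\eta\in\{0,1\}^{\mathbb Z^d_+}$ let $\sigma\cdot\eta$ be the configuration equal to $\sigma$ on these boundary sites and to $\eta$ on $\mathbb Z^d_+$. Each $x\in\mathbb Z^d_+$ has an independent rate-one Poisson clock; when the clock at $x$ rings, if there is $e\in\mathcal B$ with $(\sigma\cdot\eta)(x-e)=0$ for the current configuration $\eta$, then the spin at $x$ is replaced by an independent Bernoulli($p$) variable (value $1$ with probability $p$, value $0$ with probability $q=1-p$); otherwise nothing happens. $\mathbb P^{\rm min}_\eta$ denotes the law of this process started from $\eta$. *)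

theory Defs
  imports "HOL-Probability.Probability"
begin

text \<open>
  The lattice is \<^typ>\<open>int ^ 'd\<close>, so the dimension is \<open>CARD('d)\<close>.  A configuration on a set of
  sites is a function with values in \<open>{0, 1}\<close> there.
\<close>

definition quadrant :: "(int ^ 'd) set" where
  "quadrant = {y. \<forall>i. 0 \<le> y $ i}"

definition canon_basis :: "(int ^ 'd) set" where
  "canon_basis = range (\<lambda>i. axis i 1)"

definition l1_norm :: "int ^ 'd \<Rightarrow> int" where
  "l1_norm x = (\<Sum>i\<in>UNIV. \<bar>x $ i\<bar>)"

definition configs :: "(int ^ 'd \<Rightarrow> nat) set" where
  "configs = quadrant \<rightarrow>\<^sub>E {0, 1}"

definition boundary :: "(int ^ 'd) set" where
  "boundary = {y. y \<notin> quadrant \<and> (\<exists>e\<in>canon_basis. y + e \<in> quadrant)}"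

definition min_bc :: "int ^ 'd \<Rightarrow> int ^ 'd \<Rightarrow> nat" where
  "min_bc es = (\<lambda>y\<in>boundary. if y = - es then 0 else 1)"

text \<open>The configuration \<open>\<sigma> \<cdot> \<eta>\<close>; it is only ever read on the quadrant and its boundary.\<close>

definition extend :: "(int ^ 'd \<Rightarrow> nat) \<Rightarrow> (int ^ 'd \<Rightarrow> nat) \<Rightarrow> int ^ 'd \<Rightarrow> nat" where
  "extend \<sigma> \<eta> y = (if y \<in> quadrant then \<eta> y else \<sigma> y)"

lemma extend_cong [fundef_cong]:
  assumes "y = y'" "\<sigma> y' = \<sigma>' y'" "\<And>z. z = y' \<Longrightarrow> z \<in> quadrant \<Longrightarrow> \<eta> z = \<eta>' z"
  shows "extend \<sigma> \<eta> y = extend \<sigma>' \<eta>' y'"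
  using assms by (simp add: extend_def)

text \<open>
  Graphical construction.  Site \<open>x\<close> carries independent pairs \<open>\<omega> (x, n)\<close>, \<open>n = 0, 1, \<dots>\<close>: the
  waiting time between the \<open>n\<close>-th and the next ring of its clock (exponential of rate one), and
  the Bernoulli(\<open>p\<close>) variable offered to \<open>x\<close> at that next ring.
\<close>

type_synonym 'd noise = "(int, 'd) vec \<times> nat \<Rightarrow> real \<times> bool"

definition noise_measure :: "real \<Rightarrow> ('d::finite) noise measure" where
  "noise_measure p = (\<Pi>\<^sub>M j\<in>quadrant \<times> UNIV.
     density lborel (exponential_density 1) \<Otimes>\<^sub>M measure_pmf (bernoulli_pmf p))"

definition ring_time :: "'d noise \<Rightarrow> int ^ 'd \<Rightarrow> nat \<Rightarrow> real" where
  "ring_time \<omega> x n = (\<Sum>k\<le>n. fst (\<omega> (x, k)))"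

definition coin :: "'d noise \<Rightarrow> int ^ 'd \<Rightarrow> nat \<Rightarrow> nat" where
  "coin \<omega> x n = of_bool (snd (\<omega> (x, n)))"

lemma sum_nonneg_quadrant: "x \<in> quadrant \<Longrightarrow> 0 \<le> (\<Sum>i\<in>UNIV. (x :: int ^ 'd) $ i)"
  by (auto simp: quadrant_def intro: sum_nonneg)

lemma sum_minus_basis:
  assumes "e \<in> canon_basis"
  shows "(\<Sum>i\<in>UNIV. (x - e :: int ^ 'd) $ i) = (\<Sum>i\<in>UNIV. x $ i) - 1"
proof -
  from assms obtain j where "e = axis j 1" by (auto simp: canon_basis_def)
  then show ?thesis
    by (simp add: sum_subtractf axis_def)
qed

lemma sum_minus_basis_less:
  assumes "e \<in> canon_basis" "x - e \<in> quadrant"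
  shows "nat (\<Sum>i\<in>UNIV. (x - e :: int ^ 'd) $ i) < nat (\<Sum>i\<in>UNIV. x $ i)"
  using sum_minus_basis[OF assms(1), of x] sum_nonneg_quadrant[OF assms(2)] by linarith

text \<open>
  \<open>spin_after es \<eta> \<omega> x n\<close> is the spin at \<open>x\<close> right after the first \<open>n\<close> rings of the clock at \<open>x\<close>,
  starting from \<open>\<eta>\<close>.  The constraint at a ring looks at the neighbours \<open>x - e\<close> just before that
  ring, hence counts their rings at strictly earlier times.  As the dynamics at \<open>x\<close> depends on
  \<open>x - e\<close> only, the recursion is well-founded and no infinite-volume limit is needed.
\<close>

function spin_after :: "int ^ 'd \<Rightarrow> (int ^ 'd \<Rightarrow> nat) \<Rightarrow> 'd noise \<Rightarrow> int ^ 'd \<Rightarrow> nat \<Rightarrow> nat" where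
  "spin_after es \<eta> \<omega> x 0 = \<eta> x"
| "spin_after es \<eta> \<omega> x (Suc n) =
     (if \<exists>e\<in>canon_basis.
           extend (min_bc es)
             (\<lambda>y. spin_after es \<eta> \<omega> y (card {k. ring_time \<omega> y k < ring_time \<omega> x n})) (x - e) = 0
      then coin \<omega> x n
      else spin_after es \<eta> \<omega> x n)"
  by pat_completeness auto
termination
  by (relation "inv_image (less_than <*lex*> less_than)
        (\<lambda>(es, \<eta>, \<omega>, x, n). (nat (\<Sum>i\<in>UNIV. x $ i), n))")
     (auto simp del: vector_minus_component dest: sum_minus_basis_less)

definition east :: "int ^ 'd \<Rightarrow> (int ^ 'd \<Rightarrow> nat) \<Rightarrow> 'd noise \<Rightarrow> real \<Rightarrow> int ^ 'd \<Rightarrow> nat" where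
  "east es \<eta> \<omega> t x = spin_after es \<eta> \<omega> x (card {k. ring_time \<omega> x k \<le> t})"

definition occupation_time ::
    "int ^ 'd \<Rightarrow> (int ^ 'd \<Rightarrow> nat) \<Rightarrow> real \<Rightarrow> int ^ 'd \<Rightarrow> 'd noise \<Rightarrow> real" where
  "occupation_time es \<eta> t x \<omega> = (LBINT s:{0..t}. of_bool (east es \<eta> \<omega> s x = 0))"

definition hitting_time ::
    "int ^ 'd \<Rightarrow> (int ^ 'd \<Rightarrow> nat) \<Rightarrow> int ^ 'd \<Rightarrow> 'd noise \<Rightarrow> ereal" where
  "hitting_time es \<eta> x \<omega> = Inf (ereal ` {s. 0 \<le> s \<and> east es \<eta> \<omega> s x = 0})"

text \<open>
  The law of the process started from \<open>\<eta>\<close> is that of \<^const>\<open>east\<close> under \<^const>\<open>noise_measure\<close>;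
  this is the probability that the noise realizes an event \<open>A\<close>.
\<close>

definition noise_prob :: "real \<Rightarrow> (('d::finite) noise \<Rightarrow> bool) \<Rightarrow> real" where
  "noise_prob p A = measure (noise_measure p) {\<omega> \<in> space (noise_measure p). A \<omega>}"


text \<open>Sanity checks: the noise is a probability measure and the two events of interest are measurable.\<close>

lemma prob_space_noise_measure: "prob_space (noise_measure p)"
proof -
  have "prob_space (density lborel (exponential_density 1) \<Otimes>\<^sub>M measure_pmf (bernoulli_pmf p))"
    by (intro prob_space_pair prob_space_exponential_density prob_space_measure_pmf) simp
  then show ?thesis
    unfolding noise_measure_def by (intro prob_space_PiM)
qed

lemma measurable_noise:
  assumes "x \<in> quadrant"
  shows "(\<lambda>\<omega>. \<omega> (x, n)) \<in> noise_measure p \<rightarrow>\<^sub>M borel \<Otimes>\<^sub>M count_space UNIV"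
proof -
  have "(\<lambda>\<omega>. \<omega> (x, n)) \<in> noise_measure p \<rightarrow>\<^sub>M
      density lborel (exponential_density 1) \<Otimes>\<^sub>M measure_pmf (bernoulli_pmf p)"
    unfolding noise_measure_def using assms by (intro measurable_component_singleton) auto
  also have "\<dots> = noise_measure p \<rightarrow>\<^sub>M borel \<Otimes>\<^sub>M count_space UNIV"
    by (intro measurable_cong_sets sets_pair_measure_cong) auto
  finally show ?thesis .
qed

lemma measurable_ring_time [measurable]:
  assumes "x \<in> quadrant"
  shows "(\<lambda>\<omega>. ring_time \<omega> x n) \<in> borel_measurable (noise_measure p)"
  unfolding ring_time_def
  by (intro borel_measurable_sum measurable_compose[OF measurable_noise[OF assms] measurable_fst])

lemma measurable_coin [measurable]:
  assumes "x \<in> quadrant"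
  shows "(\<lambda>\<omega>. coin \<omega> x n) \<in> noise_measure p \<rightarrow>\<^sub>M count_space UNIV"
  unfolding coin_def
  by (rule measurable_compose[OF measurable_compose[OF measurable_noise[OF assms] measurable_snd]]) simp

lemma measurable_spin_after:
  assumes "x \<in> quadrant"
  shows "(\<lambda>\<omega>. spin_after es \<eta> \<omega> x n) \<in> noise_measure p \<rightarrow>\<^sub>M count_space UNIV"
  using assms
proof (induction "nat (\<Sum>i\<in>UNIV. x $ i)" arbitrary: x n rule: less_induct)
  case less
  note [measurable] = measurable_ring_time[OF \<open>x \<in> quadrant\<close>] measurable_coin[OF \<open>x \<in> quadrant\<close>]
  show ?case
  proof (induction n)
    case (Suc n)
    note [measurable] = Suc
    have nb: "Measurable.pred (noise_measure p) (\<lambda>\<omega>. extend (min_bc es)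
        (\<lambda>y. spin_after es \<eta> \<omega> y (card {k. ring_time \<omega> y k < ring_time \<omega> x n})) (x - e) = 0)"
      if e: "e \<in> canon_basis" for e
    proof (cases "x - e \<in> quadrant")
      case True
      note [measurable] = less(1)[OF sum_minus_basis_less[OF e True] True]
        measurable_ring_time[OF True]
      have "(\<lambda>\<omega>. spin_after es \<eta> \<omega> (x - e) (card {k. ring_time \<omega> (x - e) k < ring_time \<omega> x n}))
          \<in> noise_measure p \<rightarrow>\<^sub>M count_space UNIV"
        by (rule measurable_compose_countable[where
              g = "\<lambda>\<omega>. card {k. ring_time \<omega> (x - e) k < ring_time \<omega> x n}"]) measurable
      then show ?thesis by (simp add: extend_def True)
    qed (simp add: extend_def)
    have fin: "finite (canon_basis :: (int ^ 'a) set)"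
      by (simp add: canon_basis_def)
    have [measurable]: "Measurable.pred (noise_measure p) (\<lambda>\<omega>. \<exists>e\<in>canon_basis. extend (min_bc es)
        (\<lambda>y. spin_after es \<eta> \<omega> y (card {k. ring_time \<omega> y k < ring_time \<omega> x n})) (x - e) = 0)"
      by (rule pred_intros_finite(4)[OF fin]) (rule nb)
    show ?case by simp
  qed simp
qed

lemma measurable_east:
  assumes "x \<in> quadrant"
  shows "(\<lambda>(\<omega>, s). east es \<eta> \<omega> s x) \<in> noise_measure p \<Otimes>\<^sub>M borel \<rightarrow>\<^sub>M count_space UNIV"
proof -
  note [measurable] = measurable_ring_time[OF assms] measurable_spin_after[OF assms]
  have "(\<lambda>z. spin_after es \<eta> (fst z) x (card {k. ring_time (fst z) x k \<le> snd z}))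
      \<in> noise_measure p \<Otimes>\<^sub>M borel \<rightarrow>\<^sub>M count_space UNIV"
    by (rule measurable_compose_countable[where
          g = "\<lambda>z. card {k. ring_time (fst z) x k \<le> snd z}"]) measurable
  then show ?thesis by (simp add: east_def case_prod_beta')
qed

lemma measurable_occupation_time:
  assumes "x \<in> quadrant"
  shows "occupation_time es \<eta> t x \<in> borel_measurable (noise_measure p)"
proof -
  note [measurable] = measurable_east[OF assms]
  have "(\<lambda>(\<omega>, s). indicator {0..t} s *\<^sub>R (of_bool (east es \<eta> \<omega> s x = 0) :: real))
      \<in> borel_measurable (noise_measure p \<Otimes>\<^sub>M lborel)"
    by measurable
  then show ?thesis
    unfolding occupation_time_def[abs_def] set_lebesgue_integral_def
    by (rule lborel.borel_measurable_lebesgue_integral)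
qed

text \<open>
  A path can only change its value at ring times, except that it may also do so on the null set
  where infinitely many rings occur in a bounded time; rational times detect that case.
\<close>

lemma hitting_time_ge_iff:
  "ereal t \<le> hitting_time es \<eta> x \<omega> \<longleftrightarrow>
    \<not> (\<exists>s\<in>{0} \<union> range (ring_time \<omega> x) \<union> \<rat>. 0 \<le> s \<and> s < t \<and> east es \<eta> \<omega> s x = 0)"
proof -
  have *: "\<exists>s'\<in>{0} \<union> range (ring_time \<omega> x) \<union> \<rat>. 0 \<le> s' \<and> s' < t \<and> east es \<eta> \<omega> s' x = 0"
    if s: "0 \<le> s" "s < t" "east es \<eta> \<omega> s x = 0" for s
  proof (cases "finite {k. ring_time \<omega> x k \<le> s}")
    case True
    define s' where "s' = Max (insert 0 (ring_time \<omega> x ` {k. ring_time \<omega> x k \<le> s}))"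
    have "s' \<in> insert 0 (ring_time \<omega> x ` {k. ring_time \<omega> x k \<le> s})"
      unfolding s'_def using True by (intro Max_in) auto
    moreover have "0 \<le> s'" unfolding s'_def using True by (intro Max_ge) auto
    moreover have "s' \<le> s" unfolding s'_def using True s by auto
    moreover have "{k. ring_time \<omega> x k \<le> s'} = {k. ring_time \<omega> x k \<le> s}"
    proof safe
      fix k assume "ring_time \<omega> x k \<le> s"
      then show "ring_time \<omega> x k \<le> s'" unfolding s'_def using True by (intro Max_ge) auto
    qed (use \<open>s' \<le> s\<close> in simp)
    ultimately show ?thesis using s by (intro bexI[of _ s']) (auto simp: east_def)
  next
    case False
    obtain r where r: "r \<in> \<rat>" "s < r" "r < t"
      using Rats_dense_in_real[OF \<open>s < t\<close>] by auto
    have "{k. ring_time \<omega> x k \<le> s} \<subseteq> {k. ring_time \<omega> x k \<le> r}"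
      using r by auto
    with False have "infinite {k. ring_time \<omega> x k \<le> r}"
      using finite_subset by blast
    with False r s show ?thesis by (intro bexI[of _ r]) (auto simp: east_def)
  qed
  have "ereal t \<le> hitting_time es \<eta> x \<omega> \<longleftrightarrow> \<not> (\<exists>s. 0 \<le> s \<and> s < t \<and> east es \<eta> \<omega> s x = 0)"
    by (force simp: hitting_time_def le_Inf_iff not_less)
  with * show ?thesis by blast
qed

lemma measurable_hitting_time_ge:
  assumes "x \<in> quadrant"
  shows "Measurable.pred (noise_measure p) (\<lambda>\<omega>. ereal t \<le> hitting_time es \<eta> x \<omega>)"
proof -
  note [measurable] = measurable_ring_time[OF assms]
  have east: "(\<lambda>\<omega>. east es \<eta> \<omega> (f \<omega>) x) \<in> noise_measure p \<rightarrow>\<^sub>M count_space UNIV"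
    if [measurable]: "f \<in> borel_measurable (noise_measure p)" for f
    using measurable_compose[OF _ measurable_east[OF assms], of "\<lambda>\<omega>. (\<omega>, f \<omega>)"] by simp
  have hit: "Measurable.pred (noise_measure p)
      (\<lambda>\<omega>. 0 \<le> f \<omega> \<and> f \<omega> < t \<and> east es \<eta> \<omega> (f \<omega>) x = 0)"
    if [measurable]: "f \<in> borel_measurable (noise_measure p)" for f
    using east[OF that] by measurable
  have "Measurable.pred (noise_measure p)
      (\<lambda>\<omega>. \<not> ((0 \<le> (0::real) \<and> 0 < t \<and> east es \<eta> \<omega> 0 x = 0) \<or>
        (\<exists>k. 0 \<le> ring_time \<omega> x k \<and> ring_time \<omega> x k < t \<and> east es \<eta> \<omega> (ring_time \<omega> x k) x = 0) \<or>
        (\<exists>r. 0 \<le> real_of_rat r \<and> real_of_rat r < t \<and> east es \<eta> \<omega> (real_of_rat r) x = 0)))"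
    by (intro pred_intros_logic(2,5) pred_intros_countable hit measurable_ring_time assms
        borel_measurable_const)
  moreover have "ereal t \<le> hitting_time es \<eta> x \<omega> \<longleftrightarrow>
      \<not> ((0 \<le> (0::real) \<and> 0 < t \<and> east es \<eta> \<omega> 0 x = 0) \<or>
        (\<exists>k. 0 \<le> ring_time \<omega> x k \<and> ring_time \<omega> x k < t \<and> east es \<eta> \<omega> (ring_time \<omega> x k) x = 0) \<or>
        (\<exists>r. 0 \<le> real_of_rat r \<and> real_of_rat r < t \<and> east es \<eta> \<omega> (real_of_rat r) x = 0))" for \<omega>
    unfolding hitting_time_ge_iff Rats_def by blast
  ultimately show ?thesis by (simp only:)
qed

end

theory Submission
  imports Defs
begin

text \<open>
  The process is followed from the frozen zero at \<open>- es\<close> to \<open>x\<close> along at most \<open>d + 1\<close> axis-parallel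
  lines.  No site off a line that influences the line is influenced by it, so given the clocks off
  the line, the line is a time-inhomogeneous chain whose generator at every time is reversible with
  respect to one and the same product Bernoulli measure, and whose first site is unconstrained
  whenever the seed preceding the line is at zero.  During such times the generator dominates that
  of the East chain, whose spectral gap is bounded below uniformly in the length; hence the
  \<open>L\<^sup>2\<close> norm of the Feynman-Kac function \<open>E exp (- T\<^sub>t)\<close> of the occupation time of the last site decays
  at a fixed rate as long as the seed is at zero.  Passing to an arbitrary initial configuration
  costs a factor exponential in the length only, and Markov's inequality converts a linear
  occupation time of the seed into a linear occupation time of the last site.
  For \<open>x = 0\<close> and bounded \<open>t\<close>, where prefactors cannot be absorbed, the first two rings suffice.
\<close>


section \<open>Averages over product Bernoulli measures and the uniform spectral gap\<close>

text \<open>The environment of a line switches at arbitrary times, so the Feynman-Kac function is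
  merely Lipschitz in time. It is therefore pinned down by the integral equation that comes from the
  first ring, and its squared norm is compared at nearby times up to an error quadratic in the time
  step, which disappears on refining the partition. That all generators share one reversible measure
  is decisive: their Dirichlet forms then increase with the rates, so further zeros off the line can
  only improve the decay, and the seed enters only through its total time at zero. A gap by itself
  leaves constants undamped. They are damped by the killing at the last site, whose mean rate is
  \<open>1 - p\<close>; gap and killing together make the quadratic form coercive with a constant
  \<open>c\<close> independent of the length. A seed at zero during a fraction \<open>a\<close> of
  the time gives decay at rate \<open>c * a\<close>. Half of this pays for Markov's inequality, so
  each line multiplies the guaranteed fraction by \<open>c / 2\<close>, and \<open>d + 1\<close>
  lines yield \<open>(c / 2) ^ (d + 1)\<close>.\<close>

definition avg :: "real \<Rightarrow> nat \<Rightarrow> ((nat \<Rightarrow> nat) \<Rightarrow> real) \<Rightarrow> (nat \<Rightarrow> nat) \<Rightarrow> real" where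
  "avg p y f \<eta> = p * f (\<eta>(y := 1)) + (1 - p) * f (\<eta>(y := 0))"

text \<open>Iterated finite averages replace the integral over the product Bernoulli measure.
  Keeping the result as a function of the configuration makes \<open>avgs p n\<close> at the same
  time the conditional expectation given the sites from \<open>n\<close> on.\<close>

primrec avgs :: "real \<Rightarrow> nat \<Rightarrow> ((nat \<Rightarrow> nat) \<Rightarrow> real) \<Rightarrow> (nat \<Rightarrow> nat) \<Rightarrow> real" where
  "avgs p 0 f = f"
| "avgs p (Suc n) f = avg p n (avgs p n f)"

text \<open>Conditional variance given all other sites: a variable with two values of probabilities
  \<open>p\<close> and \<open>1 - p\<close> has variance \<open>p * (1 - p)\<close> times their
  squared difference.\<close>

definition lvar :: "real \<Rightarrow> nat \<Rightarrow> ((nat \<Rightarrow> nat) \<Rightarrow> real) \<Rightarrow> (nat \<Rightarrow> nat) \<Rightarrow> real" where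
  "lvar p y f \<eta> = p * (1 - p) * (f (\<eta>(y := 1)) - f (\<eta>(y := 0)))\<^sup>2"

definition free_of :: "nat \<Rightarrow> ((nat \<Rightarrow> nat) \<Rightarrow> real) \<Rightarrow> bool" where
  "free_of y w \<longleftrightarrow> (\<forall>\<eta> v. w (\<eta>(y := v)) = w \<eta>)"

definition dconstr :: "nat \<Rightarrow> (nat \<Rightarrow> nat) \<Rightarrow> real" where
  "dconstr y \<eta> = of_bool (y = 0 \<or> \<eta> (y - 1) = 0)"

definition zero_at :: "nat \<Rightarrow> (nat \<Rightarrow> nat) \<Rightarrow> real" where
  "zero_at i \<eta> = of_bool (\<eta> i = 0)"

section \<open>Iterated averages as conditional expectations\<close>

lemma free_ofD: "free_of y w \<Longrightarrow> w (\<eta>(y := v)) = w \<eta>"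
  by (simp add: free_of_def)

lemma avg_commute: "avg p x (avg p y f) = avg p y (avg p x f)"
proof (cases "x = y")
  case False
  then show ?thesis
    by (intro ext) (simp add: avg_def fun_upd_twist[OF False] algebra_simps)
qed simp

lemma avg_idem: "avg p y (avg p y f) = avg p y f"
  by (intro ext) (simp add: avg_def algebra_simps)

lemma avgs_avg_commute: "avgs p n (avg p y f) = avg p y (avgs p n f)"
  by (induction n) (simp_all add: avg_commute)

lemma avgs_absorb: "y < n \<Longrightarrow> avgs p n (avg p y f) = avgs p n f"
proof (induction n)
  case (Suc n)
  then show ?case
    by (cases "y = n") (simp_all add: avgs_avg_commute avg_idem avg_commute[of p y n])
qed simp

lemma avgs_avgs: "m \<le> n \<Longrightarrow> avgs p n (avgs p m f) = avgs p n f"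
  by (induction m) (simp_all add: avgs_absorb)

lemma avg_mult_free: "free_of y w \<Longrightarrow> avg p y (\<lambda>\<eta>. w \<eta> * f \<eta>) = (\<lambda>\<eta>. w \<eta> * avg p y f \<eta>)"
  by (intro ext) (simp add: avg_def free_ofD algebra_simps)

lemma avgs_mult_free:
  "(\<And>y. y < n \<Longrightarrow> free_of y w) \<Longrightarrow> avgs p n (\<lambda>\<eta>. w \<eta> * f \<eta>) = (\<lambda>\<eta>. w \<eta> * avgs p n f \<eta>)"
  by (induction n) (simp_all add: avg_mult_free)

text \<open>Tower property: \<open>w\<close> does not see the sites below \<open>m\<close>, so it
  can be moved in and out of the inner conditional expectation, one site at a time.\<close>

lemma avgs_mult_avgs:
  assumes "m \<le> n" "\<And>y. y < m \<Longrightarrow> free_of y w"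
  shows "avgs p n (\<lambda>\<eta>. w \<eta> * avgs p m f \<eta>) = avgs p n (\<lambda>\<eta>. w \<eta> * f \<eta>)"
  using assms
proof (induction m)
  case (Suc m)
  have "avgs p n (\<lambda>\<eta>. w \<eta> * avgs p (Suc m) f \<eta>) = avgs p n (avg p m (\<lambda>\<eta>. w \<eta> * avgs p m f \<eta>))"
    using Suc.prems by (simp add: avg_mult_free)
  also have "\<dots> = avgs p n (\<lambda>\<eta>. w \<eta> * avgs p m f \<eta>)"
    using Suc.prems by (intro avgs_absorb) simp
  also have "\<dots> = avgs p n (\<lambda>\<eta>. w \<eta> * f \<eta>)"
    using Suc by simp
  finally show ?case .
qed simp

lemma free_of_avg: "free_of y (avg p y f)"
  by (simp add: free_of_def avg_def)

lemma free_of_avgs: "y < n \<Longrightarrow> free_of y (avgs p n f)"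
proof (induction n)
  case (Suc n)
  show ?case
  proof (cases "y = n")
    case False
    then have "avgs p (Suc n) f = avg p y (avgs p (Suc n) f)"
      using Suc.prems avgs_absorb[of y "Suc n" p f] by (simp add: avgs_avg_commute avg_commute)
    then show ?thesis by (metis free_of_avg)
  qed (simp add: free_of_avg)
qed simp

lemma avg_add: "avg p y (\<lambda>\<eta>. f \<eta> + g \<eta>) = (\<lambda>\<eta>. avg p y f \<eta> + avg p y g \<eta>)"
  by (intro ext) (simp add: avg_def algebra_simps)

lemma avgs_add: "avgs p n (\<lambda>\<eta>. f \<eta> + g \<eta>) = (\<lambda>\<eta>. avgs p n f \<eta> + avgs p n g \<eta>)"
  by (induction n) (simp_all add: avg_add)

lemma avgs_cmult: "avgs p n (\<lambda>\<eta>. c * f \<eta>) = (\<lambda>\<eta>. c * avgs p n f \<eta>)"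
  by (rule avgs_mult_free) (simp add: free_of_def)

lemma avgs_diff: "avgs p n (\<lambda>\<eta>. f \<eta> - g \<eta>) = (\<lambda>\<eta>. avgs p n f \<eta> - avgs p n g \<eta>)"
  using avgs_add[of p n f "\<lambda>\<eta>. -1 * g \<eta>"] avgs_cmult[of p n "-1" g] by simp

lemma avgs_const: "avgs p n (\<lambda>\<eta>. c) = (\<lambda>\<eta>. c)"
  by (induction n) (simp_all add: avg_def algebra_simps)

lemma avgs_sum: "avgs p n (\<lambda>\<eta>. \<Sum>i\<in>A. f i \<eta>) = (\<lambda>\<eta>. \<Sum>i\<in>A. avgs p n (f i) \<eta>)"
  by (induction A rule: infinite_finite_induct) (simp_all add: avgs_const avgs_add)

section \<open>Local variances and their telescoping sums\<close>

locale bernoulli_param =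
  fixes p :: real
  assumes p_pos: "0 < p" and p_less: "p < 1"
begin

lemma avg_mono: "(\<And>\<eta>. f \<eta> \<le> g \<eta>) \<Longrightarrow> avg p y f \<eta> \<le> avg p y g \<eta>"
  using p_pos p_less by (auto simp: avg_def intro!: add_mono mult_left_mono)

lemma avgs_mono: "(\<And>\<eta>. f \<eta> \<le> g \<eta>) \<Longrightarrow> avgs p n f \<eta> \<le> avgs p n g \<eta>"
proof (induction n arbitrary: \<eta>)
  case (Suc n)
  then show ?case by (simp add: avg_mono)
qed simp

lemma avgs_nonneg: "(\<And>\<eta>. 0 \<le> f \<eta>) \<Longrightarrow> 0 \<le> avgs p n f \<eta>"
  using avgs_mono[of "\<lambda>_. 0" f n \<eta>] by (simp add: avgs_const)

lemma lvar_nonneg: "0 \<le> lvar p y f \<eta>"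
  using p_pos p_less by (simp add: lvar_def)

lemma lvar_eq: "lvar p y f \<eta> = avg p y (\<lambda>\<eta>. (f \<eta>)\<^sup>2) \<eta> - (avg p y f \<eta>)\<^sup>2"
  by (simp add: lvar_def avg_def power2_eq_square algebra_simps)

lemma lvar_le_avg: "lvar p y f \<eta> \<le> avg p y (\<lambda>\<eta>. (f \<eta>)\<^sup>2) \<eta>"
  by (simp add: lvar_eq)

lemma avgs_power2_le: "(avgs p n f \<eta>)\<^sup>2 \<le> avgs p n (\<lambda>\<eta>. (f \<eta>)\<^sup>2) \<eta>"
proof -
  define a where "a = avgs p n f \<eta>"
  have "0 \<le> avgs p n (\<lambda>\<xi>. (f \<xi> - a)\<^sup>2) \<eta>" by (intro avgs_nonneg) simp
  also have "(\<lambda>\<xi>. (f \<xi> - a)\<^sup>2) = (\<lambda>\<xi>. ((f \<xi>)\<^sup>2 - (2 * a) * f \<xi>) + a\<^sup>2)"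
    by (auto simp: power2_eq_square algebra_simps)
  also have "avgs p n \<dots> \<eta> = avgs p n (\<lambda>\<xi>. (f \<xi>)\<^sup>2) \<eta> - 2 * a * a + a\<^sup>2"
    by (simp only: avgs_add avgs_diff avgs_cmult avgs_const a_def)
  finally show ?thesis by (simp add: a_def power2_eq_square)
qed

text \<open>Fixing the spin at \<open>x\<close> commutes with averaging over the sites below
  \<open>n\<close>, so the difference of the two values at \<open>x\<close> is itself an average and
  Jensen's inequality applies.\<close>

lemma lvar_avgs_le:
  assumes "n \<le> x"
  shows "lvar p x (avgs p n f) \<eta> \<le> avgs p n (lvar p x f) \<eta>"
proof -
  have upd: "avgs p n f (\<eta>(x := v)) = avgs p n (\<lambda>\<xi>. f (\<xi>(x := v))) \<eta>" for v \<eta>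
    using assms
  proof (induction n arbitrary: \<eta>)
    case (Suc n)
    then have "n \<noteq> x" by simp
    then have tw: "\<eta>(x := v, n := i) = \<eta>(n := i, x := v)" for i \<eta>
      by (rule fun_upd_twist[symmetric])
    have "n \<le> x" using Suc.prems by simp
    then show ?case
      by (simp only: avgs.simps avg_def tw Suc.IH)
  qed simp
  have "avgs p n (lvar p x f) \<eta> = p * (1 - p) * avgs p n (\<lambda>\<xi>. (f (\<xi>(x := 1)) - f (\<xi>(x := 0)))\<^sup>2) \<eta>"
    by (simp only: lvar_def[abs_def] avgs_cmult)
  moreover have "(avgs p n f (\<eta>(x := 1)) - avgs p n f (\<eta>(x := 0)))\<^sup>2
      \<le> avgs p n (\<lambda>\<xi>. (f (\<xi>(x := 1)) - f (\<xi>(x := 0)))\<^sup>2) \<eta>"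
    using avgs_power2_le[of n "\<lambda>\<xi>. f (\<xi>(x := 1)) - f (\<xi>(x := 0))" \<eta>] by (simp add: upd avgs_diff)
  ultimately show ?thesis
    using p_pos p_less by (simp add: lvar_def mult_left_mono)
qed

lemma lvar_add_le: "lvar p y (\<lambda>\<eta>. f \<eta> + g \<eta>) \<eta> \<le> 2 * lvar p y f \<eta> + 2 * lvar p y g \<eta>"
proof -
  define a b where "a = f (\<eta>(y := 1)) - f (\<eta>(y := 0))" and "b = g (\<eta>(y := 1)) - g (\<eta>(y := 0))"
  have "(a + b)\<^sup>2 \<le> 2 * a\<^sup>2 + 2 * b\<^sup>2"
    using zero_le_power2[of "a - b"] by (simp add: power2_eq_square algebra_simps)
  then have "p * (1 - p) * (a + b)\<^sup>2 \<le> p * (1 - p) * (2 * a\<^sup>2 + 2 * b\<^sup>2)"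
    using p_pos p_less by (intro mult_left_mono) auto
  moreover have "f (\<eta>(y := 1)) + g (\<eta>(y := 1)) - (f (\<eta>(y := 0)) + g (\<eta>(y := 0))) = a + b"
    by (simp add: a_def b_def)
  ultimately show ?thesis
    unfolding lvar_def by (simp only: a_def[symmetric] b_def[symmetric] distrib_left mult.left_commute)
qed

lemma lvar_mult_free: "free_of y w \<Longrightarrow> lvar p y (\<lambda>\<eta>. w \<eta> * f \<eta>) \<eta> = (w \<eta>)\<^sup>2 * lvar p y f \<eta>"
  by (simp add: lvar_def free_ofD power2_eq_square algebra_simps)

lemma avgs_lvar_avgs:
  assumes "x < n"
  shows "avgs p n (lvar p x (avgs p x f)) \<eta> =
    avgs p n (\<lambda>\<xi>. (avgs p x f \<xi>)\<^sup>2) \<eta> - avgs p n (\<lambda>\<xi>. (avgs p (Suc x) f \<xi>)\<^sup>2) \<eta>"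
proof -
  have "lvar p x (avgs p x f) = (\<lambda>\<xi>. avg p x (\<lambda>\<xi>. (avgs p x f \<xi>)\<^sup>2) \<xi> - (avgs p (Suc x) f \<xi>)\<^sup>2)"
    by (auto simp: lvar_eq)
  then show ?thesis
    using avgs_absorb[OF assms, of p "\<lambda>\<xi>. (avgs p x f \<xi>)\<^sup>2"] by (simp only: avgs_diff)
qed

text \<open>The functions \<open>avgs p y f\<close> form a reversed martingale in \<open>y\<close>;
  each local variance is the drop in second moment on averaging out site \<open>y\<close>, and the
  drops telescope. With \<open>m = 0\<close> and \<open>x = n\<close> the sum is the variance of
  \<open>f\<close>.\<close>

lemma sum_lvar_avgs:
  assumes "m \<le> x" "x \<le> n"
  shows "(\<Sum>y = m..<x. avgs p n (lvar p y (avgs p y f)) \<eta>) =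
    avgs p n (\<lambda>\<xi>. (avgs p m f \<xi>)\<^sup>2) \<eta> - avgs p n (\<lambda>\<xi>. (avgs p x f \<xi>)\<^sup>2) \<eta>"
proof -
  have "(\<Sum>y = m..<x. avgs p n (lvar p y (avgs p y f)) \<eta>) =
     (\<Sum>y = m..<x. avgs p n (\<lambda>\<xi>. (avgs p y f \<xi>)\<^sup>2) \<eta> - avgs p n (\<lambda>\<xi>. (avgs p (Suc y) f \<xi>)\<^sup>2) \<eta>)"
    using assms by (intro sum.cong avgs_lvar_avgs) auto
  then show ?thesis
    using sum_Suc_diff'[OF assms(1), of "\<lambda>y. - avgs p n (\<lambda>\<xi>. (avgs p y f \<xi>)\<^sup>2) \<eta>"] by simp
qed

section \<open>Windows without zeros and the relaxed constraint\<close>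

definition ones :: "nat \<Rightarrow> nat \<Rightarrow> (nat \<Rightarrow> nat) \<Rightarrow> real" where
  "ones m x \<eta> = of_bool (\<forall>y\<in>{m..<x}. \<eta> y \<noteq> 0)"

lemma free_of_ones: "y < m \<or> x \<le> y \<Longrightarrow> free_of y (ones m x)"
proof -
  assume "y < m \<or> x \<le> y"
  then have "(\<forall>z\<in>{m..<x}. (\<eta>(y := v)) z \<noteq> 0) \<longleftrightarrow> (\<forall>z\<in>{m..<x}. \<eta> z \<noteq> 0)" for \<eta> :: "nat \<Rightarrow> nat" and v
    by (intro ball_cong) auto
  then show ?thesis by (simp del: fun_upd_apply add: free_of_def ones_def)
qed

lemma avgs_ones: "m \<le> x \<Longrightarrow> avgs p x (ones m x) = (\<lambda>\<eta>. p ^ (x - m))"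
proof (induction x)
  case 0
  then show ?case by (simp add: ones_def fun_eq_iff)
next
  case (Suc x)
  show ?case
  proof (cases "m = Suc x")
    case True
    then have "ones m (Suc x) = (\<lambda>_. 1)" by (auto simp: ones_def)
    then show ?thesis using True by (simp add: avgs_const avg_def fun_eq_iff)
  next
    case False
    then have "m \<le> x" using Suc.prems by simp
    have "ones m (Suc x) = (\<lambda>\<eta>. of_bool (\<eta> x \<noteq> 0) * ones m x \<eta>)"
      using \<open>m \<le> x\<close> by (auto simp: ones_def atLeastLessThanSuc)
    then have "avgs p x (ones m (Suc x)) = (\<lambda>\<eta>. of_bool (\<eta> x \<noteq> 0) * p ^ (x - m))"
      using Suc.IH[OF \<open>m \<le> x\<close>] by (simp add: avgs_mult_free free_of_def)
    then show ?thesis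
      using \<open>m \<le> x\<close> by (simp add: avg_def fun_eq_iff Suc_diff_le)
  qed
qed

lemma ones_sq: "(ones m x \<eta>)\<^sup>2 = ones m x \<eta>"
  by (simp add: ones_def)

lemma one_minus_ones_sq: "(1 - ones m x \<eta>)\<^sup>2 = 1 - ones m x \<eta>"
  by (simp add: ones_def)

text \<open>
  Averaging \<open>ones m x * f\<close> over the sites below \<open>x\<close> gives \<open>p ^ (x - m)\<close> times the average of \<open>f\<close>
  plus an error controlled by the variances inside the window.
\<close>

lemma window_estimate:
  assumes "m \<le> x" "x < n"
  defines "P \<equiv> p ^ (x - m)"
  shows "(1 - P)\<^sup>2 * avgs p n (lvar p x (avgs p x f)) \<eta> \<le>
    2 * avgs p n (\<lambda>\<xi>. (1 - ones m x \<xi>) * lvar p x f \<xi>) \<eta> +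
    2 * P * (\<Sum>y = m..<x. avgs p n (lvar p y (avgs p y f)) \<eta>)"
proof -
  define g where "g k = avgs p k f" for k
  define W where "W = ones m x"
  define d where "d = (\<lambda>\<xi>. g m \<xi> - g x \<xi>)"
  define b where "b = avgs p x (\<lambda>\<xi>. W \<xi> * d \<xi>)"
  define a where "a = avgs p x (\<lambda>\<xi>. (1 - W \<xi>) * f \<xi>)"
  have P: "0 < P" using p_pos by (simp add: P_def)
  have gg: "avgs p x (g m) = g x" "avgs p x (g x) = g x"
    using assms(1) by (simp_all add: g_def avgs_avgs)
  have freeg: "free_of y (g x)" if "y < x" for y
    using that by (simp add: g_def free_of_avgs)
  have Wg: "avgs p x (\<lambda>\<xi>. W \<xi> * g x \<xi>) = (\<lambda>\<xi>. P * g x \<xi>)"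
  proof -
    have "avgs p x (\<lambda>\<xi>. g x \<xi> * W \<xi>) = (\<lambda>\<xi>. g x \<xi> * avgs p x W \<xi>)"
      by (rule avgs_mult_free) (rule freeg)
    then show ?thesis
      using assms(1) by (simp add: W_def avgs_ones P_def mult.commute)
  qed
  have "avgs p x (\<lambda>\<xi>. W \<xi> * g m \<xi>) = avgs p x (\<lambda>\<xi>. W \<xi> * f \<xi>)"
    unfolding g_def using assms(1) by (intro avgs_mult_avgs) (auto simp: W_def free_of_ones)
  moreover have "(\<lambda>\<xi>. W \<xi> * d \<xi>) = (\<lambda>\<xi>. W \<xi> * g m \<xi> - W \<xi> * g x \<xi>)"
    by (auto simp: d_def algebra_simps)
  ultimately have b: "b = (\<lambda>\<xi>. avgs p x (\<lambda>\<xi>. W \<xi> * f \<xi>) \<xi> - P * g x \<xi>)"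
    by (simp add: b_def avgs_diff Wg)
  have "a = (\<lambda>\<xi>. g x \<xi> - avgs p x (\<lambda>\<xi>. W \<xi> * f \<xi>) \<xi>)"
    by (simp add: a_def g_def left_diff_distrib avgs_diff)
  \<comment> \<open>The function is split according to whether the window holds a zero:
    \<open>a\<close> carries the relaxed constraint, and \<open>b\<close> is what is left of the
    part on a window of ones after subtracting \<open>P\<close> times the mean.\<close>
  with b have ab: "(\<lambda>\<xi>. (1 - P) * g x \<xi>) = (\<lambda>\<xi>. a \<xi> + b \<xi>)"
    by (auto simp: algebra_simps)
  have 1: "(1 - P)\<^sup>2 * lvar p x (g x) \<xi> \<le> 2 * lvar p x a \<xi> + 2 * lvar p x b \<xi>" for \<xi>
    using lvar_add_le[of x a b \<xi>] lvar_mult_free[of x "\<lambda>_. 1 - P" "g x" \<xi>]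
    by (simp add: ab[symmetric] free_of_def)
  have free: "free_of x (\<lambda>\<xi>. 1 - W \<xi>)"
    using free_of_ones[of x m x] by (simp add: free_of_def W_def)
  have 2: "lvar p x a \<xi> \<le> avgs p x (\<lambda>\<xi>. (1 - W \<xi>) * lvar p x f \<xi>) \<xi>" for \<xi>
  proof -
    have "lvar p x (\<lambda>\<xi>. (1 - W \<xi>) * f \<xi>) = (\<lambda>\<xi>. (1 - W \<xi>) * lvar p x f \<xi>)"
      using lvar_mult_free[OF free] by (intro ext) (simp add: W_def one_minus_ones_sq)
    then show ?thesis
      using lvar_avgs_le[of x x "\<lambda>\<xi>. (1 - W \<xi>) * f \<xi>" \<xi>] by (simp add: a_def)
  qed
  \<comment> \<open>Cauchy-Schwarz for \<open>W\<close> and \<open>d\<close>, where \<open>W\<close>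
    is an indicator of mean \<open>P\<close> and \<open>s\<close> minimises the quadratic
    polynomial. The factor \<open>P\<close> gained here makes the error absorbable later.\<close>
  have 3: "(b \<xi>)\<^sup>2 \<le> P * avgs p x (\<lambda>\<xi>. (d \<xi>)\<^sup>2) \<xi>" for \<xi>
  proof -
    define s where "s = b \<xi> / P"
    have "0 \<le> avgs p x (\<lambda>\<zeta>. (d \<zeta> - s * W \<zeta>)\<^sup>2) \<xi>"
      by (rule avgs_nonneg) simp
    also have "(\<lambda>\<zeta>. (d \<zeta> - s * W \<zeta>)\<^sup>2) = (\<lambda>\<zeta>. ((d \<zeta>)\<^sup>2 - (2 * s) * (W \<zeta> * d \<zeta>)) + s\<^sup>2 * (W \<zeta>)\<^sup>2)"
      by (auto simp: power2_eq_square algebra_simps)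
    also have "avgs p x \<dots> \<xi> = avgs p x (\<lambda>\<zeta>. (d \<zeta>)\<^sup>2) \<xi> - 2 * s * b \<xi> + s\<^sup>2 * P"
      using assms(1) by (simp only: avgs_add avgs_diff avgs_cmult b_def W_def ones_sq avgs_ones P_def)
    also have "\<dots> = avgs p x (\<lambda>\<zeta>. (d \<zeta>)\<^sup>2) \<xi> - (b \<xi>)\<^sup>2 / P"
      using P by (simp add: s_def power2_eq_square field_simps)
    finally show ?thesis using P by (simp add: field_simps)
  qed
  have dsq: "avgs p x (\<lambda>\<xi>. (d \<xi>)\<^sup>2) = (\<lambda>\<xi>. avgs p x (\<lambda>\<xi>. (g m \<xi>)\<^sup>2) \<xi> - (g x \<xi>)\<^sup>2)"
  proof -
    have "(\<lambda>\<xi>. (d \<xi>)\<^sup>2) = (\<lambda>\<xi>. ((g m \<xi>)\<^sup>2 - 2 * (g x \<xi> * g m \<xi>)) + g x \<xi> * g x \<xi>)"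
      by (auto simp: d_def power2_eq_square algebra_simps)
    then show ?thesis
      by (simp add: avgs_add avgs_diff avgs_cmult avgs_mult_free freeg gg power2_eq_square)
  qed
  have "avgs p n (lvar p x b) \<eta> \<le> avgs p n (avg p x (\<lambda>\<xi>. (b \<xi>)\<^sup>2)) \<eta>"
    by (intro avgs_mono lvar_le_avg)
  also have "\<dots> = avgs p n (\<lambda>\<xi>. (b \<xi>)\<^sup>2) \<eta>"
    using assms(2) by (simp add: avgs_absorb)
  also have "\<dots> \<le> avgs p n (\<lambda>\<xi>. P * avgs p x (\<lambda>\<xi>. (d \<xi>)\<^sup>2) \<xi>) \<eta>"
    by (intro avgs_mono 3)
  also have "\<dots> = P * (avgs p n (\<lambda>\<xi>. (g m \<xi>)\<^sup>2) \<eta> - avgs p n (\<lambda>\<xi>. (g x \<xi>)\<^sup>2) \<eta>)"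
    using assms(2) by (simp add: avgs_cmult dsq avgs_diff avgs_avgs)
  also have "\<dots> = P * (\<Sum>y = m..<x. avgs p n (lvar p y (g y)) \<eta>)"
    using assms(1,2) by (simp add: g_def sum_lvar_avgs)
  finally have 4: "avgs p n (lvar p x b) \<eta> \<le> P * (\<Sum>y = m..<x. avgs p n (lvar p y (g y)) \<eta>)" .
  have "avgs p n (lvar p x a) \<eta> \<le> avgs p n (avgs p x (\<lambda>\<xi>. (1 - W \<xi>) * lvar p x f \<xi>)) \<eta>"
    by (intro avgs_mono 2)
  also have "\<dots> = avgs p n (\<lambda>\<xi>. (1 - W \<xi>) * lvar p x f \<xi>) \<eta>"
    using assms(2) by (simp add: avgs_avgs)
  finally have 5: "avgs p n (lvar p x a) \<eta> \<le> avgs p n (\<lambda>\<xi>. (1 - W \<xi>) * lvar p x f \<xi>) \<eta>" .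
  have "(1 - P)\<^sup>2 * avgs p n (lvar p x (g x)) \<eta> = avgs p n (\<lambda>\<xi>. (1 - P)\<^sup>2 * lvar p x (g x) \<xi>) \<eta>"
    by (simp only: avgs_cmult)
  also have "\<dots> \<le> avgs p n (\<lambda>\<xi>. 2 * lvar p x a \<xi> + 2 * lvar p x b \<xi>) \<eta>"
    by (intro avgs_mono 1)
  also have "\<dots> = 2 * avgs p n (lvar p x a) \<eta> + 2 * avgs p n (lvar p x b) \<eta>"
    by (simp add: avgs_add avgs_cmult)
  finally show ?thesis using 4 5 unfolding W_def g_def by linarith
qed

text \<open>Flip \<open>Suc m\<close> by first setting its neighbour \<open>m\<close> to zero, and restore \<open>m\<close> afterwards.\<close>

lemma avg_lvar_Suc_le:
  "avg p m (lvar p (Suc m) f) \<eta> \<le> 3 / (p * (1 - p)) *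
    (avg p (Suc m) (lvar p m f) \<eta> + avg p m (\<lambda>\<xi>. dconstr (Suc m) \<xi> * lvar p (Suc m) f \<xi>) \<eta>)"
proof -
  define u v w z where "u = f (\<eta>(m := 1, Suc m := 1))" and "v = f (\<eta>(m := 1, Suc m := 0))"
    and "w = f (\<eta>(m := 0, Suc m := 1))" and "z = f (\<eta>(m := 0, Suc m := 0))"
  define q where "q = 1 - p"
  have q: "0 < q" "p + q = 1" "q \<le> 1" using p_pos p_less by (auto simp: q_def)
  have tw: "\<eta>(Suc m := i, m := j) = \<eta>(m := j, Suc m := i)" for i j
    by (simp add: fun_upd_twist)
  have L: "avg p m (lvar p (Suc m) f) \<eta> = p * q * (p * (u - v)\<^sup>2 + q * (w - z)\<^sup>2)"
    by (simp add: avg_def lvar_def u_def v_def w_def z_def q_def algebra_simps)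
  have R: "avg p (Suc m) (lvar p m f) \<eta> + avg p m (\<lambda>\<xi>. dconstr (Suc m) \<xi> * lvar p (Suc m) f \<xi>) \<eta>
      = p * q * (p * (u - w)\<^sup>2 + q * (v - z)\<^sup>2 + q * (w - z)\<^sup>2)"
    unfolding avg_def lvar_def dconstr_def tw
    by (simp add: u_def v_def w_def z_def q_def algebra_simps)
  \<comment> \<open>A path of three flips: \<open>u - v = (u - w) + (w - z) - (v - z)\<close>,
    whence the factor 3.\<close>
  have sq: "(u - v)\<^sup>2 \<le> 3 * ((u - w)\<^sup>2 + (v - z)\<^sup>2 + (w - z)\<^sup>2)"
    using zero_le_power2[of "(u - w) - (w - z)"] zero_le_power2[of "(u - w) + (v - z)"]
      zero_le_power2[of "(w - z) + (v - z)"] by (simp add: power2_eq_square algebra_simps)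
  have K: "3 * p \<le> 3 / (p * q) * p" "3 * p + q \<le> 3 / (p * q) * q"
  proof -
    have "3 \<le> 3 / q" "3 \<le> 3 / p"
      using p_pos p_less q by (auto simp: field_simps)
    moreover have "3 / (p * q) * p = 3 / q" "3 / (p * q) * q = 3 / p"
      using p_pos q by auto
    ultimately show "3 * p \<le> 3 / (p * q) * p" "3 * p + q \<le> 3 / (p * q) * q"
      using p_pos p_less q by linarith+
  qed
  have "p * (u - v)\<^sup>2 + q * (w - z)\<^sup>2 \<le> 3 * p * (u - w)\<^sup>2 + (3 * p + q) * (v - z)\<^sup>2 + (3 * p + q) * (w - z)\<^sup>2"
  proof -
    have "0 \<le> q * (v - z)\<^sup>2" using q by simp
    then show ?thesis using mult_left_mono[OF sq, of p] p_pos by (simp add: algebra_simps)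
  qed
  also have "\<dots> \<le> 3 / (p * q) * p * (u - w)\<^sup>2 + 3 / (p * q) * q * (v - z)\<^sup>2 + 3 / (p * q) * q * (w - z)\<^sup>2"
    by (rule add_mono[OF add_mono]; rule mult_right_mono[OF _ zero_le_power2]; rule K)
  finally have *: "p * (u - v)\<^sup>2 + q * (w - z)\<^sup>2 \<le>
      3 / (p * q) * (p * (u - w)\<^sup>2 + q * (v - z)\<^sup>2 + q * (w - z)\<^sup>2)"
    by (simp only: distrib_left mult.assoc)
  have "p * q * (p * (u - v)\<^sup>2 + q * (w - z)\<^sup>2) \<le>
      p * q * (3 / (p * q) * (p * (u - w)\<^sup>2 + q * (v - z)\<^sup>2 + q * (w - z)\<^sup>2))"
    using p_pos q by (intro mult_left_mono[OF *]) simp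
  then show ?thesis
    unfolding L R q_def[symmetric] by (subst mult.left_commute)
qed

text \<open>The two-site inequality survives integration against a weight that sees neither of the
  two sites. It is one step in transporting a flip towards a distant zero, whose presence
  \<open>w\<close> records.\<close>

lemma avgs_lvar_Suc_le:
  assumes "Suc m < n" "free_of m w" "free_of (Suc m) w" "\<And>\<xi>. 0 \<le> w \<xi>"
  shows "avgs p n (\<lambda>\<xi>. w \<xi> * lvar p (Suc m) f \<xi>) \<eta> \<le> 3 / (p * (1 - p)) *
    (avgs p n (\<lambda>\<xi>. w \<xi> * lvar p m f \<xi>) \<eta> +
     avgs p n (\<lambda>\<xi>. w \<xi> * (dconstr (Suc m) \<xi> * lvar p (Suc m) f \<xi>)) \<eta>)"
proof -
  have *: "avgs p n (\<lambda>\<xi>. w \<xi> * h \<xi>) \<eta> = avgs p n (\<lambda>\<xi>. w \<xi> * avg p y h \<xi>) \<eta>"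
    if "free_of y w" "y < n" for y h
    using avgs_absorb[OF that(2), of p "\<lambda>\<xi>. w \<xi> * h \<xi>"] that by (simp add: avg_mult_free)
  have "avgs p n (\<lambda>\<xi>. w \<xi> * lvar p (Suc m) f \<xi>) \<eta> = avgs p n (\<lambda>\<xi>. w \<xi> * avg p m (lvar p (Suc m) f) \<xi>) \<eta>"
    using assms by (intro *) auto
  also have "\<dots> \<le> avgs p n (\<lambda>\<xi>. w \<xi> * (3 / (p * (1 - p)) *
    (avg p (Suc m) (lvar p m f) \<xi> + avg p m (\<lambda>\<xi>. dconstr (Suc m) \<xi> * lvar p (Suc m) f \<xi>) \<xi>))) \<eta>"
    using assms by (intro avgs_mono mult_left_mono avg_lvar_Suc_le) auto
  also have "\<dots> = 3 / (p * (1 - p)) * (avgs p n (\<lambda>\<xi>. w \<xi> * avg p (Suc m) (lvar p m f) \<xi>) \<eta>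
      + avgs p n (\<lambda>\<xi>. w \<xi> * avg p m (\<lambda>\<xi>. dconstr (Suc m) \<xi> * lvar p (Suc m) f \<xi>) \<xi>) \<eta>)"
    by (simp only: mult.left_commute[of "w _"] avgs_cmult distrib_left avgs_add)
  also have "\<dots> = 3 / (p * (1 - p)) * (avgs p n (\<lambda>\<xi>. w \<xi> * lvar p m f \<xi>) \<eta> +
     avgs p n (\<lambda>\<xi>. w \<xi> * (dconstr (Suc m) \<xi> * lvar p (Suc m) f \<xi>)) \<eta>)"
    using assms by (simp only: *[symmetric])
  finally show ?thesis .
qed

section \<open>The Dirichlet form of the East chain on \<open>n\<close> sites, term by term\<close>

definition energy :: "nat \<Rightarrow> ((nat \<Rightarrow> nat) \<Rightarrow> real) \<Rightarrow> (nat \<Rightarrow> nat) \<Rightarrow> nat \<Rightarrow> real" where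
  "energy n f \<eta> y = avgs p n (\<lambda>\<xi>. dconstr y \<xi> * lvar p y f \<xi>) \<eta>"

lemma energy_nonneg: "0 \<le> energy n f \<eta> y"
  unfolding energy_def by (intro avgs_nonneg) (simp add: lvar_nonneg dconstr_def)

lemma K_ge_1: "1 \<le> 3 / (p * (1 - p))"
proof -
  have "p * (1 - p) \<le> 3" using p_pos p_less mult_le_one[of p "1 - p"] by simp
  then show ?thesis using p_pos p_less by (simp add: field_simps)
qed

text \<open>The weight lives where site \<open>a\<close> is unconstrained, and the flip at
  \<open>a + j\<close> is moved back to \<open>a\<close> one site at a time. Each step costs the
  factor of the two-site inequality and one term of the Dirichlet form, so the cost is exponential
  in the distance \<open>j\<close> but does not depend on \<open>n\<close>.\<close>

lemma avgs_lvar_le_energy: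
  assumes "a + j < n" "\<And>y. a \<le> y \<Longrightarrow> free_of y w" "\<And>\<xi>. 0 \<le> w \<xi>" "\<And>\<xi>. w \<xi> \<le> dconstr a \<xi>"
  shows "avgs p n (\<lambda>\<xi>. w \<xi> * lvar p (a + j) f \<xi>) \<eta> \<le>
    (3 / (p * (1 - p))) ^ j * (\<Sum>y = a..a + j. energy n f \<eta> y)"
  using assms(1)
proof (induction j)
  case 0
  have "avgs p n (\<lambda>\<xi>. w \<xi> * lvar p a f \<xi>) \<eta> \<le> energy n f \<eta> a"
    unfolding energy_def by (intro avgs_mono mult_right_mono assms lvar_nonneg)
  then show ?case by simp
next
  case (Suc j)
  define K where "K = 3 / (p * (1 - p))"
  have K: "1 \<le> K" unfolding K_def by (rule K_ge_1)
  define S where "S j = (\<Sum>y = a..a + j. energy n f \<eta> y)" for j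
  have w1: "w \<xi> \<le> 1" for \<xi>
    using assms(4)[of \<xi>] by (rule order_trans) (simp add: dconstr_def)
  have "avgs p n (\<lambda>\<xi>. w \<xi> * lvar p (a + Suc j) f \<xi>) \<eta> \<le> K *
    (avgs p n (\<lambda>\<xi>. w \<xi> * lvar p (a + j) f \<xi>) \<eta> +
     avgs p n (\<lambda>\<xi>. w \<xi> * (dconstr (Suc (a + j)) \<xi> * lvar p (Suc (a + j)) f \<xi>)) \<eta>)"
    unfolding K_def add_Suc_right using Suc.prems assms by (intro avgs_lvar_Suc_le) auto
  also have "\<dots> \<le> K * (K ^ j * S j + energy n f \<eta> (Suc (a + j)))"
  proof (intro mult_left_mono add_mono)
    show "avgs p n (\<lambda>\<xi>. w \<xi> * lvar p (a + j) f \<xi>) \<eta> \<le> K ^ j * S j"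
      using Suc unfolding K_def S_def by simp
    show "avgs p n (\<lambda>\<xi>. w \<xi> * (dconstr (Suc (a + j)) \<xi> * lvar p (Suc (a + j)) f \<xi>)) \<eta>
        \<le> energy n f \<eta> (Suc (a + j))"
      unfolding energy_def
      by (intro avgs_mono mult_left_le_one_le) (simp_all add: lvar_nonneg assms w1 dconstr_def)
  qed (use K in simp)
  also have "\<dots> \<le> K * (K ^ j * S j + K ^ j * energy n f \<eta> (Suc (a + j)))"
    using K mult_right_mono[OF one_le_power[OF K, of j] energy_nonneg[of n f \<eta> "Suc (a + j)"]]
    by (intro mult_left_mono add_left_mono) auto
  also have "\<dots> = K ^ Suc j * S (Suc j)"
    by (simp add: S_def algebra_simps)
  finally show ?case unfolding K_def S_def .
qed

text \<open>Double counting: \<open>y\<close> lies in the window of \<open>x\<close> only if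
  \<open>y \<le> x \<le> y + l\<close>, which leaves at most \<open>l + 1\<close> values of
  \<open>x\<close>. Truncated subtraction cuts the windows at the left end.\<close>

lemma sum_windows_le:
  fixes d :: "nat \<Rightarrow> real"
  assumes "\<And>y. 0 \<le> d y"
  shows "(\<Sum>x<n. \<Sum>y = x - l..x. d y) \<le> (real l + 1) * (\<Sum>y<n. d y)"
proof -
  have "(\<Sum>x<n. \<Sum>y = x - l..x. d y) = (\<Sum>x<n. \<Sum>y<n. if x - l \<le> y \<and> y \<le> x then d y else 0)"
  proof (rule sum.cong[OF refl])
    fix x assume "x \<in> {..<n}"
    then have "{y \<in> {..<n}. x - l \<le> y \<and> y \<le> x} = {x - l..x}" by auto
    then show "(\<Sum>y = x - l..x. d y) = (\<Sum>y<n. if x - l \<le> y \<and> y \<le> x then d y else 0)"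
      by (simp flip: sum.inter_filter)
  qed
  also have "\<dots> = (\<Sum>y<n. \<Sum>x<n. if x - l \<le> y \<and> y \<le> x then d y else 0)"
    by (rule sum.swap)
  also have "\<dots> = (\<Sum>y<n. real (card {x \<in> {..<n}. x - l \<le> y \<and> y \<le> x}) * d y)"
    by (simp flip: sum.inter_filter)
  also have "\<dots> \<le> (\<Sum>y<n. (real l + 1) * d y)"
  proof (intro sum_mono mult_right_mono assms)
    fix y
    have "card {x \<in> {..<n}. x - l \<le> y \<and> y \<le> x} \<le> card {y..y + l}"
      by (intro card_mono) auto
    then show "real (card {x \<in> {..<n}. x - l \<le> y \<and> y \<le> x}) \<le> real l + 1" by simp
  qed
  finally show ?thesis by (simp add: sum_distrib_left)
qed

lemma one_minus_ones_le:
  "1 - ones m x \<xi> \<le> (\<Sum>z = m..<x. of_bool (\<xi> z = 0))"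
proof (cases "\<exists>z\<in>{m..<x}. \<xi> z = 0")
  case True
  then obtain z where z: "z \<in> {m..<x}" "\<xi> z = 0" by blast
  have "1 - ones m x \<xi> \<le> of_bool (\<xi> z = 0)" using z by (simp add: ones_def)
  also have "\<dots> \<le> (\<Sum>z = m..<x. of_bool (\<xi> z = 0))"
    using z by (intro member_le_sum) auto
  finally show ?thesis .
next
  case False
  then show ?thesis by (auto simp: ones_def intro!: sum_nonneg)
qed

text \<open>Union bound over the position \<open>z\<close> of a zero in the window. That zero frees
  site \<open>Suc z\<close>, from which \<open>x\<close> is at distance less than \<open>l\<close>,
  so transporting the flip costs at most the \<open>l\<close>-th power.\<close>

lemma avgs_window_lvar_le:
  assumes "l \<le> x" "x < n"
  shows "avgs p n (\<lambda>\<xi>. (1 - ones (x - l) x \<xi>) * lvar p x f \<xi>) \<eta> \<le>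
    real l * (3 / (p * (1 - p))) ^ l * (\<Sum>y = x - l..x. energy n f \<eta> y)"
proof -
  define K where "K = 3 / (p * (1 - p))"
  have K: "1 \<le> K" unfolding K_def by (rule K_ge_1)
  have "avgs p n (\<lambda>\<xi>. (1 - ones (x - l) x \<xi>) * lvar p x f \<xi>) \<eta> \<le>
      avgs p n (\<lambda>\<xi>. \<Sum>z = x - l..<x. of_bool (\<xi> z = 0) * lvar p x f \<xi>) \<eta>"
    by (intro avgs_mono) (simp only: sum_distrib_right[symmetric] mult_right_mono one_minus_ones_le lvar_nonneg)
  also have "\<dots> = (\<Sum>z = x - l..<x. avgs p n (\<lambda>\<xi>. of_bool (\<xi> z = 0) * lvar p x f \<xi>) \<eta>)"
    by (simp only: avgs_sum)
  also have "\<dots> \<le> (\<Sum>z = x - l..<x. K ^ l * (\<Sum>y = x - l..x. energy n f \<eta> y))"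
  proof (intro sum_mono)
    fix z assume z: "z \<in> {x - l..<x}"
    define j where "j = x - Suc z"
    have x: "x = Suc z + j" using z by (auto simp: j_def)
    have "avgs p n (\<lambda>\<xi>. of_bool (\<xi> z = 0) * lvar p x f \<xi>) \<eta> \<le> K ^ j * (\<Sum>y = Suc z..x. energy n f \<eta> y)"
      using assms unfolding x K_def by (intro avgs_lvar_le_energy) (auto simp: free_of_def dconstr_def)
    also have "\<dots> \<le> K ^ l * (\<Sum>y = x - l..x. energy n f \<eta> y)"
      using z K by (intro mult_mono power_increasing sum_mono2 sum_nonneg energy_nonneg zero_le_power)
        (auto simp: j_def)
    finally show "avgs p n (\<lambda>\<xi>. of_bool (\<xi> z = 0) * lvar p x f \<xi>) \<eta> \<le>
        K ^ l * (\<Sum>y = x - l..x. energy n f \<eta> y)" .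
  qed
  also have "\<dots> = real l * K ^ l * (\<Sum>y = x - l..x. energy n f \<eta> y)"
    using assms by simp
  finally show ?thesis unfolding K_def .
qed

text \<open>
  Relax the constraint at \<open>x\<close> to a zero somewhere among the \<open>l\<close> preceding sites.  It fails with
  probability \<open>p ^ l\<close>, so for \<open>l * p ^ l\<close> small the error terms of \<open>window_estimate\<close> are absorbed.
\<close>

theorem uniform_gap:
  obtains G where "0 < G"
    "\<And>n f \<eta>. avgs p n (\<lambda>\<xi>. (f \<xi>)\<^sup>2) \<eta> - (avgs p n f \<eta>)\<^sup>2 \<le> G * (\<Sum>y<n. energy n f \<eta> y)"
proof -
  have lim: "(\<lambda>l. p ^ l) \<longlonglongrightarrow> 0" "(\<lambda>l. real l * p ^ l) \<longlonglongrightarrow> 0"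
    using p_pos p_less by (auto intro!: LIMSEQ_power_zero powser_times_n_limit_0)
  have "\<forall>\<^sub>F l in sequentially. p ^ l < 1 / 16 \<and> real l * p ^ l < 1 / 16 \<and> l > 0"
    using order_tendstoD(2)[OF lim(1), of "1 / 16"] order_tendstoD(2)[OF lim(2), of "1 / 16"]
    by (intro eventually_conj eventually_gt_at_top) simp_all
  \<comment> \<open>The two smallness conditions give \<open>2 * P * (l + 1) \<le> 1 / 4\<close>,
    the share of the total variance that returns on the right-hand side.\<close>
  then obtain l where l: "p ^ l < 1 / 16" "real l * p ^ l < 1 / 16" "l > 0"
    using eventually_happens[of _ sequentially] by auto
  define K where "K = 3 / (p * (1 - p))"
  define P where "P = p ^ l"
  have K: "1 \<le> K" "1 \<le> K ^ l" using K_ge_1 by (auto simp: K_def one_le_power)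
  have P: "0 < P" using p_pos by (simp add: P_def)
  have \<alpha>: "(1 - P)\<^sup>2 \<le> 1" "5 / 8 \<le> (1 - P)\<^sup>2"
  proof -
    show "(1 - P)\<^sup>2 \<le> 1" using P l by (intro power_le_one) (auto simp: P_def)
    have "(15 / 16)\<^sup>2 \<le> (1 - P)\<^sup>2" using l by (intro power_mono) (auto simp: P_def)
    then show "5 / 8 \<le> (1 - P)\<^sup>2" by (simp add: power2_eq_square)
  qed
  define G where "G = 4 * real l * K ^ l * (real l + 1)"
  show thesis
  proof
    show "0 < 2 * G" using K l by (simp add: G_def)
    fix n f \<eta>
    define e where "e = energy n f \<eta>"
    define v where "v y = avgs p n (lvar p y (avgs p y f)) \<eta>" for y
    have e: "0 \<le> e y" for y by (simp add: e_def energy_nonneg)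
    have v: "0 \<le> v y" for y unfolding v_def by (intro avgs_nonneg lvar_nonneg)
    define V where "V = (\<Sum>x<n. v x)"
    have x: "(1 - P)\<^sup>2 * v x \<le> 2 * real l * K ^ l * (\<Sum>y = x - l..x. e y) + 2 * P * (\<Sum>y = x - l..x. v y)"
      if "x < n" for x
    proof (cases "l \<le> x")
      case True
      have "(1 - P)\<^sup>2 * v x \<le> 2 * avgs p n (\<lambda>\<xi>. (1 - ones (x - l) x \<xi>) * lvar p x f \<xi>) \<eta> +
          2 * P * (\<Sum>y = x - l..<x. v y)"
        using window_estimate[of "x - l" x n f \<eta>] that True by (simp add: P_def v_def)
      also have "\<dots> \<le> 2 * (real l * K ^ l * (\<Sum>y = x - l..x. e y)) + 2 * P * (\<Sum>y = x - l..x. v y)"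
        using avgs_window_lvar_le[OF True that, of f \<eta>] P v
        by (intro add_mono mult_left_mono sum_mono2) (auto simp: K_def e_def)
      finally show ?thesis by simp
    next
      \<comment> \<open>Near the left end the always free site \<open>0\<close> takes over the role
        of a zero in the window, and no error term arises.\<close>
      case False
      have "(1 - P)\<^sup>2 * v x \<le> 1 * v x" using v \<alpha> by (intro mult_right_mono)
      also have "1 * v x \<le> avgs p n (avgs p x (lvar p x f)) \<eta>"
        unfolding v_def by (simp add: avgs_mono lvar_avgs_le)
      also have "\<dots> = avgs p n (lvar p x f) \<eta>" using that by (simp add: avgs_avgs)
      also have "\<dots> \<le> K ^ x * (\<Sum>y = 0..x. e y)"
        using avgs_lvar_le_energy[of 0 x n "\<lambda>_. 1" f \<eta>] that
        by (simp add: free_of_def dconstr_def K_def e_def)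
      also have "\<dots> \<le> (2 * real l * K ^ l) * (\<Sum>y = x - l..x. e y)"
      proof (intro mult_mono)
        have "K ^ x \<le> 1 * K ^ l" using False K by (simp add: power_increasing)
        also have "\<dots> \<le> (2 * real l) * K ^ l" using K l by (intro mult_right_mono) auto
        finally show "K ^ x \<le> 2 * real l * K ^ l" .
      qed (use False K e in \<open>auto intro: sum_nonneg\<close>)
      also have "\<dots> \<le> \<dots> + 2 * P * (\<Sum>y = x - l..x. v y)"
        using P v by (simp add: sum_nonneg)
      finally show ?thesis .
    qed
    have "(1 - P)\<^sup>2 * V \<le> (\<Sum>x<n. 2 * real l * K ^ l * (\<Sum>y = x - l..x. e y) + 2 * P * (\<Sum>y = x - l..x. v y))"
      unfolding V_def sum_distrib_left[of "(1 - P)\<^sup>2"] by (intro sum_mono x) simp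
    also have "\<dots> = 2 * real l * K ^ l * (\<Sum>x<n. \<Sum>y = x - l..x. e y) + 2 * P * (\<Sum>x<n. \<Sum>y = x - l..x. v y)"
      by (simp add: sum.distrib sum_distrib_left)
    also have "\<dots> \<le> 2 * real l * K ^ l * ((real l + 1) * (\<Sum>y<n. e y)) + 2 * P * ((real l + 1) * V)"
      unfolding V_def using K P l e v by (intro add_mono mult_left_mono sum_windows_le) auto
    also have "2 * P * ((real l + 1) * V) \<le> 1 / 8 * V + 1 / 8 * V"
    proof -
      have "0 \<le> V" unfolding V_def by (intro sum_nonneg v)
      moreover have "2 * P * (real l + 1) \<le> 1 / 8 + 1 / 8" using l by (simp add: P_def algebra_simps)
      ultimately show ?thesis using mult_right_mono[of "2 * P * (real l + 1)" "1 / 8 + 1 / 8" V]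
        by (simp add: algebra_simps)
    qed
    also have "2 * real l * K ^ l * ((real l + 1) * (\<Sum>y<n. e y)) = G / 2 * (\<Sum>y<n. e y)"
      by (simp add: G_def)
    finally have *: "(1 - P)\<^sup>2 * V \<le> G / 2 * (\<Sum>y<n. e y) + 1 / 4 * V" by simp
    have "0 \<le> V" unfolding V_def by (intro sum_nonneg v)
    \<comment> \<open>The coefficient \<open>5 / 8\<close> exceeds the returning
      \<open>1 / 4\<close>, so \<open>V\<close> can be absorbed on the left.\<close>
    with \<alpha> have "5 / 8 * V \<le> (1 - P)\<^sup>2 * V" by (intro mult_right_mono)
    with * have "3 / 8 * V \<le> G / 2 * (\<Sum>y<n. e y)" by simp
    moreover have "0 \<le> G * (\<Sum>y<n. e y)" using K l e by (simp add: G_def sum_nonneg)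
    ultimately have "V \<le> 2 * G * (\<Sum>y<n. e y)" by simp
    moreover have "V = avgs p n (\<lambda>\<xi>. (f \<xi>)\<^sup>2) \<eta> - (avgs p n f \<eta>)\<^sup>2"
    proof -
      have "avgs p n (\<lambda>\<xi>. (avgs p n f \<xi>)\<^sup>2) \<eta> = (avgs p n f \<eta>)\<^sup>2"
        using avgs_mult_free[of n "avgs p n f" p "avgs p n f"]
        by (simp add: free_of_avgs power2_eq_square avgs_avgs)
      then show ?thesis using sum_lvar_avgs[of 0 n n f \<eta>] by (simp add: V_def v_def lessThan_atLeast0)
    qed
    ultimately show "avgs p n (\<lambda>\<xi>. (f \<xi>)\<^sup>2) \<eta> - (avgs p n f \<eta>)\<^sup>2 \<le> 2 * G * (\<Sum>y<n. energy n f \<eta> y)"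
      by (simp add: e_def)
  qed
qed

end

text \<open>The form on the right is that of minus the generator of the East chain with killing at
  rate one while the last site is zero; \<open>c\<close> bounds the bottom of its spectrum from
  below for all lengths at once.\<close>

definition coercive :: "real \<Rightarrow> real \<Rightarrow> bool" where
  "coercive p c \<longleftrightarrow> 0 < c \<and> c \<le> 1 \<and> (\<forall>n f \<eta>. 0 < n \<longrightarrow> c * avgs p n (\<lambda>\<xi>. (f \<xi>)\<^sup>2) \<eta> \<le>
    (\<Sum>y<n. bernoulli_param.energy p n f \<eta> y) + avgs p n (\<lambda>\<xi>. zero_at (n - 1) \<xi> * (f \<xi>)\<^sup>2) \<eta>)"

context bernoulli_param
begin

text \<open>The gap controls the fluctuation of \<open>f\<close> around its mean \<open>a\<close>,
  but not \<open>a\<close> itself. The mean is seen by the potential, whose average is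
  \<open>1 - p\<close>: where the last site is zero, \<open>a\<close> differs from \<open>f\<close>
  only by the fluctuation.\<close>

theorem uniform_coercivity:
  obtains c where "coercive p c"
proof -
  from uniform_gap obtain G where G: "0 < G"
    "\<And>n f \<eta>. avgs p n (\<lambda>\<xi>. (f \<xi>)\<^sup>2) \<eta> - (avgs p n f \<eta>)\<^sup>2 \<le> G * (\<Sum>y<n. energy n f \<eta> y)"
    by blast
  define q where "q = 1 - p"
  have q: "0 < q" using p_less by (simp add: q_def)
  define M where "M = (1 + 2 / q) * G + 2 / q + 1"
  have M: "1 \<le> M" using G q by (simp add: M_def)
  have "coercive p (1 / M)"
    unfolding coercive_def
  proof (intro conjI allI impI)
    show "0 < 1 / M" "1 / M \<le> 1" using M by auto
    fix n f \<eta> assume n: "0 < (n::nat)"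
    define a where "a = avgs p n f \<eta>"
    define Q where "Q = avgs p n (\<lambda>\<xi>. (f \<xi>)\<^sup>2) \<eta>"
    define E where "E = (\<Sum>y<n. energy n f \<eta> y)"
    define V where "V = zero_at (n - 1)"
    define U where "U = avgs p n (\<lambda>\<xi>. V \<xi> * (f \<xi>)\<^sup>2) \<eta>"
    have U: "0 \<le> U" unfolding U_def by (intro avgs_nonneg) (simp add: V_def zero_at_def)
    have E: "0 \<le> E" unfolding E_def by (intro sum_nonneg energy_nonneg)
    have var: "Q - a\<^sup>2 \<le> G * E" unfolding Q_def a_def E_def by (rule G)
    have "avgs p n V \<eta> = avgs p n (avg p (n - 1) V) \<eta>" using n by (simp add: avgs_absorb)
    also have "avg p (n - 1) V = (\<lambda>_. q)" by (auto simp: avg_def V_def zero_at_def q_def)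
    finally have "avgs p n V \<eta> = q" by (simp add: avgs_const)
    then have "q * a\<^sup>2 = avgs p n (\<lambda>\<xi>. a\<^sup>2 * V \<xi>) \<eta>"
      by (simp add: avgs_cmult)
    also have "\<dots> \<le> avgs p n (\<lambda>\<xi>. 2 * (V \<xi> * (f \<xi>)\<^sup>2) + 2 * (f \<xi> - a)\<^sup>2) \<eta>"
    proof (rule avgs_mono)
      fix \<xi>
      have "a\<^sup>2 \<le> 2 * (f \<xi>)\<^sup>2 + 2 * (f \<xi> - a)\<^sup>2"
        using zero_le_power2[of "2 * f \<xi> - a"] by (simp add: power2_eq_square algebra_simps)
      then show "a\<^sup>2 * V \<xi> \<le> 2 * (V \<xi> * (f \<xi>)\<^sup>2) + 2 * (f \<xi> - a)\<^sup>2"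
        by (auto simp: V_def zero_at_def)
    qed
    also have "\<dots> = 2 * U + 2 * (Q - a\<^sup>2)"
    proof -
      have "(\<lambda>\<xi>. (f \<xi> - a)\<^sup>2) = (\<lambda>\<xi>. ((f \<xi>)\<^sup>2 - (2 * a) * f \<xi>) + a\<^sup>2)"
        by (auto simp: power2_eq_square algebra_simps)
      then have "avgs p n (\<lambda>\<xi>. (f \<xi> - a)\<^sup>2) \<eta> = Q - 2 * a * a + a\<^sup>2"
        by (simp only: avgs_add avgs_diff avgs_cmult avgs_const a_def Q_def)
      then show ?thesis by (simp add: avgs_add avgs_cmult U_def power2_eq_square)
    qed
    finally have "a\<^sup>2 \<le> 2 / q * U + 2 / q * (Q - a\<^sup>2)" using q by (simp add: field_simps)
    also have "\<dots> \<le> 2 / q * U + 2 / q * (G * E)" using var q by (intro add_left_mono mult_left_mono) auto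
    finally have "Q \<le> 2 / q * U + (1 + 2 / q) * G * E" using var by (simp add: algebra_simps)
    also have "\<dots> \<le> M * U + M * E"
      using G q U E unfolding M_def by (intro add_mono mult_right_mono) auto
    finally show "1 / M * avgs p n (\<lambda>\<xi>. (f \<xi>)\<^sup>2) \<eta> \<le>
        (\<Sum>y<n. energy n f \<eta> y) + avgs p n (\<lambda>\<xi>. zero_at (n - 1) \<xi> * (f \<xi>)\<^sup>2) \<eta>"
      using M unfolding Q_def U_def E_def V_def by (simp add: field_simps)
  qed
  then show thesis by (rule that)
qed

end

section \<open>Decay for solutions of the first-ring equation\<close>

text \<open>Cutting \<open>[0, T]\<close> into \<open>N\<close> equal pieces leaves the total error
  \<open>C * T\<^sup>2 / N\<close>. This stands in for the sign of a derivative when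
  \<open>f\<close> need not be differentiable.\<close>

lemma quadratic_increments_le:
  fixes f :: "real \<Rightarrow> real"
  assumes "0 \<le> T" and inc: "\<And>s s'. 0 \<le> s \<Longrightarrow> s \<le> s' \<Longrightarrow> s' \<le> T \<Longrightarrow> f s \<le> f s' + C * (s' - s)\<^sup>2"
  shows "f 0 \<le> f T"
proof (rule field_le_epsilon)
  fix e :: real assume "0 < e"
  obtain N :: nat where N: "\<bar>C\<bar> * T\<^sup>2 / e < real N" using reals_Archimedean2 by blast
  have "0 \<le> \<bar>C\<bar> * T\<^sup>2 / e" using \<open>0 < e\<close> by simp
  with N have N0: "0 < real N" by linarith
  have *: "f 0 \<le> f (real k * (T / N)) + real k * (C * (T / N)\<^sup>2)" if "k \<le> N" for k
    using that
  proof (induction k)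
    case (Suc k)
    have d: "real (Suc k) * (T / N) - real k * (T / N) = T / N" by (simp add: algebra_simps add_divide_distrib)
    have "real (Suc k) * (T / N) \<le> real N * (T / N)"
      using Suc.prems \<open>0 \<le> T\<close> by (intro mult_right_mono) auto
    then have le: "real (Suc k) * (T / N) \<le> T" using N0 by simp
    have "real k * (T / N) \<le> real (Suc k) * (T / N)"
      using \<open>0 \<le> T\<close> by (intro mult_right_mono) auto
    then have "f (real k * (T / N)) \<le> f (real (Suc k) * (T / N)) + C * (T / N)\<^sup>2"
      using inc[of "real k * (T / N)" "real (Suc k) * (T / N)", unfolded d] le \<open>0 \<le> T\<close> by simp
    with Suc show ?case by (simp add: algebra_simps)
  qed simp
  have "f 0 \<le> f T + C * T\<^sup>2 / N"
    using *[of N] N0 by (simp add: power2_eq_square field_simps)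
  also have "C * T\<^sup>2 / N \<le> \<bar>C\<bar> * T\<^sup>2 / N" by (intro divide_right_mono mult_right_mono) auto
  also have "\<dots> \<le> e" using N N0 \<open>0 < e\<close> by (simp add: field_simps)
  finally show "f 0 \<le> f T + e" by simp
qed

lemma integrable_on_bounded:
  fixes f :: "real \<Rightarrow> real"
  assumes "f \<in> borel_measurable borel" "\<And>x. x \<in> {a..b} \<Longrightarrow> \<bar>f x\<bar> \<le> B"
  shows "f integrable_on {a..b}" "set_integrable lborel {a..b} f"
proof -
  show "set_integrable lborel {a..b} f"
    unfolding set_integrable_def
    using assms by (intro integrableI_bounded_set_indicator[where B = B]) (auto simp: emeasure_lborel_Icc_eq)
  then show "f integrable_on {a..b}" by (rule set_borel_integral_eq_integral(1))
qed

lemma exp_minus_le_quadratic: "0 \<le> x \<Longrightarrow> exp (- x) \<le> 1 - x + x\<^sup>2" for x :: real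
proof -
  assume "0 \<le> x"
  \<comment> \<open>The right-hand side multiplies out to \<open>1 + x ^ 3\<close>.\<close>
  then have "1 \<le> (1 - x + x\<^sup>2) * (1 + x)" by (simp add: power2_eq_square algebra_simps)
  also have "\<dots> \<le> (1 - x + x\<^sup>2) * exp x"
  proof (intro mult_left_mono)
    have "0 \<le> (x - 1 / 2)\<^sup>2 + 3 / 4" by (intro add_nonneg_nonneg) auto
    then show "0 \<le> 1 - x + x\<^sup>2" by (simp add: power2_eq_square algebra_simps)
  qed simp
  finally show ?thesis by (simp add: exp_minus field_simps)
qed

text \<open>\<open>A\<close> is the environment: \<open>A r y\<close> says that a zero off the line
  permits an update of \<open>y\<close> at time \<open>r\<close>. The predecessor on the line is the
  only other source of permission.\<close>

definition legal :: "(real \<Rightarrow> nat \<Rightarrow> bool) \<Rightarrow> real \<Rightarrow> nat \<Rightarrow> (nat \<Rightarrow> nat) \<Rightarrow> bool" where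
  "legal A r y \<eta> \<longleftrightarrow> A r y \<or> (0 < y \<and> \<eta> (y - 1) = 0)"

text \<open>The update operator of the chain: conditional expectation of \<open>f\<close> after a
  ring at \<open>y\<close> at time \<open>r\<close>, averaged over the coin.\<close>

definition jump ::
    "real \<Rightarrow> (real \<Rightarrow> nat \<Rightarrow> bool) \<Rightarrow> real \<Rightarrow> nat \<Rightarrow> ((nat \<Rightarrow> nat) \<Rightarrow> real) \<Rightarrow> (nat \<Rightarrow> nat) \<Rightarrow> real" where
  "jump p A r y f \<eta> = (if legal A r y \<eta> then avg p y f \<eta> else f \<eta>)"

context bernoulli_param
begin

text \<open>Every configuration of zeros and ones on \<open>n\<close> sites has mass at least
  \<open>min p (1 - p) ^ n\<close>. This turns a bound on an average into one at a prescribed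
  initial configuration.\<close>

lemma avgs_ge:
  assumes "\<And>\<xi>. 0 \<le> f \<xi>" "\<And>i. i < n \<Longrightarrow> \<eta> i \<in> {0, 1}"
  shows "(min p (1 - p)) ^ n * f \<eta> \<le> avgs p n f \<eta>"
  using assms(2)
proof (induction n)
  case (Suc n)
  have "min p (1 - p) * avgs p n f \<eta> \<le> avg p n (avgs p n f) \<eta>"
  proof -
    have nn: "0 \<le> avgs p n f \<xi>" for \<xi> by (rule avgs_nonneg) (rule assms)
    have eq: "\<eta>(n := \<eta> n) = \<eta>" by simp
    consider "\<eta> n = 1" | "\<eta> n = 0" using Suc.prems[of n] by auto
    then show ?thesis
    proof cases
      case 1
      then have "\<eta>(n := 1) = \<eta>" using eq by metis
      then have "min p (1 - p) * avgs p n f \<eta> \<le> p * avgs p n f (\<eta>(n := 1))"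
        using nn by (auto intro!: mult_right_mono)
      also have "\<dots> \<le> avg p n (avgs p n f) \<eta>" using nn p_less by (simp add: avg_def)
      finally show ?thesis .
    next
      case 2
      then have "\<eta>(n := 0) = \<eta>" using eq by metis
      then have "min p (1 - p) * avgs p n f \<eta> \<le> (1 - p) * avgs p n f (\<eta>(n := 0))"
        using nn by (auto intro!: mult_right_mono)
      also have "\<dots> \<le> avg p n (avgs p n f) \<eta>" using nn p_pos by (simp add: avg_def)
      finally show ?thesis .
    qed
  qed
  moreover have "min p (1 - p) * (min p (1 - p) ^ n * f \<eta>) \<le> min p (1 - p) * avgs p n f \<eta>"
    using Suc p_pos p_less by (intro mult_left_mono) auto
  ultimately show ?case by simp
qed simp

text \<open>Reversibility: resampling \<open>y\<close> is the conditional expectation given the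
  other sites, and the rate \<open>\<alpha>\<close> does not look at \<open>y\<close>. The quadratic
  form of the generator thus becomes minus the Dirichlet form.\<close>

lemma avgs_form_lvar:
  assumes "y < n" "free_of y \<alpha>"
  shows "avgs p n (\<lambda>\<xi>. \<alpha> \<xi> * (f \<xi> * (avg p y f \<xi> - f \<xi>))) \<eta> = - avgs p n (\<lambda>\<xi>. \<alpha> \<xi> * lvar p y f \<xi>) \<eta>"
proof -
  have "avg p y (\<lambda>\<xi>. f \<xi> * (avg p y f \<xi> - f \<xi>)) = (\<lambda>\<xi>. - lvar p y f \<xi>)"
  proof
    fix \<xi>
    have "avg p y (\<lambda>\<xi>. avg p y f \<xi> * f \<xi>) \<xi> = (avg p y f \<xi>)\<^sup>2"
      by (simp add: avg_mult_free[OF free_of_avg] avg_idem power2_eq_square)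
    then show "avg p y (\<lambda>\<xi>. f \<xi> * (avg p y f \<xi> - f \<xi>)) \<xi> = - lvar p y f \<xi>"
      by (simp add: lvar_def avg_def power2_eq_square algebra_simps)
  qed
  then have "avg p y (\<lambda>\<xi>. \<alpha> \<xi> * (f \<xi> * (avg p y f \<xi> - f \<xi>))) = (\<lambda>\<xi>. - 1 * (\<alpha> \<xi> * lvar p y f \<xi>))"
    by (simp add: avg_mult_free[OF assms(2)])
  then have "avgs p n (\<lambda>\<xi>. \<alpha> \<xi> * (f \<xi> * (avg p y f \<xi> - f \<xi>))) = avgs p n (\<lambda>\<xi>. - 1 * (\<alpha> \<xi> * lvar p y f \<xi>))"
    using avgs_absorb[OF assms(1), of p "\<lambda>\<xi>. \<alpha> \<xi> * (f \<xi> * (avg p y f \<xi> - f \<xi>))"] by simp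
  then have "avgs p n (\<lambda>\<xi>. \<alpha> \<xi> * (f \<xi> * (avg p y f \<xi> - f \<xi>))) \<eta> = - 1 * avgs p n (\<lambda>\<xi>. \<alpha> \<xi> * lvar p y f \<xi>) \<eta>"
    by (simp only: avgs_cmult)
  then show ?thesis by simp
qed

lemma jump_mono: "(\<And>\<xi>. f \<xi> \<le> g \<xi>) \<Longrightarrow> jump p A r y f \<eta> \<le> jump p A r y g \<eta>"
  by (simp add: jump_def avg_mono)

lemma jump_add_const: "jump p A r y (\<lambda>\<xi>. f \<xi> + c) \<eta> = jump p A r y f \<eta> + c"
  by (simp add: jump_def avg_def algebra_simps)

lemma jump_const: "jump p A r y (\<lambda>\<xi>. c) \<eta> = c"
  by (simp add: jump_def avg_def algebra_simps)

end

text \<open>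
  \<open>g s\<close> plays the role of the expectation of \<open>exp (- \<integral>\<^sub>s\<^sup>T zero_at (n - 1))\<close> for the dynamics
  started at time \<open>s\<close>; the integral equation is the decomposition according to the first ring.
\<close>

locale first_ring_equation = bernoulli_param p for p +
  fixes A :: "real \<Rightarrow> nat \<Rightarrow> bool" and n :: nat and T c :: real and g :: "real \<Rightarrow> (nat \<Rightarrow> nat) \<Rightarrow> real"
  assumes n: "0 < n" and T: "0 \<le> T"
    and A_measurable [measurable]: "\<And>i. Measurable.pred borel (\<lambda>r. A r i)"
    and g_measurable [measurable]: "\<And>\<eta>. (\<lambda>r. g r \<eta>) \<in> borel_measurable borel"
    and g_nonneg: "\<And>r \<eta>. 0 \<le> g r \<eta>" and g_le_1: "\<And>r \<eta>. g r \<eta> \<le> 1"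
    and g_eq: "\<And>s \<eta>. 0 \<le> s \<Longrightarrow> s \<le> T \<Longrightarrow> g s \<eta> = exp (- (real n + zero_at (n - 1) \<eta>) * (T - s)) +
       integral {s..T} (\<lambda>r. exp (- (real n + zero_at (n - 1) \<eta>) * (r - s)) * (\<Sum>y<n. jump p A r y (g r) \<eta>))"
    and coercive: "coercive p c"
begin

lemma c: "0 < c" "c \<le> 1"
  using coercive by (auto simp: coercive_def)

abbreviation jumps :: "real \<Rightarrow> (nat \<Rightarrow> nat) \<Rightarrow> real" where
  "jumps r \<eta> \<equiv> \<Sum>y<n. jump p A r y (g r) \<eta>"

section \<open>Legal times and the local drift\<close>

definition "seed s s' = integral {s..s'} (\<lambda>r. of_bool (A r 0) :: real)"

text \<open>The configuration stays frozen at \<open>\<eta>\<close> while the environment runs, so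
  this is the coefficient of the update at \<open>y\<close> in the generator integrated over the
  interval.\<close>

definition "legal_time s s' y \<eta> = integral {s..s'} (\<lambda>r. of_bool (legal A r y \<eta>) :: real)"

lemma legal_measurable [measurable]: "Measurable.pred borel (\<lambda>r. legal A r y \<eta>)"
  unfolding legal_def by measurable

lemma jump_measurable [measurable]:
  "(\<And>\<xi>. (\<lambda>r. f r \<xi>) \<in> borel_measurable borel) \<Longrightarrow> (\<lambda>r. jump p A r y (f r) \<eta>) \<in> borel_measurable borel"
proof -
  assume [measurable]: "\<And>\<xi>. (\<lambda>r. f r \<xi>) \<in> borel_measurable borel"
  show ?thesis unfolding jump_def avg_def by measurable
qed

lemma of_bool_integrable:
  "Measurable.pred borel P \<Longrightarrow> (\<lambda>r. of_bool (P r) :: real) integrable_on {a..b::real}"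
proof -
  assume [measurable]: "Measurable.pred borel P"
  show ?thesis by (rule integrable_on_bounded(1)[where B = 1]) auto
qed

text \<open>The last bound is the comparison with the East chain: a zero at the predecessor makes
  \<open>y\<close> legal throughout the interval, hence for at least \<open>seed s s'\<close>, and
  at \<open>y = 0\<close> the legal time is the seed time itself.\<close>

lemma legal_time_bounds:
  assumes "s \<le> s'"
  shows "0 \<le> legal_time s s' y \<eta>" "legal_time s s' y \<eta> \<le> s' - s"
    "seed s s' * dconstr y \<eta> \<le> legal_time s s' y \<eta>"
proof -
  have I: "(\<lambda>r. of_bool (legal A r y \<eta>) :: real) integrable_on {s..s'}" for y
    by (intro of_bool_integrable) measurable
  have J: "(\<lambda>r. of_bool (A r 0) :: real) integrable_on {s..s'}"
    by (intro of_bool_integrable) measurable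
  show "0 \<le> legal_time s s' y \<eta>" unfolding legal_time_def
    by (rule integral_nonneg[OF I]) simp
  show "legal_time s s' y \<eta> \<le> s' - s"
    using integral_le[OF I integrable_const_ivl[of 1 s s']] assms by (simp add: legal_time_def)
  have "seed s s' \<le> s' - s"
    using integral_le[OF J integrable_const_ivl[of 1 s s']] assms by (simp add: seed_def)
  moreover have "legal_time s s' y \<eta> = s' - s" if "0 < y" "\<eta> (y - 1) = 0"
    using that assms by (simp add: legal_time_def legal_def)
  moreover have "legal_time s s' 0 \<eta> = seed s s'"
    by (simp add: legal_time_def legal_def seed_def)
  moreover have "0 \<le> legal_time s s' y \<eta>" by fact
  ultimately show "seed s s' * dconstr y \<eta> \<le> legal_time s s' y \<eta>"
    by (cases "y = 0") (auto simp: dconstr_def)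
qed

lemma seed_bounds:
  assumes "s \<le> s'" shows "0 \<le> seed s s'" "seed s s' \<le> s' - s"
  using legal_time_bounds(1,2)[OF assms, of 0] by (simp_all add: legal_time_def legal_def seed_def)

definition "rate \<eta> = real n + zero_at (n - 1) \<eta>"

definition "M = real n + 1"

lemma rate: "0 \<le> rate \<eta>" "rate \<eta> \<le> M"
  by (auto simp: rate_def zero_at_def M_def)

lemma jumps_bounds: "0 \<le> jumps r \<eta>" "jumps r \<eta> \<le> real n"
proof -
  show "0 \<le> jumps r \<eta>"
    using jump_mono[of "\<lambda>_. 0" "g r" A r _ \<eta>] by (intro sum_nonneg) (simp add: jump_const g_nonneg)
  have "jumps r \<eta> \<le> (\<Sum>y<n. 1)"
    using jump_mono[of "g r" "\<lambda>_. 1" A r _ \<eta>] by (intro sum_mono) (simp add: jump_const g_le_1)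
  then show "jumps r \<eta> \<le> real n" by simp
qed

lemma weighted_jumps_integrable:
  assumes "s \<le> a"
  shows "(\<lambda>r. exp (- rate \<eta> * (r - s)) * jumps r \<eta>) integrable_on {a..b}"
proof (rule integrable_on_bounded(1)[where B = "1 * real n"])
  fix r assume "r \<in> {a..b}"
  then show "\<bar>exp (- rate \<eta> * (r - s)) * jumps r \<eta>\<bar> \<le> 1 * real n"
    unfolding abs_mult using jumps_bounds[of r \<eta>] rate[of \<eta>] assms
    by (intro mult_mono) auto
qed measurable

text \<open>Markov property of the integral equation: the exponential weight factorises at
  \<open>s'\<close>, and what follows is the equation started at \<open>s'\<close>.\<close>

lemma g_step:
  assumes "0 \<le> s" "s \<le> s'" "s' \<le> T"
  shows "g s \<eta> = exp (- rate \<eta> * (s' - s)) * g s' \<eta> +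
    integral {s..s'} (\<lambda>r. exp (- rate \<eta> * (r - s)) * jumps r \<eta>)"
proof -
  define F where "F s r = exp (- rate \<eta> * (r - s)) * jumps r \<eta>" for s r
  have "integral {s..T} (F s) = integral {s..s'} (F s) + integral {s'..T} (F s)"
    unfolding F_def using assms
    by (intro Henstock_Kurzweil_Integration.integral_combine[symmetric] weighted_jumps_integrable) auto
  also have "integral {s'..T} (F s) = exp (- rate \<eta> * (s' - s)) * integral {s'..T} (F s')"
  proof -
    have "F s = (\<lambda>r. exp (- rate \<eta> * (s' - s)) * F s' r)"
      by (intro ext) (simp add: F_def algebra_simps flip: exp_add)
    then show ?thesis by simp
  qed
  finally have *: "integral {s..T} (F s) = integral {s..s'} (F s) + exp (- rate \<eta> * (s' - s)) * integral {s'..T} (F s')" .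
  have "exp (- rate \<eta> * (T - s)) = exp (- rate \<eta> * (s' - s)) * exp (- rate \<eta> * (T - s'))"
    by (simp add: algebra_simps flip: exp_add)
  with * show ?thesis
    using g_eq[of s \<eta>] g_eq[of s' \<eta>] assms unfolding F_def rate_def[symmetric]
    by (simp add: algebra_simps)
qed

text \<open>Over a short interval the rings contribute at most \<open>n\<close> times its length,
  and the exponential loses at most \<open>rate \<eta> \<le> M\<close> times its length.\<close>

lemma g_lipschitz:
  assumes "0 \<le> s" "s \<le> s'" "s' \<le> T"
  shows "\<bar>g s \<eta> - g s' \<eta>\<bar> \<le> M * (s' - s)"
proof -
  define I where "I = integral {s..s'} (\<lambda>r. exp (- rate \<eta> * (r - s)) * jumps r \<eta>)"
  have "0 \<le> I" unfolding I_def
    by (intro integral_nonneg weighted_jumps_integrable mult_nonneg_nonneg jumps_bounds) auto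
  moreover have "I \<le> real n * (s' - s)"
  proof -
    have "I \<le> integral {s..s'} (\<lambda>r. real n)" unfolding I_def
    proof (intro integral_le weighted_jumps_integrable)
      fix r assume "r \<in> {s..s'}"
      then have "exp (- rate \<eta> * (r - s)) * jumps r \<eta> \<le> 1 * real n"
        using jumps_bounds[of r \<eta>] rate[of \<eta>] by (intro mult_mono) auto
      then show "exp (- rate \<eta> * (r - s)) * jumps r \<eta> \<le> real n" by simp
    qed auto
    then show ?thesis using assms by (simp add: mult.commute)
  qed
  moreover have "g s' \<eta> - M * (s' - s) \<le> exp (- rate \<eta> * (s' - s)) * g s' \<eta>"
  proof -
    have "(1 - rate \<eta> * (s' - s)) * g s' \<eta> \<le> exp (- rate \<eta> * (s' - s)) * g s' \<eta>"
      using exp_ge_add_one_self[of "- rate \<eta> * (s' - s)"] g_nonneg[of s' \<eta>]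
      by (intro mult_right_mono) auto
    moreover have "rate \<eta> * (s' - s) * g s' \<eta> \<le> M * (s' - s) * 1"
      using rate[of \<eta>] assms g_nonneg[of s' \<eta>] g_le_1[of s' \<eta>] by (intro mult_mono) (auto simp: M_def)
    ultimately show ?thesis by (simp add: algebra_simps)
  qed
  moreover have "exp (- rate \<eta> * (s' - s)) * g s' \<eta> \<le> 1 * g s' \<eta>"
    using rate[of \<eta>] assms g_nonneg[of s' \<eta>] by (intro mult_right_mono) auto
  moreover have "real n * (s' - s) \<le> M * (s' - s)"
    using assms by (intro mult_right_mono) (auto simp: M_def)
  ultimately show ?thesis using g_step[OF assms, of \<eta>] unfolding I_def by linarith
qed

text \<open>First-order part of \<open>g s - g s'\<close>: the generator integrated over the
  interval and applied to \<open>g s'\<close>, minus the killing.\<close>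

definition "drift s s' \<eta> =
  (\<Sum>y<n. legal_time s s' y \<eta> * (avg p y (g s') \<eta> - g s' \<eta>)) - (s' - s) * (zero_at (n - 1) \<eta> * g s' \<eta>)"

text \<open>Under the integral \<open>g r\<close> is replaced by \<open>g s'\<close>, at a cost
  controlled by the Lipschitz bound, and the exponential is expanded to second order. Either error
  is at most \<open>M\<^sup>2 * (s' - s)\<^sup>2\<close>.\<close>

lemma g_le_drift:
  assumes "0 \<le> s" "s \<le> s'" "s' \<le> T"
  shows "g s \<eta> \<le> g s' \<eta> + drift s s' \<eta> + 2 * M\<^sup>2 * (s' - s)\<^sup>2"
proof -
  define h where "h = s' - s"
  have h: "0 \<le> h" using assms by (simp add: h_def)
  have M: "1 \<le> M" by (simp add: M_def)
  define k where "k r = (\<Sum>y<n. jump p A r y (g s') \<eta>)" for r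
  have k: "k r = (\<Sum>y<n. of_bool (legal A r y \<eta>) * (avg p y (g s') \<eta> - g s' \<eta>)) + real n * g s' \<eta>" for r
  proof -
    have "jump p A r y (g s') \<eta> = of_bool (legal A r y \<eta>) * (avg p y (g s') \<eta> - g s' \<eta>) + g s' \<eta>" for y
      by (simp add: jump_def)
    then show ?thesis by (simp add: k_def sum.distrib)
  qed
  have kint: "(\<lambda>r. of_bool (legal A r y \<eta>) * (avg p y (g s') \<eta> - g s' \<eta>)) integrable_on {s..s'}" for y
    by (intro integrable_on_mult_left of_bool_integrable) measurable
  have ksum: "(\<lambda>r. \<Sum>y<n. of_bool (legal A r y \<eta>) * (avg p y (g s') \<eta> - g s' \<eta>)) integrable_on {s..s'}"
    by (intro integrable_sum kint) auto
  have Ik: "integral {s..s'} k =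
      (\<Sum>y<n. legal_time s s' y \<eta> * (avg p y (g s') \<eta> - g s' \<eta>)) + real n * g s' \<eta> * h"
  proof -
    have "integral {s..s'} k = integral {s..s'} (\<lambda>r. \<Sum>y<n. of_bool (legal A r y \<eta>) * (avg p y (g s') \<eta> - g s' \<eta>))
        + integral {s..s'} (\<lambda>r. real n * g s' \<eta>)"
      unfolding k by (intro Henstock_Kurzweil_Integration.integral_add ksum integrable_const_ivl)
    also have "integral {s..s'} (\<lambda>r. \<Sum>y<n. of_bool (legal A r y \<eta>) * (avg p y (g s') \<eta> - g s' \<eta>)) =
        (\<Sum>y<n. integral {s..s'} (\<lambda>r. of_bool (legal A r y \<eta>) * (avg p y (g s') \<eta> - g s' \<eta>)))"
      by (intro Henstock_Kurzweil_Integration.integral_sum kint) auto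
    finally show ?thesis
      using assms by (simp add: legal_time_def h_def mult.commute)
  qed
  have k_int: "k integrable_on {s..s'}" unfolding k
    by (intro Henstock_Kurzweil_Integration.integrable_add ksum) auto
  have "integral {s..s'} (\<lambda>r. exp (- rate \<eta> * (r - s)) * jumps r \<eta>)
      \<le> integral {s..s'} (\<lambda>r. k r + real n * (M * h))"
  proof (intro integral_le weighted_jumps_integrable Henstock_Kurzweil_Integration.integrable_add k_int)
    fix r assume r: "r \<in> {s..s'}"
    have "exp (- rate \<eta> * (r - s)) * jumps r \<eta> \<le> 1 * jumps r \<eta>"
      using r jumps_bounds[of r \<eta>] rate[of \<eta>] by (intro mult_right_mono) auto
    also have "\<dots> \<le> (\<Sum>y<n. jump p A r y (\<lambda>\<xi>. g s' \<xi> + M * h) \<eta>)"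
      unfolding mult_1
    proof (intro sum_mono jump_mono)
      fix \<xi>
      have "\<bar>g r \<xi> - g s' \<xi>\<bar> \<le> M * (s' - r)" using r assms by (intro g_lipschitz) auto
      also have "\<dots> \<le> M * h" using r M by (intro mult_left_mono) (auto simp: h_def)
      finally show "g r \<xi> \<le> g s' \<xi> + M * h" by simp
    qed
    also have "\<dots> = k r + real n * (M * h)" by (simp add: jump_add_const k_def sum.distrib)
    finally show "exp (- rate \<eta> * (r - s)) * jumps r \<eta> \<le> k r + real n * (M * h)" .
  qed auto
  also have "\<dots> = integral {s..s'} k + real n * (M * h) * h"
    using assms by (subst Henstock_Kurzweil_Integration.integral_add[OF k_int]) (auto simp: h_def)
  finally have 1: "g s \<eta> \<le> exp (- rate \<eta> * h) * g s' \<eta> + integral {s..s'} k + real n * M * h\<^sup>2"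
    using g_step[OF assms, of \<eta>] by (simp add: h_def power2_eq_square mult.assoc)
  have "exp (- rate \<eta> * h) * g s' \<eta> \<le> (1 - rate \<eta> * h + (rate \<eta> * h)\<^sup>2) * g s' \<eta>"
    using exp_minus_le_quadratic[of "rate \<eta> * h"] rate[of \<eta>] h g_nonneg[of s' \<eta>]
    by (intro mult_right_mono) auto
  also have "\<dots> = g s' \<eta> - rate \<eta> * h * g s' \<eta> + (rate \<eta>)\<^sup>2 * h\<^sup>2 * g s' \<eta>"
    by (simp add: power2_eq_square algebra_simps)
  also have "(rate \<eta>)\<^sup>2 * h\<^sup>2 * g s' \<eta> \<le> M\<^sup>2 * h\<^sup>2 * 1"
    using rate[of \<eta>] g_nonneg[of s' \<eta>] g_le_1[of s' \<eta>] by (intro mult_mono[OF mult_right_mono] power_mono) auto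
  finally have 2: "exp (- rate \<eta> * h) * g s' \<eta> \<le> g s' \<eta> - rate \<eta> * h * g s' \<eta> + M\<^sup>2 * h\<^sup>2" by simp
  have 3: "real n * M * h\<^sup>2 \<le> M\<^sup>2 * h\<^sup>2"
    using M by (intro mult_right_mono) (auto simp: M_def power2_eq_square algebra_simps)
  have "integral {s..s'} k - rate \<eta> * h * g s' \<eta> = drift s s' \<eta>"
    unfolding Ik drift_def h_def[symmetric] rate_def by (simp add: algebra_simps)
  with 1 2 3 show ?thesis unfolding h_def[symmetric] by linarith
qed

section \<open>Decay of the squared norm\<close>

definition "phi s \<eta> = avgs p n (\<lambda>\<xi>. (g s \<xi>)\<^sup>2) \<eta>"

text \<open>On expanding the square of \<open>g s = g s' + \<Delta>\<close>, the cross term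
  integrates to minus the Dirichlet form with legal times as coefficients, minus the killing;
  coercivity bounds both through the seed time. The constant 5 collects
  \<open>\<Delta>\<^sup>2\<close> and twice the second-order error
  \<open>2 * M\<^sup>2\<close>.\<close>

lemma phi_step:
  assumes "0 \<le> s" "s \<le> s'" "s' \<le> T"
  shows "phi s \<eta> \<le> (1 - 2 * c * seed s s') * phi s' \<eta> + 5 * M\<^sup>2 * (s' - s)\<^sup>2"
proof -
  define h where "h = s' - s"
  have h: "0 \<le> h" using assms by (simp add: h_def)
  define a where "a = seed s s'"
  have a: "0 \<le> a" "a \<le> h" using seed_bounds[OF assms(2)] by (auto simp: a_def h_def)
  define f where "f = g s'"
  have "phi s \<eta> \<le> avgs p n (\<lambda>\<xi>. (f \<xi>)\<^sup>2 + 2 * (f \<xi> * drift s s' \<xi>) + 5 * M\<^sup>2 * h\<^sup>2) \<eta>"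
    unfolding phi_def
  proof (rule avgs_mono)
    fix \<xi>
    define \<Delta> where "\<Delta> = g s \<xi> - f \<xi>"
    have "\<bar>\<Delta>\<bar> \<le> M * h" using g_lipschitz[OF assms, of \<xi>] by (simp add: \<Delta>_def f_def h_def)
    then have "\<bar>\<Delta>\<bar>\<^sup>2 \<le> (M * h)\<^sup>2" by (intro power_mono) auto
    then have 1: "\<Delta>\<^sup>2 \<le> M\<^sup>2 * h\<^sup>2" by (simp add: power_mult_distrib)
    have "\<Delta> \<le> drift s s' \<xi> + 2 * M\<^sup>2 * h\<^sup>2"
      using g_le_drift[OF assms, of \<xi>] by (simp add: \<Delta>_def f_def h_def)
    then have "f \<xi> * \<Delta> \<le> f \<xi> * (drift s s' \<xi> + 2 * M\<^sup>2 * h\<^sup>2)"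
      using g_nonneg by (intro mult_left_mono) (auto simp: f_def)
    moreover have "f \<xi> * (2 * M\<^sup>2 * h\<^sup>2) \<le> 1 * (2 * M\<^sup>2 * h\<^sup>2)"
      using g_le_1 by (intro mult_right_mono) (auto simp: f_def)
    moreover have "(g s \<xi>)\<^sup>2 = (f \<xi>)\<^sup>2 + 2 * (f \<xi> * \<Delta>) + \<Delta>\<^sup>2"
      by (simp add: \<Delta>_def power2_eq_square algebra_simps)
    ultimately show "(g s \<xi>)\<^sup>2 \<le> (f \<xi>)\<^sup>2 + 2 * (f \<xi> * drift s s' \<xi>) + 5 * M\<^sup>2 * h\<^sup>2"
      using 1 by (simp add: algebra_simps)
  qed
  also have "\<dots> = phi s' \<eta> + 2 * avgs p n (\<lambda>\<xi>. f \<xi> * drift s s' \<xi>) \<eta> + 5 * M\<^sup>2 * h\<^sup>2"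
    by (simp only: avgs_add avgs_cmult avgs_const phi_def f_def)
  also have "avgs p n (\<lambda>\<xi>. f \<xi> * drift s s' \<xi>) \<eta> \<le> - (c * a * phi s' \<eta>)"
  proof -
    define U where "U = avgs p n (\<lambda>\<xi>. zero_at (n - 1) \<xi> * (f \<xi>)\<^sup>2) \<eta>"
    have U: "0 \<le> U" unfolding U_def by (intro avgs_nonneg) (auto simp: zero_at_def)
    have "(\<lambda>\<xi>. f \<xi> * drift s s' \<xi>) = (\<lambda>\<xi>. (\<Sum>y<n. legal_time s s' y \<xi> * (f \<xi> * (avg p y f \<xi> - f \<xi>)))
        - h * (zero_at (n - 1) \<xi> * (f \<xi>)\<^sup>2))"
      by (intro ext) (simp add: drift_def f_def h_def sum_distrib_left power2_eq_square algebra_simps)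
    then have "avgs p n (\<lambda>\<xi>. f \<xi> * drift s s' \<xi>) \<eta> =
      (\<Sum>y<n. avgs p n (\<lambda>\<xi>. legal_time s s' y \<xi> * (f \<xi> * (avg p y f \<xi> - f \<xi>))) \<eta>) - h * U"
      by (simp only: avgs_diff avgs_sum avgs_cmult U_def)
    also have "\<dots> = - (\<Sum>y<n. avgs p n (\<lambda>\<xi>. legal_time s s' y \<xi> * lvar p y f \<xi>) \<eta>) - h * U"
    proof -
      have "free_of y (legal_time s s' y)" for y
        by (cases y) (auto simp: free_of_def legal_time_def legal_def)
      then show ?thesis by (simp add: avgs_form_lvar sum_negf)
    qed
    also have "\<dots> \<le> - (\<Sum>y<n. a * energy n f \<eta> y) - a * U"
    proof -
      have "a * energy n f \<eta> y \<le> avgs p n (\<lambda>\<xi>. legal_time s s' y \<xi> * lvar p y f \<xi>) \<eta>" for y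
        unfolding energy_def avgs_cmult[symmetric, THEN fun_cong]
      proof (rule avgs_mono)
        fix \<xi>
        show "a * (dconstr y \<xi> * lvar p y f \<xi>) \<le> legal_time s s' y \<xi> * lvar p y f \<xi>"
          using mult_right_mono[OF legal_time_bounds(3)[OF assms(2)] lvar_nonneg, of y \<xi> y f \<xi>]
          by (simp add: a_def mult.assoc)
      qed
      then have "(\<Sum>y<n. a * energy n f \<eta> y) \<le> (\<Sum>y<n. avgs p n (\<lambda>\<xi>. legal_time s s' y \<xi> * lvar p y f \<xi>) \<eta>)"
        by (rule sum_mono)
      \<comment> \<open>The killing acts for the full length \<open>h\<close>; only the part
        \<open>a\<close> of it is kept, so that both terms of the coercive form carry the same
        factor.\<close>
      moreover have "a * U \<le> h * U" using a U by (intro mult_right_mono)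
      ultimately show ?thesis by linarith
    qed
    also have "\<dots> = - (a * ((\<Sum>y<n. energy n f \<eta> y) + U))"
      by (simp add: sum_distrib_left algebra_simps)
    also have "\<dots> \<le> - (a * (c * phi s' \<eta>))"
    proof (intro le_imp_neg_le mult_left_mono a(1))
      show "c * phi s' \<eta> \<le> (\<Sum>y<n. energy n f \<eta> y) + U"
        using coercive n unfolding coercive_def U_def phi_def f_def by blast
    qed
    finally show ?thesis by (simp add: mult_ac)
  qed
  finally show ?thesis by (simp add: a_def h_def algebra_simps)
qed

text \<open>The integrating factor \<open>exp (2 * c * seed s T)\<close> turns the one-step bound
  into monotonicity up to a quadratic error. The terminal value is 1 because \<open>g T\<close> is
  constantly 1.\<close>

lemma phi_decay: "phi 0 \<eta> \<le> exp (- 2 * c * seed 0 T)"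
proof -
  have comb: "seed s T = seed s s' + seed s' T" if "s \<le> s'" "s' \<le> T" for s s'
    unfolding seed_def using that
    by (intro Henstock_Kurzweil_Integration.integral_combine[symmetric] of_bool_integrable) auto
  define \<psi> where "\<psi> s = phi s \<eta> * exp (2 * c * seed s T)" for s
  have phi_nonneg: "0 \<le> phi s \<eta>" for s unfolding phi_def by (intro avgs_nonneg) simp
  have "\<psi> 0 \<le> \<psi> T"
  proof (rule quadratic_increments_le[OF T])
    fix s s' assume s: "0 \<le> s" "s \<le> s'" "s' \<le> T"
    define x where "x = 2 * c * seed s s'"
    have sT: "seed s T \<le> T" using seed_bounds[of s T] s by simp
    have "\<psi> s \<le> ((1 - x) * phi s' \<eta> + 5 * M\<^sup>2 * (s' - s)\<^sup>2) * exp (2 * c * seed s T)"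
      unfolding \<psi>_def x_def using phi_step[OF s, of \<eta>] by (intro mult_right_mono) (auto simp: mult_ac)
    also have "\<dots> = (1 - x) * exp x * (phi s' \<eta> * exp (2 * c * seed s' T)) + 5 * M\<^sup>2 * (s' - s)\<^sup>2 * exp (2 * c * seed s T)"
      by (simp add: comb[OF s(2,3)] x_def distrib_left exp_add algebra_simps)
    also have "\<dots> \<le> 1 * \<psi> s' + 5 * M\<^sup>2 * (s' - s)\<^sup>2 * exp (2 * c * T)"
    proof (intro add_mono)
      have "(1 - x) * exp x \<le> exp (- x) * exp x"
        using exp_ge_add_one_self[of "- x"] by (intro mult_right_mono) auto
      then have "(1 - x) * exp x \<le> 1" by (simp flip: exp_add)
      then show "(1 - x) * exp x * (phi s' \<eta> * exp (2 * c * seed s' T)) \<le> 1 * \<psi> s'"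
        unfolding \<psi>_def using phi_nonneg by (intro mult_right_mono) auto
      show "5 * M\<^sup>2 * (s' - s)\<^sup>2 * exp (2 * c * seed s T) \<le> 5 * M\<^sup>2 * (s' - s)\<^sup>2 * exp (2 * c * T)"
        using sT c by (intro mult_left_mono) auto
    qed
    finally show "\<psi> s \<le> \<psi> s' + (5 * M\<^sup>2 * exp (2 * c * T)) * (s' - s)\<^sup>2" by (simp add: mult_ac)
  qed
  also have "\<psi> T = 1"
    using g_eq[of T] T by (simp add: \<psi>_def phi_def seed_def avgs_const)
  finally show ?thesis by (simp add: \<psi>_def exp_minus field_simps)
qed

theorem decay:
  assumes "\<And>i. i < n \<Longrightarrow> \<eta> i \<in> {0, 1}"
  shows "g 0 \<eta> \<le> (1 / min p (1 - p)) ^ n * exp (- c * integral {0..T} (\<lambda>r. of_bool (A r 0)))"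
proof (rule power2_le_imp_le)
  define m where "m = min p (1 - p)"
  have m: "0 < m" "m \<le> 1" using p_pos p_less by (auto simp: m_def)
  have "m ^ n * (g 0 \<eta>)\<^sup>2 \<le> exp (- 2 * c * seed 0 T)"
    using avgs_ge[of "\<lambda>\<xi>. (g 0 \<xi>)\<^sup>2" n \<eta>] assms phi_decay[of \<eta>] by (simp add: phi_def m_def)
  then have "(g 0 \<eta>)\<^sup>2 \<le> (1 / m) ^ n * exp (- 2 * c * seed 0 T)"
    using m by (simp add: field_simps)
  \<comment> \<open>The prefactor is squared so that taking the root leaves a natural power.\<close>
  also have "\<dots> \<le> ((1 / m) ^ n * (1 / m) ^ n) * exp (- 2 * c * seed 0 T)"
    using m one_le_power[of "1 / m" n] by (intro mult_right_mono) auto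
  also have "\<dots> = ((1 / m) ^ n * exp (- c * seed 0 T))\<^sup>2"
    by (simp add: power2_eq_square algebra_simps flip: exp_add)
  finally show "(g 0 \<eta>)\<^sup>2 \<le> ((1 / min p (1 - p)) ^ n * exp (- c * integral {0..T} (\<lambda>r. of_bool (A r 0))))\<^sup>2"
    by (simp add: m_def seed_def)
qed (use p_pos p_less in simp)

end

section \<open>Exponential clocks\<close>

definition marks :: "real \<Rightarrow> (real \<times> bool) measure" where
  "marks p = density lborel (exponential_density 1) \<Otimes>\<^sub>M measure_pmf (bernoulli_pmf p)"

definition marks_on :: "real \<Rightarrow> 'i set \<Rightarrow> ('i \<Rightarrow> real \<times> bool) measure" where
  "marks_on p I = (\<Pi>\<^sub>M j\<in>I. marks p)"

lemma prob_space_marks: "prob_space (marks p)"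
  unfolding marks_def
  by (intro prob_space_pair prob_space_exponential_density prob_space_measure_pmf) simp

lemma prob_space_marks_on: "prob_space (marks_on p I)"
  unfolding marks_on_def by (intro prob_space_PiM prob_space_marks)

lemma sets_marks [measurable_cong]: "sets (marks p) = sets (borel \<Otimes>\<^sub>M count_space UNIV)"
  unfolding marks_def by (intro sets_pair_measure_cong) auto

lemma space_marks [simp]: "space (marks p) = UNIV"
  by (simp add: marks_def space_pair_measure)

lemma measurable_mark:
  "j \<in> I \<Longrightarrow> (\<lambda>\<omega>. \<omega> j) \<in> marks_on p I \<rightarrow>\<^sub>M marks p"
  unfolding marks_on_def by (rule measurable_component_singleton)

lemma measurable_fst_mark:
  "j \<in> I \<Longrightarrow> (\<lambda>\<omega>. fst (\<omega> j)) \<in> borel_measurable (marks_on p I)"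
  by (rule measurable_compose[OF measurable_mark]) (simp_all add: measurable_cong_sets[OF sets_marks refl])

lemma measurable_snd_mark:
  "j \<in> I \<Longrightarrow> (\<lambda>\<omega>. snd (\<omega> j)) \<in> marks_on p I \<rightarrow>\<^sub>M count_space UNIV"
  by (rule measurable_compose[OF measurable_mark]) (simp_all add: measurable_cong_sets[OF sets_marks refl])

lemma measurable_to_marks_on:
  assumes "\<And>\<omega>. \<omega> \<in> space N \<Longrightarrow> f \<omega> \<in> extensional I" "\<And>j. j \<in> I \<Longrightarrow> (\<lambda>\<omega>. f \<omega> j) \<in> N \<rightarrow>\<^sub>M marks p"
  shows "f \<in> N \<rightarrow>\<^sub>M marks_on p I"
  unfolding marks_on_def
proof (rule measurable_PiM_single')
  show "f \<in> space N \<rightarrow> (\<Pi>\<^sub>E i\<in>I. space (marks p))"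
    using assms(1) by (auto simp: PiE_def)
qed (use assms(2) in auto)

lemma nn_integral_marks:
  assumes [measurable]: "f \<in> borel_measurable (borel \<Otimes>\<^sub>M count_space UNIV)" and p: "0 < p" "p < 1"
  shows "(\<integral>\<^sup>+ z. f z \<partial>marks p) = (\<integral>\<^sup>+ r. ennreal (indicator {0..} r * exp (- r)) *
     (ennreal p * f (r, True) + ennreal (1 - p) * f (r, False)) \<partial>lborel)"
proof -

  have [measurable]: "f \<in> borel_measurable (borel \<Otimes>\<^sub>M measure_pmf (bernoulli_pmf p))"
  proof -
    have "sets (borel \<Otimes>\<^sub>M measure_pmf (bernoulli_pmf p)) = sets (borel \<Otimes>\<^sub>M count_space UNIV :: (real \<times> bool) measure)"
      by (intro sets_pair_measure_cong) auto
    from measurable_cong_sets[OF this refl] assms(1) show ?thesis by blast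
  qed
  have "(\<integral>\<^sup>+ z. f z \<partial>marks p) = (\<integral>\<^sup>+ r. \<integral>\<^sup>+ b. f (r, b) \<partial>measure_pmf (bernoulli_pmf p) \<partial>density lborel (exponential_density 1))"
    unfolding marks_def by (rule measure_pmf.nn_integral_fst[symmetric]) measurable
  also have "\<dots> = (\<integral>\<^sup>+ r. ennreal (exponential_density 1 r) * (\<integral>\<^sup>+ b. f (r, b) \<partial>measure_pmf (bernoulli_pmf p)) \<partial>lborel)"
    by (intro nn_integral_density) measurable
  also have "\<dots> = (\<integral>\<^sup>+ r. ennreal (indicator {0..} r * exp (- r)) *
     (ennreal p * f (r, True) + ennreal (1 - p) * f (r, False)) \<partial>lborel)"
  proof (intro nn_integral_cong arg_cong2[where f = "(*)"])
    fix r
    show "ennreal (exponential_density 1 r) = ennreal (indicator {0..} r * exp (- r))"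
      by (auto simp: exponential_density_def)
    show "(\<integral>\<^sup>+ b. f (r, b) \<partial>measure_pmf (bernoulli_pmf p)) = ennreal p * f (r, True) + ennreal (1 - p) * f (r, False)"
      using p by (subst nn_integral_bernoulli_pmf) (auto simp: mult.commute)
  qed
  finally show ?thesis .
qed

lemma AE_marks_fst:
  assumes S: "S \<in> sets borel" "AE r in lborel. r \<notin> S \<inter> {0..}" and p: "0 < p" "p < 1"
  shows "AE z in marks p. fst z \<notin> S"
proof -
  note [measurable] = S(1)
  have "(\<integral>\<^sup>+ z. indicator S (fst z) \<partial>marks p) =
      (\<integral>\<^sup>+ r. ennreal (indicator {0..} r * exp (- r)) *
     (ennreal p * indicator S r + ennreal (1 - p) * indicator S r) \<partial>lborel)"
    using p by (subst nn_integral_marks) auto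
  also have "\<dots> = (\<integral>\<^sup>+ (r::real). 0 \<partial>lborel)"
    using S(2) by (intro nn_integral_cong_AE) (auto elim!: eventually_mono simp: indicator_def)
  finally have "(\<integral>\<^sup>+ z. indicator S (fst z) \<partial>marks p) = 0" by simp
  moreover have "(\<lambda>z. indicator S (fst z) :: ennreal) \<in> borel_measurable (marks p)"
    by (subst measurable_cong_sets[OF sets_marks refl]) measurable
  ultimately have "AE z in marks p. indicator S (fst z) = (0 :: ennreal)"
    by (subst (asm) nn_integral_0_iff_AE) auto
  then show ?thesis by (auto elim!: eventually_mono simp: indicator_def split: if_splits)
qed

lemma AE_marks_nonneg: "0 < p \<Longrightarrow> p < 1 \<Longrightarrow> AE z in marks p. 0 \<le> fst z"
  using AE_marks_fst[of "{..<0}" p] by (simp add: not_less)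

lemma AE_marks_neq:
  assumes "0 < p" "p < 1"
  shows "AE z in marks p. fst z \<noteq> a"
proof -
  have "AE r in lborel. r \<notin> {a} \<inter> {0..}"
    by (rule eventually_mono[OF AE_lborel_singleton[of a]]) simp
  from AE_marks_fst[OF _ this assms] show ?thesis by simp
qed

text \<open>Lack of memory: the exponential density factorises at \<open>r + x\<close>, and the coin
  is unaffected by the shift.\<close>

lemma nn_integral_marks_memoryless:
  assumes [measurable]: "f \<in> borel_measurable (borel \<Otimes>\<^sub>M count_space UNIV)" and p: "0 < p" "p < 1" and r: "0 \<le> r"
  shows "(\<integral>\<^sup>+ z. indicator {r<..} (fst z) * f (fst z - r, snd z) \<partial>marks p) = ennreal (exp (- r)) * (\<integral>\<^sup>+ z. f z \<partial>marks p)"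
proof -
  define h where "h x = ennreal p * f (x, True) + ennreal (1 - p) * f (x, False)" for x
  have [measurable]: "h \<in> borel_measurable borel" unfolding h_def by measurable
  have "(\<integral>\<^sup>+ z. indicator {r<..} (fst z) * f (fst z - r, snd z) \<partial>marks p) =
     (\<integral>\<^sup>+ x. ennreal (indicator {0..} x * exp (- x)) * (ennreal p * (indicator {r<..} x * f (x - r, True)) +
       ennreal (1 - p) * (indicator {r<..} x * f (x - r, False))) \<partial>lborel)"
    using p by (subst nn_integral_marks) auto
  also have "\<dots> = (\<integral>\<^sup>+ x. ennreal (indicator {0..} x * exp (- x)) * (indicator {r<..} x * h (x - r)) \<partial>lborel)"
    by (intro nn_integral_cong) (auto simp: h_def indicator_def)
  also have "\<dots> = (\<integral>\<^sup>+ x. ennreal (indicator {0..} (r + x) * exp (- (r + x))) * (indicator {r<..} (r + x) * h x) \<partial>lborel)"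
    by (subst nn_integral_real_affine[where t = r and c = 1]) auto
  also have "\<dots> = (\<integral>\<^sup>+ x. ennreal (exp (- r)) * (ennreal (indicator {0..} x * exp (- x)) * h x) \<partial>lborel)"
  proof (intro nn_integral_cong_AE eventually_mono[OF AE_lborel_singleton[of 0]])
    \<comment> \<open>The conditions \<open>r < r + x\<close> and \<open>0 \<le> x\<close> differ at
      0, which is therefore removed as a null set.\<close>
    fix x :: real assume "x \<noteq> 0"
    then consider "x < 0" | "0 < x" by linarith
    then show "ennreal (indicator {0..} (r + x) * exp (- (r + x))) * (indicator {r<..} (r + x) * h x) =
        ennreal (exp (- r)) * (ennreal (indicator {0..} x * exp (- x)) * h x)"
    proof cases
      case 2
      have "exp (- (r + x)) = exp (- r) * exp (- x)" by (simp flip: exp_add)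
      then have "ennreal (exp (- (r + x))) = ennreal (exp (- r)) * ennreal (exp (- x))"
        by (simp only: ennreal_mult' exp_ge_zero)
      then show ?thesis using 2 r by (simp add: mult.assoc)
    qed simp
  qed
  also have "\<dots> = ennreal (exp (- r)) * (\<integral>\<^sup>+ z. f z \<partial>marks p)"
    using p by (subst nn_integral_cmult) (auto simp: nn_integral_marks h_def)
  finally show ?thesis .
qed

section \<open>Several independent clocks\<close>

lemma nn_integral_marks_on_insert:
  assumes "j \<in> I" and [measurable]: "f \<in> borel_measurable (marks_on p I)"
  shows "(\<integral>\<^sup>+ \<omega>. f \<omega> \<partial>marks_on p I) = (\<integral>\<^sup>+ X. \<integral>\<^sup>+ z. f (X(j := z)) \<partial>marks p \<partial>marks_on p (I - {j}))"
proof -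
  interpret M: prob_space "marks p" by (rule prob_space_marks)
  interpret X: prob_space "marks_on p (I - {j})" by (rule prob_space_marks_on)
  interpret MX: pair_sigma_finite "marks p" "marks_on p (I - {j})" ..
  have I: "insert j (I - {j}) = I" using assms(1) by auto
  have *: "distr (marks p \<Otimes>\<^sub>M marks_on p (I - {j})) (marks_on p I) (\<lambda>(x, X). X(j := x)) = marks_on p I"
    using distr_pair_PiM_eq_PiM[of "I - {j}" "\<lambda>_. marks p" j, OF prob_space_marks prob_space_marks]
    unfolding I marks_on_def .
  have [measurable]: "(\<lambda>(x, X). X(j := x)) \<in> marks p \<Otimes>\<^sub>M marks_on p (I - {j}) \<rightarrow>\<^sub>M marks_on p I"
    unfolding marks_on_def by (subst (2) I[symmetric]) measurable
  have "(\<integral>\<^sup>+ \<omega>. f \<omega> \<partial>marks_on p I) = (\<integral>\<^sup>+ (x, X). f (X(j := x)) \<partial>(marks p \<Otimes>\<^sub>M marks_on p (I - {j})))"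
    by (subst *[symmetric], subst nn_integral_distr) (auto simp: case_prod_beta')
  also have "\<dots> = (\<integral>\<^sup>+ X. \<integral>\<^sup>+ z. f (X(j := z)) \<partial>marks p \<partial>marks_on p (I - {j}))"
    using MX.nn_integral_snd[of "\<lambda>(x, X). f (X(j := x))"] by (simp add: case_prod_beta')
  finally show ?thesis .
qed

text \<open>Marks as seen \<open>r\<close> time units later: the waiting times indexed by
  \<open>J\<close> are pending ones, of which \<open>r\<close> has elapsed.\<close>

definition delay :: "real \<Rightarrow> (nat \<times> nat) set \<Rightarrow> (nat \<times> nat \<Rightarrow> real \<times> bool) \<Rightarrow> nat \<times> nat \<Rightarrow> real \<times> bool" where
  "delay r J \<omega> = (\<lambda>j. if j \<in> J then (fst (\<omega> j) - r, snd (\<omega> j)) else \<omega> j)"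

lemma measurable_delay:
  assumes "J \<subseteq> I"
  shows "(\<lambda>(r, \<omega>). delay r J \<omega>) \<in> borel \<Otimes>\<^sub>M marks_on p I \<rightarrow>\<^sub>M marks_on p I"
proof (rule measurable_to_marks_on)
  fix z assume "z \<in> space (borel \<Otimes>\<^sub>M marks_on p I :: (real \<times> _) measure)"
  then have "snd z \<in> extensional I"
    by (auto simp: space_pair_measure marks_on_def space_PiM PiE_def)
  then show "(\<lambda>(r, \<omega>). delay r J \<omega>) z \<in> extensional I"
    using assms by (auto simp: delay_def extensional_def case_prod_beta')
next
  fix j assume j: "j \<in> I"
  note [measurable] = measurable_mark[OF j] measurable_fst_mark[OF j] measurable_snd_mark[OF j]
  show "(\<lambda>z. (\<lambda>(r, \<omega>). delay r J \<omega>) z j) \<in> borel \<Otimes>\<^sub>M marks_on p I \<rightarrow>\<^sub>M marks p"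
  proof (cases "j \<in> J")
    case True
    have "(\<lambda>z. (fst (snd z j) - fst z, snd (snd z j))) \<in> borel \<Otimes>\<^sub>M marks_on p I \<rightarrow>\<^sub>M borel \<Otimes>\<^sub>M count_space UNIV"
      by measurable
    then show ?thesis using True
      by (simp add: delay_def case_prod_beta' measurable_cong_sets[OF refl sets_marks])
  qed (simp add: delay_def case_prod_beta')
qed

lemma measurable_delay': "J \<subseteq> I \<Longrightarrow> delay r J \<in> marks_on p I \<rightarrow>\<^sub>M marks_on p I"
  using measurable_compose[OF measurable_Pair1' measurable_delay, of r] by simp

lemma nn_integral_delay_single:
  assumes j: "j \<in> I" and f: "f \<in> borel_measurable (marks_on p I)" and p: "0 < p" "p < 1" and r: "0 \<le> r"
  shows "(\<integral>\<^sup>+ \<omega>. indicator {r<..} (fst (\<omega> j)) * f (delay r {j} \<omega>) \<partial>marks_on p I) =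
    ennreal (exp (- r)) * (\<integral>\<^sup>+ \<omega>. f \<omega> \<partial>marks_on p I)"
proof -
  note [measurable] = f measurable_fst_mark[OF j] measurable_delay'[of "{j}" I r p]
  have I: "insert j (I - {j}) = I" using j by auto
  have upd [measurable]: "(\<lambda>z. X(j := z)) \<in> borel \<Otimes>\<^sub>M count_space UNIV \<rightarrow>\<^sub>M marks_on p I"
    if "X \<in> space (marks_on p (I - {j}))" for X
  proof -
    have "(\<lambda>z. X(j := z)) \<in> marks p \<rightarrow>\<^sub>M marks_on p I"
      using that j
      by (intro measurable_to_marks_on) (auto simp: marks_on_def space_PiM PiE_def extensional_def)
    then show ?thesis by (simp add: measurable_cong_sets[OF sets_marks refl])
  qed
  have "(\<integral>\<^sup>+ \<omega>. indicator {r<..} (fst (\<omega> j)) * f (delay r {j} \<omega>) \<partial>marks_on p I) =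
     (\<integral>\<^sup>+ X. \<integral>\<^sup>+ z. indicator {r<..} (fst z) * f (X(j := (fst z - r, snd z))) \<partial>marks p \<partial>marks_on p (I - {j}))"
  proof (subst nn_integral_marks_on_insert[OF j])
    have "delay r {j} (X(j := z)) = X(j := (fst z - r, snd z))" for X z
      by (auto simp: delay_def)
    then show "(\<integral>\<^sup>+ X. \<integral>\<^sup>+ z. indicator {r<..} (fst ((X(j := z)) j)) * f (delay r {j} (X(j := z))) \<partial>marks p \<partial>marks_on p (I - {j}))
      = (\<integral>\<^sup>+ X. \<integral>\<^sup>+ z. indicator {r<..} (fst z) * f (X(j := (fst z - r, snd z))) \<partial>marks p \<partial>marks_on p (I - {j}))"
      by simp
  qed (use j in \<open>auto intro!: borel_measurable_times_ennreal measurable_compose[OF measurable_fst_mark[OF j]]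
      measurable_compose[OF measurable_delay' f]\<close>)
  also have "\<dots> = (\<integral>\<^sup>+ X. ennreal (exp (- r)) * (\<integral>\<^sup>+ z. f (X(j := z)) \<partial>marks p) \<partial>marks_on p (I - {j}))"
  proof (intro nn_integral_cong)
    fix X assume X: "X \<in> space (marks_on p (I - {j}))"
    note [measurable] = upd[OF X]
    show "(\<integral>\<^sup>+ z. indicator {r<..} (fst z) * f (X(j := (fst z - r, snd z))) \<partial>marks p)
        = ennreal (exp (- r)) * (\<integral>\<^sup>+ z. f (X(j := z)) \<partial>marks p)"
      using nn_integral_marks_memoryless[of "\<lambda>z. f (X(j := z))" p r] p r by simp
  qed
  also have "\<dots> = ennreal (exp (- r)) * (\<integral>\<^sup>+ X. \<integral>\<^sup>+ z. f (X(j := z)) \<partial>marks p \<partial>marks_on p (I - {j}))"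
  proof (rule nn_integral_cmult)
    interpret M: prob_space "marks p" by (rule prob_space_marks)
    have "(\<lambda>(X, x). X(j := x)) \<in> marks_on p (I - {j}) \<Otimes>\<^sub>M marks p \<rightarrow>\<^sub>M marks_on p I"
      unfolding marks_on_def by (subst (2) I[symmetric]) measurable
    from measurable_compose[OF this f]
    have "(\<lambda>(X, x). f (X(j := x))) \<in> borel_measurable (marks_on p (I - {j}) \<Otimes>\<^sub>M marks p)"
      by (simp add: case_prod_beta')
    then show "(\<lambda>X. \<integral>\<^sup>+ z. f (X(j := z)) \<partial>marks p) \<in> borel_measurable (marks_on p (I - {j}))"
      by (rule M.borel_measurable_nn_integral)
  qed
  also have "\<dots> = ennreal (exp (- r)) * (\<integral>\<^sup>+ \<omega>. f \<omega> \<partial>marks_on p I)"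
    using nn_integral_marks_on_insert[OF j f] by simp
  finally show ?thesis .
qed

text \<open>Memorylessness one index at a time: if all clocks in \<open>J\<close> outlast
  \<open>r\<close>, the residual noise is fresh, and each clock contributes its survival probability
  \<open>exp (- r)\<close>.\<close>

lemma nn_integral_delay:
  assumes "finite J" "J \<subseteq> I" and f: "f \<in> borel_measurable (marks_on p I)" and p: "0 < p" "p < 1" and r: "0 \<le> r"
  shows "(\<integral>\<^sup>+ \<omega>. (\<Prod>j\<in>J. indicator {r<..} (fst (\<omega> j))) * f (delay r J \<omega>) \<partial>marks_on p I) =
    ennreal (exp (- r * card J)) * (\<integral>\<^sup>+ \<omega>. f \<omega> \<partial>marks_on p I)"
  using assms(1,2)
proof (induction J rule: finite_induct)
  case empty
  then show ?case by (simp add: delay_def)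
next
  case (insert i J)
  define h where "h \<omega> = (\<Prod>j\<in>J. indicator {r<..} (fst (\<omega> j))) * f (delay r J \<omega>)" for \<omega>
  have h: "h \<in> borel_measurable (marks_on p I)"
  proof -
    note [measurable] = f measurable_delay'[of J I r p]
    have "(\<lambda>\<omega>. \<Prod>j\<in>J. indicator {r<..} (fst (\<omega> j)) :: ennreal) \<in> borel_measurable (marks_on p I)"
      using insert.prems
      by (intro borel_measurable_prod_ennreal measurable_compose[OF measurable_fst_mark]) auto
    moreover have "J \<subseteq> I" using insert.prems by auto
    ultimately show ?thesis unfolding h_def by measurable
  qed
  have "(\<Prod>j\<in>insert i J. indicator {r<..} (fst (\<omega> j))) * f (delay r (insert i J) \<omega>) =
      indicator {r<..} (fst (\<omega> i)) * h (delay r {i} \<omega>)" for \<omega>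
  proof -
    have "delay r (insert i J) \<omega> = delay r J (delay r {i} \<omega>)"
      using insert.hyps by (auto simp: delay_def fun_eq_iff)
    moreover have "(\<Prod>j\<in>J. indicator {r<..} (fst (\<omega> j))) = (\<Prod>j\<in>J. indicator {r<..} (fst (delay r {i} \<omega> j)) :: ennreal)"
      using insert.hyps by (intro prod.cong) (auto simp: delay_def)
    ultimately show ?thesis using insert.hyps by (simp add: h_def mult.assoc)
  qed
  then have "(\<integral>\<^sup>+ \<omega>. (\<Prod>j\<in>insert i J. indicator {r<..} (fst (\<omega> j))) * f (delay r (insert i J) \<omega>) \<partial>marks_on p I)
     = ennreal (exp (- r)) * (\<integral>\<^sup>+ \<omega>. h \<omega> \<partial>marks_on p I)"
    using nn_integral_delay_single[of i I h p r] h insert.prems p r by simp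
  also have "\<dots> = ennreal (exp (- r)) * (ennreal (exp (- r * card J)) * (\<integral>\<^sup>+ \<omega>. f \<omega> \<partial>marks_on p I))"
    using insert unfolding h_def by simp
  also have "\<dots> = ennreal (exp (- r * card (insert i J))) * (\<integral>\<^sup>+ \<omega>. f \<omega> \<partial>marks_on p I)"
    using insert.hyps
    by (simp add: mult.assoc[symmetric] ennreal_mult'[symmetric] algebra_simps flip: exp_add)
  finally show ?case .
qed

section \<open>Removing the first mark of a site\<close>

abbreviation line_index :: "nat \<Rightarrow> (nat \<times> nat) set" where
  "line_index n \<equiv> {..<n} \<times> UNIV"

abbreviation line_noise :: "real \<Rightarrow> nat \<Rightarrow> (nat \<times> nat \<Rightarrow> real \<times> bool) measure" where
  "line_noise p n \<equiv> marks_on p (line_index n)"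

text \<open>The first mark of \<open>y\<close> is used up and its later marks are renumbered from 0;
  the other sites keep their marks.\<close>

definition drop_first :: "nat \<Rightarrow> nat \<Rightarrow> (nat \<times> nat \<Rightarrow> real \<times> bool) \<Rightarrow> nat \<times> nat \<Rightarrow> real \<times> bool" where
  "drop_first n y \<omega> = (\<lambda>j\<in>line_index n. \<omega> (if fst j = y then (y, Suc (snd j)) else j))"

lemma measurable_drop_first:
  "y < n \<Longrightarrow> drop_first n y \<in> line_noise p n \<rightarrow>\<^sub>M line_noise p n"
  by (rule measurable_to_marks_on) (auto simp: drop_first_def intro!: measurable_mark)

text \<open>Renumbering is an injection into the indices other than \<open>(y, 0)\<close>, so the
  renumbered noise has the original law and is independent of the removed mark.\<close>

lemma nn_integral_drop_first:
  assumes y: "y < n" and f: "f \<in> borel_measurable (marks p \<Otimes>\<^sub>M line_noise p n)"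
  shows "(\<integral>\<^sup>+ \<omega>. f (\<omega> (y, 0), drop_first n y \<omega>) \<partial>line_noise p n) =
    (\<integral>\<^sup>+ z. \<integral>\<^sup>+ \<omega>. f (z, \<omega>) \<partial>line_noise p n \<partial>marks p)"
proof -
  define I where "I = line_index n"
  define I' where "I' = I - {(y, 0)}"
  define \<phi> :: "nat \<times> nat \<Rightarrow> nat \<times> nat" where "\<phi> j = (if fst j = y then (y, Suc (snd j)) else j)" for j
  have y0: "(y, 0) \<in> I" using y by (simp add: I_def)
  have \<phi>: "inj_on \<phi> I" "\<phi> \<in> I \<rightarrow> I'"
    using y by (auto simp: inj_on_def \<phi>_def I_def I'_def split: if_splits)
  have d: "distr (marks_on p I') (marks_on p I) (\<lambda>\<omega>. \<lambda>j\<in>I. \<omega> (\<phi> j)) = marks_on p I"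
    unfolding marks_on_def using distr_PiM_reindex[OF _ \<phi>, of "\<lambda>_. marks p"] by (simp add: prob_space_marks)
  have [measurable]: "(\<lambda>\<omega>. \<lambda>j\<in>I. \<omega> (\<phi> j)) \<in> marks_on p I' \<rightarrow>\<^sub>M marks_on p I"
    using \<phi>(2) by (intro measurable_to_marks_on) (auto intro!: measurable_mark)
  interpret M: prob_space "marks p" by (rule prob_space_marks)
  interpret X: prob_space "marks_on p I" by (rule prob_space_marks_on)
  interpret MX: pair_sigma_finite "marks p" "marks_on p I" ..
  note [measurable] = f[folded I_def] measurable_drop_first[OF y, of p, folded I_def] measurable_mark[OF y0]
  have "(\<integral>\<^sup>+ \<omega>. f (\<omega> (y, 0), drop_first n y \<omega>) \<partial>marks_on p I) =
     (\<integral>\<^sup>+ X. \<integral>\<^sup>+ z. f (z, \<lambda>j\<in>I. X (\<phi> j)) \<partial>marks p \<partial>marks_on p I')"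
  proof (subst nn_integral_marks_on_insert[OF y0])
    have "drop_first n y (X((y, 0) := z)) = (\<lambda>j\<in>I. X (\<phi> j))" for X z
      by (auto simp: drop_first_def \<phi>_def I_def fun_eq_iff)
    then show "(\<integral>\<^sup>+ X. \<integral>\<^sup>+ z. f ((X((y, 0) := z)) (y, 0), drop_first n y (X((y, 0) := z))) \<partial>marks p \<partial>marks_on p (I - {(y, 0)}))
      = (\<integral>\<^sup>+ X. \<integral>\<^sup>+ z. f (z, \<lambda>j\<in>I. X (\<phi> j)) \<partial>marks p \<partial>marks_on p I')"
      by (simp add: I'_def)
  qed measurable
  also have "\<dots> = (\<integral>\<^sup>+ \<omega>. \<integral>\<^sup>+ z. f (z, \<omega>) \<partial>marks p \<partial>marks_on p I)"
    by (subst d[symmetric], subst nn_integral_distr) auto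
  also have "\<dots> = (\<integral>\<^sup>+ z. \<integral>\<^sup>+ \<omega>. f (z, \<omega>) \<partial>marks_on p I \<partial>marks p)"
    by (rule MX.Fubini') measurable
  finally show ?thesis unfolding I_def .
qed

section \<open>The process on a line in a given environment\<close>

text \<open>Makes the guard \<open>0 < i\<close> available to the recursion below, since
  \<open>i - 1\<close> is smaller than \<open>i\<close> only under it.\<close>

declare conj_cong [fundef_cong]

definition lring :: "(nat \<times> nat \<Rightarrow> real \<times> bool) \<Rightarrow> nat \<Rightarrow> nat \<Rightarrow> real" where
  "lring W i k = (\<Sum>j\<le>k. fst (W (i, j)))"

text \<open>Line analogue of \<open>spin_after\<close>. Zeros off the line enter only through
  \<open>A\<close>, read at absolute time; the starting time \<open>s\<close> is a parameter so that
  the process can be restarted at its first ring.\<close>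

function lspin ::
    "(real \<Rightarrow> nat \<Rightarrow> bool) \<Rightarrow> real \<Rightarrow> (nat \<Rightarrow> nat) \<Rightarrow> (nat \<times> nat \<Rightarrow> real \<times> bool) \<Rightarrow> nat \<Rightarrow> nat \<Rightarrow> nat" where
  "lspin A s \<eta> W i 0 = \<eta> i"
| "lspin A s \<eta> W i (Suc k) =
     (if A (s + lring W i k) i \<or>
         (0 < i \<and> lspin A s \<eta> W (i - 1) (card {j. lring W (i - 1) j < lring W i k}) = 0)
      then of_bool (snd (W (i, k)))
      else lspin A s \<eta> W i k)"
  by pat_completeness auto
termination
  by (relation "measures [\<lambda>(A, s, \<eta>, W, i, k). i, \<lambda>(A, s, \<eta>, W, i, k). k]") auto

definition lstate ::
    "(real \<Rightarrow> nat \<Rightarrow> bool) \<Rightarrow> real \<Rightarrow> (nat \<Rightarrow> nat) \<Rightarrow> (nat \<times> nat \<Rightarrow> real \<times> bool) \<Rightarrow> real \<Rightarrow> nat \<Rightarrow> nat" where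
  "lstate A s \<eta> W t i = lspin A s \<eta> W i (card {j. s + lring W i j \<le> t})"

text \<open>Noise of the restarted process: \<open>y\<close> moves on to its next mark, and every
  other site has the elapsed time deducted from its pending waiting time.\<close>

definition after_first :: "nat \<Rightarrow> nat \<Rightarrow> (nat \<times> nat \<Rightarrow> real \<times> bool) \<Rightarrow> nat \<times> nat \<Rightarrow> real \<times> bool" where
  "after_first n y W = delay (fst (W (y, 0))) (({..<n} - {y}) \<times> {0}) (drop_first n y W)"

definition flip_at ::
    "(real \<Rightarrow> nat \<Rightarrow> bool) \<Rightarrow> real \<Rightarrow> nat \<Rightarrow> (nat \<Rightarrow> nat) \<Rightarrow> bool \<Rightarrow> nat \<Rightarrow> nat" where
  "flip_at A r y \<eta> b = (if legal A r y \<eta> then \<eta>(y := of_bool b) else \<eta>)"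

section \<open>Pathwise restart at the first ring\<close>

lemma lring_ge_first:
  assumes "\<And>k. 0 \<le> fst (W (i, k))"
  shows "fst (W (i, 0)) \<le> lring W i k"
proof (induction k)
  case (Suc k)
  with assms[of "Suc k"] show ?case by (simp add: lring_def)
qed (simp add: lring_def)

text \<open>Typical noise for which \<open>y\<close> is the strict winner of the race to ring first.
  Local finiteness matters because rings are counted by \<open>card\<close>, which is 0 on infinite
  sets.\<close>

locale first_ring =
  fixes n y :: nat and W :: "nat \<times> nat \<Rightarrow> real \<times> bool"
  assumes y: "y < n"
    and nonneg: "\<And>i k. i < n \<Longrightarrow> 0 \<le> fst (W (i, k))"
    and locally_finite: "\<And>i t. i < n \<Longrightarrow> finite {k. lring W i k \<le> t}"
    and first: "\<And>i. i < n \<Longrightarrow> i \<noteq> y \<Longrightarrow> fst (W (y, 0)) < fst (W (i, 0))"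
begin

definition "\<rho> = fst (W (y, 0))"

definition "W' = after_first n y W"

lemma lring_after:
  assumes "i < n"
  shows "lring W i (k + of_bool (i = y)) = \<rho> + lring W' i k"
proof (cases "i = y")
  case True
  have "lring W y (Suc k) = fst (W (y, 0)) + (\<Sum>j\<le>k. fst (W (y, Suc j)))"
    unfolding lring_def by (rule sum.atMost_Suc_shift)
  then show ?thesis
    using True y by (simp add: \<rho>_def W'_def lring_def after_first_def delay_def drop_first_def)
next
  case False
  show ?thesis
    using False assms
    by (induction k) (auto simp: \<rho>_def W'_def lring_def after_first_def delay_def drop_first_def)
qed

lemma lring_gt: "i < n \<Longrightarrow> i \<noteq> y \<Longrightarrow> \<rho> < lring W i k"
  using first[of i] lring_ge_first[of W i k] nonneg[of i] by (simp add: \<rho>_def)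

lemma lring_ge: "i < n \<Longrightarrow> \<rho> \<le> lring W i k"
  using lring_gt[of i k] lring_ge_first[of W y k] nonneg[of y] by (cases "i = y") (auto simp: \<rho>_def)

lemma lring_y_0: "lring W y 0 = \<rho>"
  by (simp add: lring_def \<rho>_def)

text \<open>Only site \<open>y\<close> loses a ring in the restarted noise, the one at time
  \<open>\<rho>\<close>, and the indicator puts it back into the count. The bound \<open>t\<close>
  keeps the counted set finite.\<close>

lemma card_split:
  assumes i: "i < n" and P: "i = y \<Longrightarrow> P \<rho>" and fin: "\<And>r. P r \<Longrightarrow> r \<le> t"
  shows "card {j. P (lring W i j)} = card {j. P (\<rho> + lring W' i j)} + of_bool (i = y)"
proof (cases "i = y")
  case True
  have "{j. P (lring W y j)} = insert 0 (Suc ` {j. P (lring W y (Suc j))})"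
  proof (intro set_eqI)
    fix j show "j \<in> {j. P (lring W y j)} \<longleftrightarrow> j \<in> insert 0 (Suc ` {j. P (lring W y (Suc j))})"
      using P[OF True] by (cases j) (auto simp: lring_y_0)
  qed
  moreover have "finite {j. P (lring W y (Suc j))}"
  proof -
    have "finite {j. P (lring W y j)}"
      using fin by (intro finite_subset[OF _ locally_finite[OF y, of t]]) auto
    from finite_vimageI[OF this, of Suc] show ?thesis by (simp add: vimage_def)
  qed
  moreover have "lring W y (Suc j) = \<rho> + lring W' y j" for j
    using lring_after[OF y, of j] by simp
  ultimately show ?thesis using True by (simp add: card_image)
next
  case False
  then show ?thesis using lring_after[OF i] by simp
qed

text \<open>Induction along the line, then over the rings. Each constraint is read at the same
  absolute time before and after the restart, and the number of rings seen at a site shifts by one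
  at \<open>y\<close> only.\<close>

lemma lspin_after:
  assumes "i < n"
  shows "lspin A s \<eta> W i (k + of_bool (i = y)) =
    lspin A (s + \<rho>) (flip_at A (s + \<rho>) y \<eta> (snd (W (y, 0)))) W' i k"
  using assms
proof (induction i arbitrary: k rule: less_induct)
  case (less i)
  define \<eta>' where "\<eta>' = flip_at A (s + \<rho>) y \<eta> (snd (W (y, 0)))"
  show ?case
  proof (induction k)
    case 0
    show ?case
    proof (cases "i = y")
      case True
      \<comment> \<open>At its first ring \<open>y\<close> sees the initial spin of its predecessor,
        which has not rung yet.\<close>
      have "{j. lring W (y - 1) j < lring W y 0} = {}" if "0 < y"
        using lring_gt[of "y - 1"] that y by (auto simp: lring_y_0 not_less intro: less_imp_le)
      then show ?thesis
        using True by (auto simp: flip_at_def legal_def lring_y_0)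
    next
      case False
      then show ?thesis by (simp add: flip_at_def)
    qed
  next
    case (Suc k)
    have A: "A (s + lring W i (k + of_bool (i = y))) i = A (s + \<rho> + lring W' i k) i"
      using lring_after[OF less.prems] by (simp add: add.assoc)
    have coin: "snd (W (i, k + of_bool (i = y))) = snd (W' (i, k))"
      using less.prems by (auto simp: W'_def after_first_def delay_def drop_first_def)
    have nb: "lspin A s \<eta> W (i - 1) (card {j. lring W (i - 1) j < lring W i (k + of_bool (i = y))}) =
      lspin A (s + \<rho>) \<eta>' W' (i - 1) (card {j. lring W' (i - 1) j < lring W' i k})" if i: "0 < i"
    proof -
      have "card {j. lring W (i - 1) j < lring W i (k + of_bool (i = y))} =
        card {j. \<rho> + lring W' (i - 1) j < lring W i (k + of_bool (i = y))} + of_bool (i - 1 = y)"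
      proof (rule card_split[where t = "lring W i (k + of_bool (i = y))"])
        assume "i - 1 = y"
        then have "i \<noteq> y" using i by auto
        then show "\<rho> < lring W i (k + of_bool (i = y))"
          using lring_gt[OF less.prems] by simp
      qed (use less.prems i in auto)
      also have "{j. \<rho> + lring W' (i - 1) j < lring W i (k + of_bool (i = y))} = {j. lring W' (i - 1) j < lring W' i k}"
        using lring_after[OF less.prems] by simp
      finally show ?thesis
        using less.IH[of "i - 1"] i less.prems by (simp add: \<eta>'_def)
    qed
    have "lspin A s \<eta> W i (Suc (k + of_bool (i = y))) = lspin A (s + \<rho>) \<eta>' W' i (Suc k)"
      using nb A coin Suc.IH unfolding lspin.simps by (auto simp: \<eta>'_def)
    then show ?case by (simp add: \<eta>'_def)
  qed
qed

lemma lstate_after: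
  assumes "i < n" "s + \<rho> \<le> t"
  shows "lstate A s \<eta> W t i = lstate A (s + \<rho>) (flip_at A (s + \<rho>) y \<eta> (snd (W (y, 0)))) W' t i"
proof -
  have "card {j. s + lring W i j \<le> t} = card {j. s + (\<rho> + lring W' i j) \<le> t} + of_bool (i = y)"
    using assms by (intro card_split[where t = "t - s"]) auto
  then show ?thesis
    using lspin_after[OF assms(1), of A s \<eta>] unfolding lstate_def by (simp add: add.assoc)
qed

lemma lstate_before:
  assumes "i < n" "t < s + \<rho>"
  shows "lstate A s \<eta> W t i = \<eta> i"
proof -
  have "\<not> s + lring W i j \<le> t" for j using lring_ge[OF assms(1), of j] assms(2) by linarith
  then show ?thesis by (simp add: lstate_def)
qed

end

lemma lstate_no_ring:
  assumes "\<And>k. 0 \<le> fst (W (i, k))" "t < s + fst (W (i, 0))"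
  shows "lstate A s \<eta> W t i = \<eta> i"
proof -
  have "\<not> s + lring W i j \<le> t" for j
  proof -
    have "fst (W (i, 0)) \<le> lring W i j" using assms(1) by (rule lring_ge_first)
    with assms(2) show ?thesis by linarith
  qed
  then show ?thesis by (simp add: lstate_def)
qed

section \<open>Measurability of the process on a line\<close>

lemma lring_measurable [measurable]:
  "i < n \<Longrightarrow> (\<lambda>W. lring W i k) \<in> borel_measurable (line_noise p n)"
  unfolding lring_def by (intro borel_measurable_sum measurable_fst_mark) auto

lemma lspin_measurable:
  assumes A: "\<And>i. Measurable.pred borel (\<lambda>r. A r i)" and "i < n"
  shows "(\<lambda>z. lspin A (fst z) \<eta> (snd z) i k) \<in> borel \<Otimes>\<^sub>M line_noise p n \<rightarrow>\<^sub>M count_space UNIV"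
  using assms(2)
proof (induction i arbitrary: k rule: less_induct)
  case (less i)
  note [measurable] = A lring_measurable[OF less.prems]
  show ?case
  proof (induction k)
    case (Suc k)
    note [measurable] = Suc
    have [measurable]: "Measurable.pred (borel \<Otimes>\<^sub>M line_noise p n)
      (\<lambda>z. 0 < i \<and> lspin A (fst z) \<eta> (snd z) (i - 1) (card {j. lring (snd z) (i - 1) j < lring (snd z) i k}) = 0)"
    proof (cases "0 < i")
      case True
      then have i': "i - 1 < i" "i - 1 < n" using less.prems by auto
      note [measurable] = less.IH[OF i'] lring_measurable[OF i'(2)]
      have "(\<lambda>z. lspin A (fst z) \<eta> (snd z) (i - 1) (card {j. lring (snd z) (i - 1) j < lring (snd z) i k}))
          \<in> borel \<Otimes>\<^sub>M line_noise p n \<rightarrow>\<^sub>M count_space UNIV"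
        by (rule measurable_compose_countable[where
              g = "\<lambda>z. card {j. lring (snd z) (i - 1) j < lring (snd z) i k}"]) measurable
      then show ?thesis using True by simp
    qed simp
    have [measurable]: "(\<lambda>W. snd (W (i, k))) \<in> line_noise p n \<rightarrow>\<^sub>M count_space UNIV"
      using less.prems by (intro measurable_snd_mark) auto
    have [measurable]: "Measurable.pred (borel \<Otimes>\<^sub>M line_noise p n) (\<lambda>z. A (fst z + lring (snd z) i k) i)"
      by (rule measurable_compose[OF _ A]) measurable
    have c1: "(\<lambda>z. of_bool (snd (snd z (i, k))) :: nat) \<in> borel \<Otimes>\<^sub>M line_noise p n \<rightarrow>\<^sub>M count_space UNIV"
      by (rule measurable_compose[OF measurable_snd]) measurable
    have c2: "Measurable.pred (borel \<Otimes>\<^sub>M line_noise p n) (\<lambda>z. A (fst z + lring (snd z) i k) i \<or>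
      (0 < i \<and> lspin A (fst z) \<eta> (snd z) (i - 1) (card {j. lring (snd z) (i - 1) j < lring (snd z) i k}) = 0))"
      by (rule pred_intros_logic(5)) fact+
    show ?case
      unfolding lspin.simps by (rule measurable_If[OF c1 Suc predE[OF c2]])
  qed simp
qed

lemma lstate_measurable:
  assumes A: "\<And>i. Measurable.pred borel (\<lambda>r. A r i)" and i: "i < n"
  shows "(\<lambda>z. lstate A (fst (fst z)) \<eta> (snd (fst z)) (snd z) i) \<in> (borel \<Otimes>\<^sub>M line_noise p n) \<Otimes>\<^sub>M borel \<rightarrow>\<^sub>M count_space UNIV"
proof -
  note [measurable] = lspin_measurable[OF A i] lring_measurable[OF i]
  have "(\<lambda>z. lspin A (fst (fst z)) \<eta> (snd (fst z)) i (card {j. fst (fst z) + lring (snd (fst z)) i j \<le> snd z}))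
      \<in> (borel \<Otimes>\<^sub>M line_noise p n) \<Otimes>\<^sub>M borel \<rightarrow>\<^sub>M count_space UNIV"
    by (rule measurable_compose_countable[where
          g = "\<lambda>z. card {j. fst (fst z) + lring (snd (fst z)) i j \<le> snd z}"]) measurable
  then show ?thesis by (simp add: lstate_def)
qed

section \<open>Law of the noise around the first ring\<close>

abbreviation rings_first :: "nat \<Rightarrow> nat \<Rightarrow> (nat \<times> nat \<Rightarrow> real \<times> bool) set" where
  "rings_first n y \<equiv> {W. \<forall>i<n. i \<noteq> y \<longrightarrow> fst (W (y, 0)) < fst (W (i, 0))}"

abbreviation silent :: "nat \<Rightarrow> real \<Rightarrow> (nat \<times> nat \<Rightarrow> real \<times> bool) set" where
  "silent n r \<equiv> {W. \<forall>i<n. r < fst (W (i, 0))}"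

text \<open>Given the first mark \<open>z\<close> of \<open>y\<close>, the other
  \<open>n - 1\<close> clocks outlast it with probability \<open>exp (- fst z * (n - 1))\<close>,
  and the noise from then on is fresh. Removal of a mark handles \<open>y\<close>, memorylessness
  the other sites.\<close>

lemma nn_integral_after_first:
  assumes y: "y < n" and f: "f \<in> borel_measurable (marks p \<Otimes>\<^sub>M line_noise p n)"
    and p: "0 < p" "p < 1"
  shows "(\<integral>\<^sup>+ W. indicator (rings_first n y) W * f (W (y, 0), after_first n y W)
      \<partial>line_noise p n) =
    (\<integral>\<^sup>+ z. ennreal (exp (- fst z * (real n - 1))) * (\<integral>\<^sup>+ W. f (z, W) \<partial>line_noise p n) \<partial>marks p)"
proof -
  define J :: "(nat \<times> nat) set" where "J = ({..<n} - {y}) \<times> {0}"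
  have J: "finite J" "J \<subseteq> line_index n" "card J = n - 1"
    using y by (auto simp: J_def card_cartesian_product)
  define h where "h = (\<lambda>(z, W). (\<Prod>j\<in>J. indicator {fst z<..} (fst (W j))) * f (z, delay (fst z) J W))"
  have fstm [measurable]: "fst \<in> borel_measurable (marks p)"
    by (subst measurable_cong_sets[OF sets_marks refl]) measurable
  have "(\<lambda>x. (fst (fst x), snd x)) \<in> marks p \<Otimes>\<^sub>M line_noise p n \<rightarrow>\<^sub>M borel \<Otimes>\<^sub>M line_noise p n"
    by measurable
  from measurable_compose[OF this measurable_delay[OF J(2)]]
  have dm [measurable]: "(\<lambda>x. delay (fst (fst x)) J (snd x)) \<in> marks p \<Otimes>\<^sub>M line_noise p n \<rightarrow>\<^sub>M line_noise p n"
    by simp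
  have ind [measurable]: "(\<lambda>x. indicator {fst (fst x)<..} (fst (snd x j)) :: ennreal) \<in> borel_measurable (marks p \<Otimes>\<^sub>M line_noise p n)"
    if "j \<in> J" for j
  proof -
    have W: "(\<lambda>x. fst (snd x j)) \<in> borel_measurable (marks p \<Otimes>\<^sub>M line_noise p n)"
      using that J by (intro measurable_compose[OF measurable_snd] measurable_fst_mark) auto
    have z: "(\<lambda>x. fst (fst x)) \<in> borel_measurable (marks p \<Otimes>\<^sub>M line_noise p n)"
      by (rule measurable_compose[OF measurable_fst fstm])
    have "(\<lambda>x. of_bool (f x < g x) :: ennreal) \<in> borel_measurable M"
      if [measurable]: "f \<in> borel_measurable M" "g \<in> borel_measurable M" for f g :: "_ \<Rightarrow> real" and M
      by measurable
    from this[OF z W] show ?thesis by (simp add: indicator_def of_bool_def)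
  qed
  have prodm: "(\<lambda>x. \<Prod>j\<in>J. indicator {fst (fst x)<..} (fst (snd x j)) :: ennreal) \<in> borel_measurable (marks p \<Otimes>\<^sub>M line_noise p n)"
    by (intro borel_measurable_prod_ennreal ind)
  have h: "h \<in> borel_measurable (marks p \<Otimes>\<^sub>M line_noise p n)"
  proof -
    note [measurable] = f prodm
    show ?thesis unfolding h_def case_prod_beta' by measurable
  qed
  have "indicator (rings_first n y) W * f (W (y, 0), after_first n y W) =
      h (W (y, 0), drop_first n y W)" for W
  proof -
    have "(\<Prod>j\<in>J. indicator {fst (W (y, 0))<..} (fst (drop_first n y W j))) =
        (\<Prod>i\<in>{..<n} - {y}. indicator {fst (W (y, 0))<..} (fst (W (i, 0))) :: ennreal)"
      by (rule prod.reindex_cong[of "\<lambda>i. (i, 0)"]) (auto simp: J_def inj_on_def drop_first_def)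
    also have "\<dots> = indicator (rings_first n y) W"
    proof (cases "\<forall>i<n. i \<noteq> y \<longrightarrow> fst (W (y, 0)) < fst (W (i, 0))")
      case False
      then obtain i where "i \<in> {..<n} - {y}" "\<not> fst (W (y, 0)) < fst (W (i, 0))" by auto
      then have "(\<Prod>i\<in>{..<n} - {y}. indicator {fst (W (y, 0))<..} (fst (W (i, 0))) :: ennreal) = 0"
        by (intro prod_zero bexI[of _ i]) auto
      then show ?thesis using False by simp
    qed auto
    finally show ?thesis by (simp add: h_def after_first_def J_def)
  qed
  then have "(\<integral>\<^sup>+ W. indicator (rings_first n y) W * f (W (y, 0), after_first n y W)
      \<partial>line_noise p n) = (\<integral>\<^sup>+ W. h (W (y, 0), drop_first n y W) \<partial>line_noise p n)"
    by simp
  also have "\<dots> = (\<integral>\<^sup>+ z. \<integral>\<^sup>+ W. h (z, W) \<partial>line_noise p n \<partial>marks p)"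
    by (rule nn_integral_drop_first[OF y h])
  also have "\<dots> = (\<integral>\<^sup>+ z. ennreal (exp (- fst z * (real n - 1))) * (\<integral>\<^sup>+ W. f (z, W) \<partial>line_noise p n) \<partial>marks p)"
  proof (rule nn_integral_cong_AE, rule eventually_mono[OF AE_marks_nonneg[OF p]])
    fix z :: "real \<times> bool" assume z: "0 \<le> fst z"
    have fz: "(\<lambda>W. f (z, W)) \<in> borel_measurable (line_noise p n)"
      by (rule measurable_compose[OF measurable_Pair1' f]) simp
    show "(\<integral>\<^sup>+ W. h (z, W) \<partial>line_noise p n) =
        ennreal (exp (- fst z * (real n - 1))) * (\<integral>\<^sup>+ W. f (z, W) \<partial>line_noise p n)"
      using nn_integral_delay[OF J(1,2) fz p z] y by (simp add: h_def J(3) of_nat_diff)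
  qed
  finally show ?thesis .
qed

lemma nn_integral_no_ring:
  assumes p: "0 < p" "p < 1" and r: "0 \<le> r"
  shows "(\<integral>\<^sup>+ W. indicator (silent n r) W \<partial>line_noise p n) = ennreal (exp (- r * real n))"
proof -
  interpret prob_space "line_noise p n" by (rule prob_space_marks_on)
  define J :: "(nat \<times> nat) set" where "J = {..<n} \<times> {0}"
  have J: "finite J" "J \<subseteq> line_index n" "card J = n"
    by (auto simp: J_def card_cartesian_product)
  have "(\<Prod>j\<in>J. indicator {r<..} (fst (W j)) :: ennreal) = indicator (silent n r) W" for W
  proof (cases "\<forall>i<n. r < fst (W (i, 0))")
    case False
    then obtain i where "i < n" "\<not> r < fst (W (i, 0))" by auto
    then have "(\<Prod>j\<in>J. indicator {r<..} (fst (W j)) :: ennreal) = 0"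
      using J(1) by (intro prod_zero bexI[of _ "(i, 0)"]) (auto simp: J_def)
    then show ?thesis using False by simp
  next
    case True
    then have "(\<Prod>j\<in>J. indicator {r<..} (fst (W j)) :: ennreal) = 1"
      by (intro prod.neutral) (auto simp: J_def)
    then show ?thesis using True by simp
  qed
  note * = this
  show ?thesis
    using nn_integral_delay[OF J(1,2), of "\<lambda>_. 1" p r] p r unfolding * by (simp add: J(3) emeasure_space_1)
qed

section \<open>Almost sure properties of the clocks\<close>

lemma AE_marks_on_component:
  assumes "j \<in> I" "AE z in marks p. P z"
  shows "AE W in marks_on p I. P (W j)"
  unfolding marks_on_def using assms by (intro AE_PiM_component prob_space_marks)

text \<open>With all marks but that at \<open>i\<close> held fixed, a tie asks an exponential
  variable to hit a given value.\<close>

lemma AE_no_tie: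
  assumes "i \<in> I" "j \<in> I" "i \<noteq> j" and p: "0 < p" "p < 1"
  shows "AE W in marks_on p I. fst (W i) \<noteq> fst (W j)"
proof -
  have "(\<lambda>x. of_bool (f x = g x) :: ennreal) \<in> borel_measurable M"
    if [measurable]: "f \<in> borel_measurable M" "g \<in> borel_measurable M" for f g :: "_ \<Rightarrow> real" and M
    by measurable
  from this[OF measurable_fst_mark[OF assms(1)] measurable_fst_mark[OF assms(2)]]
  have m: "(\<lambda>W. of_bool (fst (W i) = fst (W j)) :: ennreal) \<in> borel_measurable (marks_on p I)" .
  have "(\<integral>\<^sup>+ W. of_bool (fst (W i) = fst (W j)) \<partial>marks_on p I) =
     (\<integral>\<^sup>+ X. \<integral>\<^sup>+ z. of_bool (fst z = fst (X j)) \<partial>marks p \<partial>marks_on p (I - {i}))"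
    using assms by (subst nn_integral_marks_on_insert[OF assms(1) m]) simp
  also have "\<dots> = (\<integral>\<^sup>+ X. 0 \<partial>marks_on p (I - {i}))"
  proof (rule nn_integral_cong)
    fix X
    have "(\<integral>\<^sup>+ z. of_bool (fst z = fst (X j)) \<partial>marks p) = (\<integral>\<^sup>+ z. 0 \<partial>marks p)"
      by (rule nn_integral_cong_AE, rule eventually_mono[OF AE_marks_neq[OF p, of "fst (X j)"]]) simp
    then show "(\<integral>\<^sup>+ z. of_bool (fst z = fst (X j)) \<partial>marks p) = (0 :: ennreal)" by simp
  qed
  finally have "(\<integral>\<^sup>+ W. of_bool (fst (W i) = fst (W j)) \<partial>marks_on p I) = 0" by simp
  with m have "AE W in marks_on p I. (of_bool (fst (W i) = fst (W j)) :: ennreal) = 0"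
    by (simp add: nn_integral_0_iff_AE)
  then show ?thesis by (rule eventually_mono) (simp split: if_splits)
qed

lemma nn_integral_marks_exp:
  assumes p: "0 < p" "p < 1"
  shows "(\<integral>\<^sup>+ z. ennreal (exp (- fst z)) \<partial>marks p) = ennreal (1 / 2)"
proof -
  interpret D: prob_space "density lborel (exponential_density 2)"
    by (rule prob_space_exponential_density) simp
  have "(\<integral>\<^sup>+ z. ennreal (exp (- fst z)) \<partial>marks p) = (\<integral>\<^sup>+ r. ennreal (1 / 2) * ennreal (exponential_density 2 r) \<partial>lborel)"
  proof (subst nn_integral_marks)
    show "(\<integral>\<^sup>+ r. ennreal (indicator {0..} r * exp (- r)) *
        (ennreal p * ennreal (exp (- fst (r, True))) + ennreal (1 - p) * ennreal (exp (- fst (r, False)))) \<partial>lborel)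
      = (\<integral>\<^sup>+ r. ennreal (1 / 2) * ennreal (exponential_density 2 r) \<partial>lborel)"
    proof (rule nn_integral_cong)
      fix r :: real
      have "ennreal p * ennreal (exp (- r)) + ennreal (1 - p) * ennreal (exp (- r)) = ennreal (exp (- r))"
        using p by (simp flip: distrib_right ennreal_plus)
      moreover have "indicator {0..} r * exp (- r) * exp (- r) = 1 / 2 * exponential_density 2 r"
        by (auto simp: exponential_density_def simp flip: exp_add)
      ultimately show "ennreal (indicator {0..} r * exp (- r)) *
        (ennreal p * ennreal (exp (- fst (r, True))) + ennreal (1 - p) * ennreal (exp (- fst (r, False))))
        = ennreal (1 / 2) * ennreal (exponential_density 2 r)"
        by (simp only: fst_conv ennreal_mult''[symmetric] ennreal_mult'[symmetric] exp_ge_zero zero_le_divide_1_iff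
            zero_le_numeral)
    qed
  qed (use p in auto)
  also have "\<dots> = ennreal (1 / 2) * (\<integral>\<^sup>+ r. ennreal (exponential_density 2 r) \<partial>lborel)"
    by (rule nn_integral_cmult) measurable
  also have "(\<integral>\<^sup>+ r. ennreal (exponential_density 2 r) \<partial>lborel) = 1"
    using D.emeasure_space_1 by (simp add: emeasure_density)
  finally show ?thesis by simp
qed

text \<open>Laplace transform at 1 of a sum of \<open>k + 1\<close> independent exponential
  variables, by peeling off the first mark.\<close>

lemma nn_integral_exp_lring:
  assumes i: "i < n" and p: "0 < p" "p < 1"
  shows "(\<integral>\<^sup>+ W. ennreal (exp (- lring W i k)) \<partial>line_noise p n) = ennreal ((1 / 2) ^ Suc k)"
proof (induction k)
  interpret prob_space "line_noise p n" by (rule prob_space_marks_on)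
  have fstm [measurable]: "fst \<in> borel_measurable (marks p)"
    by (subst measurable_cong_sets[OF sets_marks refl]) measurable
  note [measurable] = lring_measurable[OF i]
  {
    case 0
    have "(\<lambda>(z, W). ennreal (exp (- fst z))) \<in> borel_measurable (marks p \<Otimes>\<^sub>M line_noise p n)"
      by measurable
    from nn_integral_drop_first[OF i this] show ?case
      using nn_integral_marks_exp[OF p] by (simp add: lring_def emeasure_space_1)
  next
    case (Suc k)
    have "lring W i (Suc k) = fst (W (i, 0)) + lring (drop_first n i W) i k" for W
      using i unfolding lring_def by (subst sum.atMost_Suc_shift) (simp add: drop_first_def)
    then have "(\<integral>\<^sup>+ W. ennreal (exp (- lring W i (Suc k))) \<partial>line_noise p n) =
       (\<integral>\<^sup>+ W. (\<lambda>(z, W). ennreal (exp (- fst z)) * ennreal (exp (- lring W i k))) (W (i, 0), drop_first n i W) \<partial>line_noise p n)"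
      by (simp add: ennreal_mult'[symmetric] flip: exp_add)
    also have "\<dots> = (\<integral>\<^sup>+ z. \<integral>\<^sup>+ W. (\<lambda>(z, W). ennreal (exp (- fst z)) * ennreal (exp (- lring W i k))) (z, W) \<partial>line_noise p n \<partial>marks p)"
      by (rule nn_integral_drop_first[OF i]) measurable
    also have "\<dots> = (\<integral>\<^sup>+ z. ennreal (exp (- fst z)) * ennreal ((1 / 2) ^ Suc k) \<partial>marks p)"
      by (simp add: nn_integral_cmult Suc)
    also have "\<dots> = ennreal (1 / 2) * ennreal ((1 / 2) ^ Suc k)"
      using nn_integral_marks_exp[OF p] by (subst nn_integral_multc) auto
    also have "\<dots> = ennreal (1 / 2 * (1 / 2) ^ Suc k)" by (rule ennreal_mult'[symmetric]) simp
    finally show ?case by simp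
  }
qed

text \<open>The expected sum over \<open>k\<close> of \<open>exp (- lring W i k)\<close> is a
  convergent geometric series, so almost surely the sum is finite and the ring times tend to
  infinity.\<close>

lemma AE_locally_finite:
  assumes i: "i < n" and p: "0 < p" "p < 1"
  shows "AE W in line_noise p n. \<forall>t. finite {k. lring W i k \<le> t}"
proof -
  note [measurable] = lring_measurable[OF i]
  have "(\<integral>\<^sup>+ W. (\<Sum>k. ennreal (exp (- lring W i k))) \<partial>line_noise p n) =
      (\<Sum>k. ennreal ((1 / 2) ^ Suc k))"
    by (subst nn_integral_suminf) (auto simp only: nn_integral_exp_lring[OF i p], measurable)
  also have "\<dots> = ennreal (\<Sum>k. (1 / 2) ^ Suc k)"
    by (rule suminf_ennreal2) (auto intro: summable_mult summable_geometric)
  finally have "(\<integral>\<^sup>+ W. (\<Sum>k. ennreal (exp (- lring W i k))) \<partial>line_noise p n) \<noteq> \<infinity>" by simp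
  then have "AE W in line_noise p n. (\<Sum>k. ennreal (exp (- lring W i k))) \<noteq> \<infinity>"
    by (intro nn_integral_noteq_infinite) measurable
  then show ?thesis
  proof (rule eventually_mono, intro allI)
    fix W t assume "(\<Sum>k. ennreal (exp (- lring W i k))) \<noteq> \<infinity>"
    then have "summable (\<lambda>k. exp (- lring W i k))"
      by (intro summable_suminf_not_top) auto
    then have "(\<lambda>k. exp (- lring W i k)) \<longlonglongrightarrow> 0" by (rule summable_LIMSEQ_zero)
    then have "\<forall>\<^sub>F k in sequentially. exp (- lring W i k) < exp (- t)"
      by (rule order_tendstoD) simp
    then have "finite {k. \<not> exp (- lring W i k) < exp (- t)}"
      by (simp add: cofinite_eq_sequentially[symmetric] eventually_cofinite)
    then show "finite {k. lring W i k \<le> t}" by (simp add: not_less)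
  qed
qed

section \<open>The Feynman-Kac weight and its integral equation\<close>

locale line_process = bernoulli_param p for p +
  fixes A :: "real \<Rightarrow> nat \<Rightarrow> bool" and n :: nat and T :: real
  assumes n: "0 < n" and T: "0 \<le> T" and A_measurable: "\<And>i. Measurable.pred borel (\<lambda>r. A r i)"
begin

abbreviation "noise \<equiv> line_noise p n"

definition weight :: "real \<Rightarrow> (nat \<Rightarrow> nat) \<Rightarrow> (nat \<times> nat \<Rightarrow> real \<times> bool) \<Rightarrow> real" where
  "weight s \<eta> W = exp (- (LINT r|lborel. indicator {s..T} r * of_bool (lstate A s \<eta> W r (n - 1) = 0)))"

definition g :: "real \<Rightarrow> (nat \<Rightarrow> nat) \<Rightarrow> real" where
  "g s \<eta> = (LINT W|noise. weight s \<eta> W)"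

lemma weight_bounds: "0 < weight s \<eta> W" "weight s \<eta> W \<le> 1"
  by (auto simp: weight_def)

lemma weight_measurable: "(\<lambda>z. weight (fst z) \<eta> (snd z)) \<in> borel_measurable (borel \<Otimes>\<^sub>M noise)"
proof -
  have N: "sets ((borel \<Otimes>\<^sub>M noise) \<Otimes>\<^sub>M lborel) = sets ((borel \<Otimes>\<^sub>M noise) \<Otimes>\<^sub>M borel)"
    by (intro sets_pair_measure_cong) auto
  have "(\<lambda>z. lstate A (fst (fst z)) \<eta> (snd (fst z)) (snd z) (n - 1)) \<in> (borel \<Otimes>\<^sub>M noise) \<Otimes>\<^sub>M borel \<rightarrow>\<^sub>M count_space UNIV"
    using n by (intro lstate_measurable A_measurable) auto
  then have [measurable]: "Measurable.pred ((borel \<Otimes>\<^sub>M noise) \<Otimes>\<^sub>M borel)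
      (\<lambda>z. lstate A (fst (fst z)) \<eta> (snd (fst z)) (snd z) (n - 1) = 0)"
    by measurable
  have [measurable]: "Measurable.pred ((borel \<Otimes>\<^sub>M noise) \<Otimes>\<^sub>M borel) (\<lambda>z. fst (fst z) \<le> (snd z :: real))"
    "Measurable.pred ((borel \<Otimes>\<^sub>M noise) \<Otimes>\<^sub>M borel) (\<lambda>z. snd z \<le> T)"
    by measurable
  have "(\<lambda>z. of_bool (fst (fst z) \<le> snd z \<and> snd z \<le> T \<and> lstate A (fst (fst z)) \<eta> (snd (fst z)) (snd z) (n - 1) = 0) :: real)
      \<in> borel_measurable ((borel \<Otimes>\<^sub>M noise) \<Otimes>\<^sub>M borel)"
    by measurable
  also have "(\<lambda>z. of_bool (fst (fst z) \<le> snd z \<and> snd z \<le> T \<and> lstate A (fst (fst z)) \<eta> (snd (fst z)) (snd z) (n - 1) = 0) :: real) =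
      (\<lambda>(z, r). indicator {fst z..T} r * of_bool (lstate A (fst z) \<eta> (snd z) r (n - 1) = 0))"
    by (auto simp: indicator_def)
  finally have "(\<lambda>(z, r). indicator {fst z..T} r * of_bool (lstate A (fst z) \<eta> (snd z) r (n - 1) = 0) :: real)
      \<in> borel_measurable ((borel \<Otimes>\<^sub>M noise) \<Otimes>\<^sub>M lborel)"
    by (simp add: measurable_cong_sets[OF N refl])
  from lborel.borel_measurable_lebesgue_integral[OF this]
  show ?thesis unfolding weight_def by measurable
qed

lemma weight_measurable': "weight s \<eta> \<in> borel_measurable noise"
  using measurable_compose[OF measurable_Pair1' weight_measurable, of s] by simp

lemma g_measurable: "(\<lambda>s. g s \<eta>) \<in> borel_measurable borel"
proof -
  interpret prob_space noise by (rule prob_space_marks_on)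
  show ?thesis
    unfolding g_def using weight_measurable[of \<eta>]
    by (intro borel_measurable_lebesgue_integral) (simp add: case_prod_beta')
qed

lemma integrable_weight: "integrable noise (weight s \<eta>)"
proof -
  interpret prob_space noise by (rule prob_space_marks_on)
  show ?thesis
    using weight_bounds[of s \<eta>] weight_measurable'[of s \<eta>]
    by (intro integrable_const_bound[where B = 1] AE_I2) (auto simp: abs_of_pos)
qed

lemma g_bounds: "0 \<le> g s \<eta>" "g s \<eta> \<le> 1"
proof -
  interpret prob_space noise by (rule prob_space_marks_on)
  show "0 \<le> g s \<eta>" unfolding g_def
    by (intro Bochner_Integration.integral_nonneg) (simp add: weight_bounds less_imp_le)
  show "g s \<eta> \<le> 1"
    unfolding g_def by (intro integral_le_const integrable_weight AE_I2 weight_bounds)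
qed

lemma ennreal_g: "ennreal (g s \<eta>) = (\<integral>\<^sup>+ W. ennreal (weight s \<eta> W) \<partial>noise)"
  unfolding g_def
  by (intro nn_integral_eq_integral[symmetric] integrable_weight) (simp add: weight_bounds less_imp_le)

abbreviation "last_zero \<eta> \<equiv> zero_at (n - 1) \<eta>"

lemma weight_no_ring:
  assumes "s \<le> T" "\<And>i k. i < n \<Longrightarrow> 0 \<le> fst (W (i, k))" "\<And>i. i < n \<Longrightarrow> T - s < fst (W (i, 0))"
  shows "weight s \<eta> W = exp (- last_zero \<eta> * (T - s))"
proof -
  have "(LINT r|lborel. indicator {s..T} r * of_bool (lstate A s \<eta> W r (n - 1) = 0)) =
      (LINT r|lborel. last_zero \<eta> * indicator {s..T} r :: real)"
  proof (intro Bochner_Integration.integral_cong refl)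
    fix r
    have "lstate A s \<eta> W r (n - 1) = \<eta> (n - 1)" if "r \<le> T"
    proof (rule lstate_no_ring)
      show "r < s + fst (W (n - 1, 0))" using that assms(3)[of "n - 1"] n by simp
    qed (use assms(2) n in simp)
    then show "indicator {s..T} r * of_bool (lstate A s \<eta> W r (n - 1) = 0) = last_zero \<eta> * indicator {s..T} r"
      by (auto simp: indicator_def zero_at_def)
  qed
  also have "\<dots> = last_zero \<eta> * (T - s)" using assms(1) by simp
  finally show ?thesis by (simp add: weight_def)
qed

text \<open>The time integral splits at the first ring: before it the last site keeps its initial
  spin, from then on the restarted process takes over.\<close>

lemma weight_first_ring:
  assumes "first_ring n y W" and le: "fst (W (y, 0)) \<le> T - s" and W: "W \<in> space noise"
  shows "weight s \<eta> W = exp (- last_zero \<eta> * fst (W (y, 0))) *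
    weight (s + fst (W (y, 0))) (flip_at A (s + fst (W (y, 0))) y \<eta> (snd (W (y, 0)))) (after_first n y W)"
proof -
  interpret first_ring n y W by fact
  define \<eta>' where "\<eta>' = flip_at A (s + \<rho>) y \<eta> (snd (W (y, 0)))"
  have \<rho>: "0 \<le> \<rho>" "s + \<rho> \<le> T" using nonneg[OF y, of 0] le by (auto simp: \<rho>_def)
  define u where "u r = (indicator {s + \<rho>..T} r * of_bool (lstate A (s + \<rho>) \<eta>' W' r (n - 1) = 0) :: real)" for r
  have after: "after_first n y W \<in> space noise"
  proof -
    have "W' \<in> extensional (line_index n)"
      using y by (auto simp: W'_def after_first_def delay_def drop_first_def extensional_def)
    then show ?thesis by (auto simp: W'_def marks_on_def space_PiM PiE_def)
  qed
  have u: "integrable lborel u"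
  proof -
    have "(\<lambda>z. lstate A (fst (fst z)) \<eta>' (snd (fst z)) (snd z) (n - 1)) \<in> (borel \<Otimes>\<^sub>M noise) \<Otimes>\<^sub>M borel \<rightarrow>\<^sub>M count_space UNIV"
      using n by (intro lstate_measurable A_measurable) auto
    from measurable_compose[OF measurable_Pair1' this, of "(s + \<rho>, W')"]
    have [measurable]: "(\<lambda>r. lstate A (s + \<rho>) \<eta>' W' r (n - 1)) \<in> borel \<rightarrow>\<^sub>M count_space UNIV"
      using after by (simp add: space_pair_measure W'_def)
    have "u \<in> borel_measurable borel" unfolding u_def by measurable
    then show ?thesis
      by (intro integrableI_bounded_set[where A = "{s + \<rho>..T}" and B = 1])
        (auto simp: emeasure_lborel_Icc_eq u_def)
  qed
  have "(LINT r|lborel. indicator {s..T} r * of_bool (lstate A s \<eta> W r (n - 1) = 0)) =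
      (LINT r|lborel. last_zero \<eta> * indicator {s..<s + \<rho>} r + u r)"
  proof (intro Bochner_Integration.integral_cong refl)
    fix r
    have "n - 1 < n" using n by simp
    with lstate_before[of "n - 1" r s A \<eta>] lstate_after[of "n - 1" s r A \<eta>] \<rho>
    show "indicator {s..T} r * of_bool (lstate A s \<eta> W r (n - 1) = 0) = last_zero \<eta> * indicator {s..<s + \<rho>} r + u r"
      by (cases "r < s + \<rho>") (auto simp: indicator_def zero_at_def u_def \<eta>'_def)
  qed
  also have "\<dots> = (LINT r|lborel. last_zero \<eta> * indicator {s..<s + \<rho>} r) + (LINT r|lborel. u r)"
    using \<rho> by (intro Bochner_Integration.integral_add u integrable_mult_right integrable_real_indicator) auto
  also have "(LINT r|lborel. last_zero \<eta> * indicator {s..<s + \<rho>} r) = last_zero \<eta> * \<rho>"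
    using \<rho> by simp
  finally show ?thesis
    unfolding weight_def u_def by (simp add: exp_add[symmetric] W'_def \<eta>'_def flip: \<rho>_def)
qed

text \<open>Weight of a path on which \<open>y\<close> rings first, no later than \<open>T\<close>,
  written as a function of the first mark of \<open>y\<close> and the noise after it, which are
  independent.\<close>

definition ring_contribution :: "real \<Rightarrow> nat \<Rightarrow> (nat \<Rightarrow> nat) \<Rightarrow> (real \<times> bool) \<times> (nat \<times> nat \<Rightarrow> real \<times> bool) \<Rightarrow> ennreal" where
  "ring_contribution s y \<eta> x = indicator {..T - s} (fst (fst x)) * ennreal (exp (- last_zero \<eta> * fst (fst x)) *
     weight (s + fst (fst x)) (flip_at A (s + fst (fst x)) y \<eta> (snd (fst x))) (snd x))"

lemma legal_measurable: "Measurable.pred borel (\<lambda>r. legal A r y \<eta>)"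
  unfolding legal_def using A_measurable[of y] by measurable

lemma flip_cases:
  "F (flip_at A r y \<eta> b) = (if legal A r y \<eta> then (if b then F (\<eta>(y := 1)) else F (\<eta>(y := 0))) else F \<eta>)"
  by (simp add: flip_at_def)

lemma measurable_shift_fst: "(\<lambda>z. s + fst z) \<in> borel_measurable (marks p)"
  by (subst measurable_cong_sets[OF sets_marks refl]) measurable

lemma measurable_fst_marks: "fst \<in> borel_measurable (marks p)"
  by (subst measurable_cong_sets[OF sets_marks refl]) measurable

lemma measurable_snd_marks: "snd \<in> marks p \<rightarrow>\<^sub>M count_space UNIV"
  by (subst measurable_cong_sets[OF sets_marks refl]) measurable

text \<open>The random configuration takes only three values, so measurability at it reduces to
  measurability at fixed configurations.\<close>

lemma measurable_flip:
  assumes f: "f \<in> M \<rightarrow>\<^sub>M marks p"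
    and F: "\<And>\<xi>. (\<lambda>x. F x \<xi>) \<in> borel_measurable M"
  shows "(\<lambda>x. F x (flip_at A (s + fst (f x)) y \<eta> (snd (f x))) :: real) \<in> borel_measurable M"
proof -
  have [measurable]: "Measurable.pred M (\<lambda>x. legal A (s + fst (f x)) y \<eta>)"
    by (rule measurable_compose[OF measurable_compose[OF f measurable_shift_fst] legal_measurable])
  have [measurable]: "Measurable.pred M (\<lambda>x. snd (f x))"
    by (rule measurable_compose[OF f measurable_snd_marks])
  note [measurable] = F
  show ?thesis by (subst flip_cases) measurable
qed

lemma ring_contribution_measurable: "ring_contribution s y \<eta> \<in> borel_measurable (marks p \<Otimes>\<^sub>M noise)"
proof -
  have [measurable]: "(\<lambda>x. fst (fst x)) \<in> borel_measurable (marks p \<Otimes>\<^sub>M noise)"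
    by (rule measurable_compose[OF measurable_fst measurable_fst_marks])
  have "(\<lambda>x. (s + fst (fst x), snd x)) \<in> marks p \<Otimes>\<^sub>M noise \<rightarrow>\<^sub>M borel \<Otimes>\<^sub>M noise" by measurable
  from measurable_compose[OF this weight_measurable]
  have F: "(\<lambda>x. weight (s + fst (fst x)) \<xi> (snd x)) \<in> borel_measurable (marks p \<Otimes>\<^sub>M noise)" for \<xi> by simp
  have [measurable]: "(\<lambda>x. weight (s + fst (fst x)) (flip_at A (s + fst (fst x)) y \<eta> (snd (fst x))) (snd x))
      \<in> borel_measurable (marks p \<Otimes>\<^sub>M noise)"
    by (rule measurable_flip[OF measurable_fst F])
  show ?thesis unfolding ring_contribution_def by measurable
qed

lemma of_bool_measurable:
  "Measurable.pred M P \<Longrightarrow> (\<lambda>x. of_bool (P x) :: ennreal) \<in> borel_measurable M"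
  by (rule measurable_compose[of P M "count_space UNIV" of_bool borel]) simp_all

lemma after_first_measurable: "y < n \<Longrightarrow> after_first n y \<in> noise \<rightarrow>\<^sub>M noise"
  unfolding after_first_def[abs_def]
  by (rule measurable_compose[OF _ measurable_delay, of "\<lambda>W. (fst (W (y, 0)), drop_first n y W)", simplified])
    (auto intro!: measurable_Pair measurable_fst_mark measurable_drop_first)

lemma first_measurable:
  assumes y: "y < n"
  shows "(\<lambda>W. indicator (rings_first n y) W :: ennreal) \<in> borel_measurable noise"
proof -
  have "Measurable.pred noise (\<lambda>W. fst (W (y, 0)) < fst (W (i, 0)))" if "i < n" for i
    using that y by (intro borel_measurable_pred_less measurable_fst_mark) auto
  then have "Measurable.pred noise (\<lambda>W. \<forall>i\<in>{..<n} - {y}. fst (W (y, 0)) < fst (W (i, 0)))"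
    by (rule pred_intros_finite(3)[rotated]) auto
  from of_bool_measurable[OF this]
  have "(\<lambda>W. of_bool (\<forall>i\<in>{..<n} - {y}. fst (W (y, 0)) < fst (W (i, 0))) :: ennreal) \<in> borel_measurable noise" .
  then show ?thesis by (rule back_subst[of "\<lambda>f. f \<in> borel_measurable noise"]) (auto simp: fun_eq_iff indicator_def)
qed

text \<open>Ties being excluded, either no clock of the line rings up to \<open>T\<close> or exactly
  one site rings first. In the former case the cut-off in \<open>ring_contribution\<close> makes the
  sum vanish.\<close>

lemma AE_weight_decomposition:
  assumes s: "s \<le> T"
  shows "AE W in noise. ennreal (weight s \<eta> W) =
    indicator (silent n (T - s)) W * ennreal (exp (- last_zero \<eta> * (T - s))) +
    (\<Sum>y<n. indicator (rings_first n y) W *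
      ring_contribution s y \<eta> (W (y, 0), after_first n y W))"
proof -
  have "AE W in noise. \<forall>i\<in>{..<n}. \<forall>k\<in>UNIV. 0 \<le> fst (W (i, k))"
    using p_pos p_less
    by (intro AE_ball_countable' AE_marks_on_component AE_marks_nonneg) auto
  moreover have "AE W in noise. \<forall>i\<in>{..<n}. \<forall>t. finite {k. lring W i k \<le> t}"
    using p_pos p_less by (intro AE_ball_countable' AE_locally_finite) auto
  moreover have "AE W in noise. \<forall>i\<in>{..<n}. \<forall>j\<in>{..<n} - {i}. fst (W (i, 0)) \<noteq> fst (W (j, 0))"
    using p_pos p_less by (intro AE_ball_countable' AE_no_tie) auto
  ultimately show ?thesis
    using AE_space
  proof eventually_elim
    case (elim W)
    have nn: "0 \<le> fst (W (i, k))" if "i < n" for i k using elim(1) that by auto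
    define w where "w i = fst (W (i, 0))" for i
    define F where "F y = (indicator (rings_first n y) W *
      ring_contribution s y \<eta> (W (y, 0), after_first n y W))" for y
    show ?case
    proof (cases "\<forall>i<n. T - s < w i")
      case True
      then have "F y = 0" if "y < n" for y
        using that by (auto simp: F_def ring_contribution_def w_def)
      then have "(\<Sum>y<n. F y) = 0" by simp
      moreover have "weight s \<eta> W = exp (- last_zero \<eta> * (T - s))"
        using True nn s by (intro weight_no_ring) (auto simp: w_def)
      ultimately show ?thesis using True by (simp add: F_def w_def)
    next
      case False
      have "Min (w ` {..<n}) \<in> w ` {..<n}" using n by (intro Min_in) auto
      then obtain y where y: "y < n" "w y = Min (w ` {..<n})" by auto
      have le: "w y \<le> w i" if "i < n" for i using that y by simp
      have lt: "w y < w i" if "i < n" "i \<noteq> y" for i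
      proof -
        have "fst (W (y, 0)) \<noteq> fst (W (i, 0))" using elim(3) y(1) that by blast
        then show ?thesis using le[OF that(1)] by (simp add: w_def)
      qed
      have wy: "w y \<le> T - s" using False le by force
      have "F i = 0" if "i < n" "i \<noteq> y" for i
        using lt[OF that] y(1) that by (force simp: F_def w_def indicator_def)
      then have "(\<Sum>i<n. F i) = (\<Sum>i<n. if i = y then F y else 0)"
        by (intro sum.cong) auto
      also have "\<dots> = F y" using y(1) by simp
      also have "F y = ring_contribution s y \<eta> (W (y, 0), after_first n y W)"
        using lt by (auto simp: F_def w_def)
      also have "\<dots> = ennreal (weight s \<eta> W)"
      proof -
        have "first_ring n y W"
          using y(1) nn elim(2) lt by unfold_locales (auto simp: w_def)
        from weight_first_ring[OF this _ elim(4), of s \<eta>] wy show ?thesis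
          by (simp add: ring_contribution_def w_def)
      qed
      finally show ?thesis using False by (auto simp: F_def w_def)
    qed
  qed
qed

text \<open>Survival of the other clocks and the density of the first mark multiply to
  \<open>exp (- n * r)\<close>, the coin averages to \<open>jump\<close>, and a translation by
  \<open>s\<close> passes to absolute time.\<close>

lemma nn_integral_ring_contribution:
  assumes y: "y < n"
  shows "(\<integral>\<^sup>+ W. indicator (rings_first n y) W *
      ring_contribution s y \<eta> (W (y, 0), after_first n y W) \<partial>noise) =
    (\<integral>\<^sup>+ r. ennreal (indicator {s..T} r * (exp (- (real n + last_zero \<eta>) * (r - s)) * jump p A r y (g r) \<eta>)) \<partial>lborel)"
proof -
  define \<psi> where "\<psi> z = ennreal (exp (- fst z * (real n - 1))) * (indicator {..T - s} (fst z) *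
     ennreal (exp (- last_zero \<eta> * fst z) * g (s + fst z) (flip_at A (s + fst z) y \<eta> (snd z))))" for z :: "real \<times> bool"
  have "(\<integral>\<^sup>+ W. indicator (rings_first n y) W *
      ring_contribution s y \<eta> (W (y, 0), after_first n y W) \<partial>noise) =
    (\<integral>\<^sup>+ z. ennreal (exp (- fst z * (real n - 1))) * (\<integral>\<^sup>+ W. ring_contribution s y \<eta> (z, W) \<partial>noise) \<partial>marks p)"
    by (rule nn_integral_after_first[OF y ring_contribution_measurable p_pos p_less])
  also have "\<dots> = (\<integral>\<^sup>+ z. \<psi> z \<partial>marks p)"
  proof (intro nn_integral_cong)
    fix z :: "real \<times> bool"
    define \<eta>' where "\<eta>' = flip_at A (s + fst z) y \<eta> (snd z)"
    have "(\<integral>\<^sup>+ W. ring_contribution s y \<eta> (z, W) \<partial>noise) =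
      (\<integral>\<^sup>+ W. indicator {..T - s} (fst z) * (ennreal (exp (- last_zero \<eta> * fst z)) * ennreal (weight (s + fst z) \<eta>' W)) \<partial>noise)"
      by (simp add: ring_contribution_def \<eta>'_def ennreal_mult' weight_bounds less_imp_le)
    also have "\<dots> = indicator {..T - s} (fst z) * (ennreal (exp (- last_zero \<eta> * fst z)) * ennreal (g (s + fst z) \<eta>'))"
      using weight_measurable'[of "s + fst z" \<eta>'] by (simp add: nn_integral_cmult ennreal_g)
    finally show "ennreal (exp (- fst z * (real n - 1))) * (\<integral>\<^sup>+ W. ring_contribution s y \<eta> (z, W) \<partial>noise) = \<psi> z"
      by (simp add: \<psi>_def \<eta>'_def ennreal_mult' g_bounds)
  qed
  also have "\<dots> = (\<integral>\<^sup>+ r. ennreal (indicator {0..} r * exp (- r)) * (ennreal p * \<psi> (r, True) + ennreal (1 - p) * \<psi> (r, False)) \<partial>lborel)"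
  proof (rule nn_integral_marks[OF _ p_pos p_less])
    note [measurable] = measurable_fst_marks
    have "(\<lambda>z. g (s + fst z) \<xi>) \<in> borel_measurable (marks p)" for \<xi>
      by (rule measurable_compose[OF measurable_shift_fst g_measurable])
    from measurable_flip[OF measurable_ident this]
    have [measurable]: "(\<lambda>z. g (s + fst z) (flip_at A (s + fst z) y \<eta> (snd z))) \<in> borel_measurable (marks p)"
      by simp
    have "\<psi> \<in> borel_measurable (marks p)"
      unfolding \<psi>_def by measurable
    then show "\<psi> \<in> borel_measurable (borel \<Otimes>\<^sub>M count_space UNIV)"
      by (simp add: measurable_cong_sets[OF sets_marks refl])
  qed
  also have "\<dots> = (\<integral>\<^sup>+ r. ennreal (indicator {0..T - s} r * (exp (- (real n + last_zero \<eta>) * r) * jump p A (s + r) y (g (s + r)) \<eta>)) \<partial>lborel)"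
  proof (intro nn_integral_cong)
    fix r :: real
    define J where "J = jump p A (s + r) y (g (s + r)) \<eta>"
    define gt gf where "gt = g (s + r) (flip_at A (s + r) y \<eta> True)" and "gf = g (s + r) (flip_at A (s + r) y \<eta> False)"
    have J: "J = p * gt + (1 - p) * gf"
      by (auto simp: J_def jump_def gt_def gf_def flip_at_def avg_def algebra_simps)
    have b: "0 \<le> gt" "0 \<le> gf" by (auto simp: gt_def gf_def g_bounds)
    show "ennreal (indicator {0..} r * exp (- r)) * (ennreal p * \<psi> (r, True) + ennreal (1 - p) * \<psi> (r, False)) =
      ennreal (indicator {0..T - s} r * (exp (- (real n + last_zero \<eta>) * r) * J))"
    proof (cases "0 \<le> r \<and> r \<le> T - s")
      case True
      define E where "E = exp (- r * (real n - 1)) * exp (- last_zero \<eta> * r)"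
      have "\<psi> (r, True) = ennreal (E * gt)" "\<psi> (r, False) = ennreal (E * gf)"
        using True by (auto simp: \<psi>_def E_def gt_def gf_def ennreal_mult' mult.assoc g_bounds)
      then have "ennreal p * \<psi> (r, True) + ennreal (1 - p) * \<psi> (r, False) = ennreal (p * (E * gt) + (1 - p) * (E * gf))"
        using b p_pos p_less by (simp add: ennreal_mult' ennreal_plus E_def)
      also have "p * (E * gt) + (1 - p) * (E * gf) = E * J" by (simp add: J algebra_simps)
      finally have "ennreal (indicator {0..} r * exp (- r)) * (ennreal p * \<psi> (r, True) + ennreal (1 - p) * \<psi> (r, False)) =
          ennreal (exp (- r) * (E * J))"
        using True by (simp add: ennreal_mult')
      also have "exp (- r) * (E * J) = exp (- (real n + last_zero \<eta>) * r) * J"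
        by (simp add: E_def mult.assoc[symmetric] exp_add[symmetric] algebra_simps)
      finally show ?thesis using True by simp
    next
      case False
      then show ?thesis by (auto simp: \<psi>_def indicator_def)
    qed
  qed
  also have "\<dots> = (\<integral>\<^sup>+ r. ennreal (indicator {s..T} r * (exp (- (real n + last_zero \<eta>) * (r - s)) * jump p A r y (g r) \<eta>)) \<partial>lborel)"
  proof (subst nn_integral_real_affine[where t = "- s" and c = 1])
    have [measurable]: "(\<lambda>r. jump p A (s + r) y (g (s + r)) \<eta>) \<in> borel_measurable borel"
    proof -
      note [measurable] = g_measurable legal_measurable
      have [measurable]: "(\<lambda>r. jump p A r y (g r) \<eta>) \<in> borel_measurable borel"
        unfolding jump_def avg_def by measurable
      show ?thesis by measurable
    qed
    show "(\<lambda>r. ennreal (indicator {0..T - s} r * (exp (- (real n + last_zero \<eta>) * r) * jump p A (s + r) y (g (s + r)) \<eta>)))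
        \<in> borel_measurable borel" by measurable
  qed (auto intro!: nn_integral_cong simp: indicator_def)
  finally show ?thesis .
qed

text \<open>Expectation of the pathwise decomposition at the first ring. It is computed with
  nonnegative integrals and carried over to real ones at the end.\<close>

lemma g_equation:
  assumes s: "0 \<le> s" "s \<le> T"
  shows "g s \<eta> = exp (- (real n + last_zero \<eta>) * (T - s)) +
       integral {s..T} (\<lambda>r. exp (- (real n + last_zero \<eta>) * (r - s)) * (\<Sum>y<n. jump p A r y (g r) \<eta>))"
proof -
  define E where "E r = exp (- (real n + last_zero \<eta>) * (r - s))" for r
  define j where "j y r = E r * jump p A r y (g r) \<eta>" for y r
  have jm: "j y \<in> borel_measurable borel" for y
  proof -
    note [measurable] = g_measurable legal_measurable
    show ?thesis unfolding j_def E_def jump_def avg_def by measurable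
  qed
  have V: "0 \<le> last_zero \<eta>" by (simp add: zero_at_def)
  have jump01: "0 \<le> jump p A r y (g r) \<eta>" "jump p A r y (g r) \<eta> \<le> 1" for r y
    using jump_mono[of "\<lambda>_. 0" "g r" A r y \<eta>] jump_mono[of "g r" "\<lambda>_. 1" A r y \<eta>]
    by (simp_all add: jump_const g_bounds)
  have j0: "0 \<le> j y r" for y r using jump01 by (simp add: j_def E_def)
  have jb: "\<bar>j y r\<bar> \<le> 1" if "r \<in> {s..T}" for y r
  proof -
    have "E r \<le> 1" using that V by (simp add: E_def mult_nonpos_nonneg)
    then show ?thesis using jump01[of r y] unfolding j_def abs_mult by (intro mult_le_one) (auto simp: E_def)
  qed
  have int: "j y integrable_on {s..T}" "set_integrable lborel {s..T} (j y)" for y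
    by (rule integrable_on_bounded[where B = 1], rule jm, erule jb)+
  have Ij: "(\<integral>\<^sup>+ r. ennreal (indicator {s..T} r * j y r) \<partial>lborel) = ennreal (integral {s..T} (j y))" for y
  proof -
    have "integrable lborel (\<lambda>r. indicator {s..T} r * j y r)"
      using int(2)[of y] by (simp add: set_integrable_def)
    then have "(\<integral>\<^sup>+ r. ennreal (indicator {s..T} r * j y r) \<partial>lborel) = ennreal (LBINT r:{s..T}. j y r)"
      unfolding set_lebesgue_integral_def
      by (subst nn_integral_eq_integral) (auto intro!: mult_nonneg_nonneg j0)
    then show ?thesis using set_borel_integral_eq_integral(2)[OF int(2)[of y]] by simp
  qed
  have m1: "(\<lambda>W. indicator (silent n (T - s)) W :: ennreal) \<in> borel_measurable noise"
  proof -
    have "Measurable.pred noise (\<lambda>W. T - s < fst (W (i, 0)))" if "i < n" for i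
    proof -
      have [measurable]: "(\<lambda>W. fst (W (i, 0))) \<in> borel_measurable noise"
        using that by (intro measurable_fst_mark) auto
      show ?thesis by (rule borel_measurable_pred_less) auto
    qed
    then have "Measurable.pred noise (\<lambda>W. \<forall>i\<in>{..<n}. T - s < fst (W (i, 0)))"
      by (intro pred_intros_finite) auto
    from of_bool_measurable[OF this]
    have "(\<lambda>W. of_bool (\<forall>i\<in>{..<n}. T - s < fst (W (i, 0))) :: ennreal) \<in> borel_measurable noise" .
    then show ?thesis by (rule back_subst[of "\<lambda>f. f \<in> borel_measurable noise"]) (auto simp: fun_eq_iff indicator_def)
  qed
  have m2: "(\<lambda>W. indicator (rings_first n y) W *
      ring_contribution s y \<eta> (W (y, 0), after_first n y W)) \<in> borel_measurable noise" if y: "y < n" for y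
    by (intro borel_measurable_times_ennreal first_measurable
        measurable_compose[OF _ ring_contribution_measurable] measurable_Pair measurable_mark after_first_measurable)
      (use y in auto)
  have "ennreal (g s \<eta>) = (\<integral>\<^sup>+ W. indicator (silent n (T - s)) W * ennreal (exp (- last_zero \<eta> * (T - s))) +
    (\<Sum>y<n. indicator (rings_first n y) W *
      ring_contribution s y \<eta> (W (y, 0), after_first n y W)) \<partial>noise)"
    unfolding ennreal_g by (rule nn_integral_cong_AE[OF AE_weight_decomposition[OF s(2)]])
  also have "\<dots> = (\<integral>\<^sup>+ W. indicator (silent n (T - s)) W * ennreal (exp (- last_zero \<eta> * (T - s))) \<partial>noise) +
    (\<integral>\<^sup>+ W. (\<Sum>y<n. indicator (rings_first n y) W *
      ring_contribution s y \<eta> (W (y, 0), after_first n y W)) \<partial>noise)"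
  proof (rule nn_integral_add)
    show "(\<lambda>W. indicator (silent n (T - s)) W * ennreal (exp (- last_zero \<eta> * (T - s)))) \<in> borel_measurable noise"
      by (rule borel_measurable_times_ennreal[OF m1 borel_measurable_const])
    show "(\<lambda>W. \<Sum>y<n. indicator (rings_first n y) W *
        ring_contribution s y \<eta> (W (y, 0), after_first n y W)) \<in> borel_measurable noise"
      by (rule borel_measurable_sum) (rule m2, simp)
  qed
  also have "(\<integral>\<^sup>+ W. (\<Sum>y<n. indicator (rings_first n y) W *
      ring_contribution s y \<eta> (W (y, 0), after_first n y W)) \<partial>noise) =
     (\<Sum>y<n. \<integral>\<^sup>+ W. indicator (rings_first n y) W *
      ring_contribution s y \<eta> (W (y, 0), after_first n y W) \<partial>noise)"
    by (rule nn_integral_sum) (rule m2, simp)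
  also have "\<dots> = (\<Sum>y<n. ennreal (integral {s..T} (j y)))"
    by (intro sum.cong refl) (simp only: nn_integral_ring_contribution lessThan_iff j_def[symmetric] E_def[symmetric] Ij)
  also have "\<dots> = ennreal (\<Sum>y<n. integral {s..T} (j y))"
    by (intro sum_ennreal integral_nonneg int j0)
  also have "(\<Sum>y<n. integral {s..T} (j y)) = integral {s..T} (\<lambda>r. \<Sum>y<n. j y r)"
    by (intro Henstock_Kurzweil_Integration.integral_sum[symmetric] int) auto
  also have "(\<integral>\<^sup>+ W. indicator (silent n (T - s)) W * ennreal (exp (- last_zero \<eta> * (T - s))) \<partial>noise) =
      ennreal (E T)"
  proof -
    have "(\<integral>\<^sup>+ W. indicator (silent n (T - s)) W * ennreal (exp (- last_zero \<eta> * (T - s))) \<partial>noise) =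
      ennreal (exp (- (T - s) * real n)) * ennreal (exp (- last_zero \<eta> * (T - s)))"
      using s nn_integral_no_ring[OF p_pos p_less, of "T - s" n] by (subst nn_integral_multc[OF m1]) simp
    also have "\<dots> = ennreal (exp (- (T - s) * real n) * exp (- last_zero \<eta> * (T - s)))"
      by (rule ennreal_mult'[symmetric]) simp
    also have "exp (- (T - s) * real n) * exp (- last_zero \<eta> * (T - s)) = E T"
      by (simp add: E_def algebra_simps flip: exp_add)
    finally show ?thesis .
  qed
  also have "ennreal (E T) + ennreal (integral {s..T} (\<lambda>r. \<Sum>y<n. j y r)) = ennreal (E T + integral {s..T} (\<lambda>r. \<Sum>y<n. j y r))"
    by (intro ennreal_plus[symmetric] integral_nonneg integrable_sum int sum_nonneg j0) (auto simp: E_def)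
  finally have "g s \<eta> = E T + integral {s..T} (\<lambda>r. \<Sum>y<n. j y r)"
    by (subst (asm) ennreal_inj) (auto simp: E_def g_bounds intro!: add_nonneg_nonneg integral_nonneg integrable_sum int sum_nonneg j0)
  then show ?thesis by (simp add: E_def j_def sum_distrib_left)
qed

theorem weight_decay:
  assumes c: "coercive p c" and \<eta>: "\<And>i. i < n \<Longrightarrow> \<eta> i \<in> {0, 1}"
  shows "(LINT W|noise. weight 0 \<eta> W) \<le>
    (1 / min p (1 - p)) ^ n * exp (- c * integral {0..T} (\<lambda>r. of_bool (A r 0)))"
proof -
  interpret first_ring_equation p A n T c g
    using n T A_measurable g_measurable g_bounds g_equation c by unfold_locales
  show ?thesis using decay[OF \<eta>] by (simp add: g_def)
qed

end

section \<open>Lines in the lattice\<close>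

text \<open>The index sets may be infinite, so the two laws are compared on finite cylinders, where
  merging separates the conditions on \<open>I\<close> from those on \<open>J\<close>.\<close>

lemma distr_merge_marks_on:
  fixes I J :: "'i set"
  assumes "I \<inter> J = {}"
  shows "distr (marks_on p I \<Otimes>\<^sub>M marks_on p J) (marks_on p (I \<union> J)) (merge I J) = marks_on p (I \<union> J)"
  unfolding marks_on_def
proof (rule measure_eqI_PiM_infinite)
  let ?IJ = "Pi\<^sub>M I (\<lambda>_. marks p) \<Otimes>\<^sub>M Pi\<^sub>M J (\<lambda>_. marks p)"
  let ?D = "distr ?IJ (Pi\<^sub>M (I \<union> J) (\<lambda>_. marks p)) (merge I J)"
  interpret I: prob_space "Pi\<^sub>M I (\<lambda>_. marks p)" by (intro prob_space_PiM prob_space_marks)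
  interpret J: prob_space "Pi\<^sub>M J (\<lambda>_. marks p)" by (intro prob_space_PiM prob_space_marks)
  interpret IJ: pair_prob_space "Pi\<^sub>M I (\<lambda>_. marks p)" "Pi\<^sub>M J (\<lambda>_. marks p)" ..
  interpret D: prob_space "distr ?IJ (Pi\<^sub>M (I \<union> J) (\<lambda>_. marks p)) (merge I J)"
    by (rule IJ.prob_space_distr) simp
  show "finite_measure ?D"
    by unfold_locales
  fix F and A :: "'i \<Rightarrow> (real \<times> bool) set"
  assume F: "finite F" "F \<subseteq> I \<union> J" and A: "\<And>i. i \<in> F \<Longrightarrow> A i \<in> sets (marks p)"
  let ?X = "prod_emb (I \<union> J) (\<lambda>_. marks p) F (Pi\<^sub>E F A)"
  have "merge I J -` ?X \<inter> space ?IJ =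
    prod_emb I (\<lambda>_. marks p) (F \<inter> I) (Pi\<^sub>E (F \<inter> I) A) \<times> prod_emb J (\<lambda>_. marks p) (F \<inter> J) (Pi\<^sub>E (F \<inter> J) A)"
  proof (rule set_eqI)
    fix x :: "('i \<Rightarrow> real \<times> bool) \<times> ('i \<Rightarrow> real \<times> bool)"
    obtain a b where x: "x = (a, b)" by (cases x)
    have emb: "f \<in> prod_emb K (\<lambda>_. marks p) G (Pi\<^sub>E G A) \<longleftrightarrow> f \<in> extensional K \<and> (\<forall>i\<in>G. f i \<in> A i)"
      for f and K G :: "'i set"
    proof -
      have "f \<in> (\<Pi>\<^sub>E i\<in>K. space (marks p)) \<longleftrightarrow> f \<in> extensional K" by (simp add: PiE_def)
      then show ?thesis
        by (simp only: prod_emb_def Int_iff vimage_eq restrict_PiE_iff) blast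
    qed
    have "(\<forall>i\<in>F. merge I J (a, b) i \<in> A i) \<longleftrightarrow> (\<forall>i\<in>F \<inter> I. a i \<in> A i) \<and> (\<forall>i\<in>F \<inter> J. b i \<in> A i)"
    proof -
      have "merge I J (a, b) i = a i" if "i \<in> I" for i using that by (simp add: merge_def)
      moreover have "merge I J (a, b) i = b i" if "i \<in> J" for i
        using that assms by (auto simp: merge_def)
      moreover have "(\<forall>i\<in>F. P i) \<longleftrightarrow> (\<forall>i\<in>F \<inter> I. P i) \<and> (\<forall>i\<in>F \<inter> J. P i)" for P
        using F(2) by blast
      ultimately show ?thesis by simp
    qed
    then show "x \<in> merge I J -` ?X \<inter> space ?IJ \<longleftrightarrow>
      x \<in> prod_emb I (\<lambda>_. marks p) (F \<inter> I) (Pi\<^sub>E (F \<inter> I) A) \<times> prod_emb J (\<lambda>_. marks p) (F \<inter> J) (Pi\<^sub>E (F \<inter> J) A)"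
    proof -
      assume *: "(\<forall>i\<in>F. merge I J (a, b) i \<in> A i) \<longleftrightarrow> (\<forall>i\<in>F \<inter> I. a i \<in> A i) \<and> (\<forall>i\<in>F \<inter> J. b i \<in> A i)"
      have "merge I J (a, b) \<in> extensional (I \<union> J)" by simp
      moreover have "(a, b) \<in> space ?IJ \<longleftrightarrow>
          a \<in> extensional I \<and> b \<in> extensional J"
        by (simp add: space_pair_measure space_PiM PiE_def)
      ultimately show ?thesis
        unfolding x using * by (simp only: vimage_eq Int_iff mem_Times_iff fst_conv snd_conv emb) blast
    qed
  qed
  then have "emeasure ?D ?X =
    emeasure ?IJ
     (prod_emb I (\<lambda>_. marks p) (F \<inter> I) (Pi\<^sub>E (F \<inter> I) A) \<times> prod_emb J (\<lambda>_. marks p) (F \<inter> J) (Pi\<^sub>E (F \<inter> J) A))"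
    using F A by (subst emeasure_distr) (auto intro!: sets_PiM_I)
  also have "\<dots> = (\<Prod>i\<in>F \<inter> I. emeasure (marks p) (A i)) * (\<Prod>i\<in>F \<inter> J. emeasure (marks p) (A i))"
    using F A
    by (subst J.emeasure_pair_measure_Times)
      (auto intro!: sets_PiM_I arg_cong2[where f = "(*)"] emeasure_PiM_emb prob_space_marks)
  also have "\<dots> = (\<Prod>i\<in>F \<inter> I \<union> F \<inter> J. emeasure (marks p) (A i))"
    using F assms by (intro prod.union_disjoint[symmetric]) auto
  also have "F \<inter> I \<union> F \<inter> J = F" using F by auto
  also have "(\<Prod>i\<in>F. emeasure (marks p) (A i)) = emeasure (Pi\<^sub>M (I \<union> J) (\<lambda>_. marks p)) ?X"
    using F A by (intro emeasure_PiM_emb[symmetric] prob_space_marks) auto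
  finally show "emeasure ?D ?X =
    emeasure (Pi\<^sub>M (I \<union> J) (\<lambda>_. marks p)) ?X" .
qed simp_all

lemma noise_measure_eq: "noise_measure p = marks_on p (quadrant \<times> UNIV)"
  unfolding noise_measure_def marks_on_def marks_def ..

text \<open>Constraints look only at sites \<open>y - e\<close>, so by recursion the spin at
  \<open>y\<close> is determined by the noise at sites that are below \<open>y\<close> in every
  coordinate.\<close>

lemma spin_after_cong:
  assumes "y \<in> quadrant"
    and "\<And>y' k. y' \<in> quadrant \<Longrightarrow> (\<And>i. y' $ i \<le> y $ i) \<Longrightarrow> \<omega> (y', k) = \<omega>' (y', k)"
  shows "spin_after es \<eta> \<omega> y n = spin_after es \<eta> \<omega>' y n"
  using assms
proof (induction "nat (\<Sum>i\<in>UNIV. y $ i)" arbitrary: y n rule: less_induct)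
  case less
  note eq = less.prems(2)
  have ring: "ring_time \<omega> y k = ring_time \<omega>' y k" for k
    unfolding ring_time_def using less.prems by (intro sum.cong) auto
  show ?case
  proof (induction n)
    case (Suc n)
    have "extend (min_bc es) (\<lambda>y'. spin_after es \<eta> \<omega> y' (card {k. ring_time \<omega> y' k < ring_time \<omega> y n})) (y - e) =
      extend (min_bc es) (\<lambda>y'. spin_after es \<eta> \<omega>' y' (card {k. ring_time \<omega>' y' k < ring_time \<omega>' y n})) (y - e)"
      if e: "e \<in> canon_basis" for e
    proof (cases "y - e \<in> quadrant")
      case True
      from e obtain j where "e = axis j 1" by (auto simp: canon_basis_def)
      then have le: "(y - e) $ i \<le> y $ i" for i by (simp add: axis_def)
      have agree: "\<omega> (y', k) = \<omega>' (y', k)" if "y' \<in> quadrant" "\<And>i. y' $ i \<le> (y - e) $ i" for y' k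
        using that(2) le by (intro eq that(1)) (meson order_trans)
      have "ring_time \<omega> (y - e) k = ring_time \<omega>' (y - e) k" for k
        unfolding ring_time_def using True by (intro sum.cong refl arg_cong[where f = fst] agree) auto
      moreover have "spin_after es \<eta> \<omega> (y - e) m = spin_after es \<eta> \<omega>' (y - e) m" for m
        using agree by (intro less.hyps sum_minus_basis_less e True) auto
      ultimately show ?thesis by (simp add: extend_def ring)
    qed (simp add: extend_def)
    then have "(\<exists>e\<in>canon_basis. extend (min_bc es) (\<lambda>y'. spin_after es \<eta> \<omega> y' (card {k. ring_time \<omega> y' k < ring_time \<omega> y n})) (y - e) = 0) =
      (\<exists>e\<in>canon_basis. extend (min_bc es) (\<lambda>y'. spin_after es \<eta> \<omega>' y' (card {k. ring_time \<omega>' y' k < ring_time \<omega>' y n})) (y - e) = 0)"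
      by simp
    moreover have "coin \<omega> y n = coin \<omega>' y n" using less.prems by (simp add: coin_def)
    ultimately show ?case using Suc by (simp only: spin_after.simps)
  qed simp
qed

locale lattice_line =
  fixes es :: "int ^ 'd" and \<eta> :: "int ^ 'd \<Rightarrow> nat" and z :: "int ^ 'd" and i :: 'd and m :: nat
  assumes m: "0 < m" and line_quadrant: "\<And>k. z + axis i (int (Suc k)) \<in> quadrant"
begin

definition site :: "nat \<Rightarrow> int ^ 'd" where "site k = z + axis i (int (Suc k))"

definition "sites = site ` {..<m}"

definition "env_index = (quadrant - sites) \<times> (UNIV :: nat set)"

definition on_sites :: "(nat \<times> nat \<Rightarrow> real \<times> bool) \<Rightarrow> 'd noise" where
  "on_sites W = (\<lambda>j\<in>sites \<times> UNIV. W (the_inv_into {..<m} site (fst j), snd j))"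

text \<open>Lattice noise assembled from two independent pieces, so that the environment noise
  \<open>\<rho>\<close> can be held fixed while the line noise \<open>W\<close> is
  integrated.\<close>

definition join :: "'d noise \<Rightarrow> (nat \<times> nat \<Rightarrow> real \<times> bool) \<Rightarrow> 'd noise" where
  "join \<rho> W = merge env_index (sites \<times> UNIV) (\<rho>, on_sites W)"

lemma site_quadrant: "site k \<in> quadrant"
  unfolding site_def by (rule line_quadrant)

lemma inj_site: "inj site"
  by (rule injI) (simp add: site_def axis_eq_axis)

lemma site_minus: "site (Suc k) - axis i 1 = site k" "site 0 - axis i 1 = z"
  by (simp_all add: site_def vec_eq_iff axis_def)

lemma site_nth: "site k $ j = z $ j + (if j = i then int (Suc k) else 0)"
  by (simp add: site_def axis_def)

lemma join_site: "k < m \<Longrightarrow> join \<rho> W (site k, l) = W (k, l)"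
  using inj_site
  by (simp add: join_def on_sites_def merge_def env_index_def sites_def the_inv_into_f_f inj_on_subset[OF inj_site])

lemma join_env: "y \<in> quadrant \<Longrightarrow> y \<notin> sites \<Longrightarrow> join \<rho> W (y, l) = \<rho> (y, l)"
  by (simp add: join_def merge_def env_index_def)

lemma index_split: "env_index \<union> sites \<times> UNIV = quadrant \<times> (UNIV :: nat set)"
  using site_quadrant by (auto simp: env_index_def sites_def)

lemma on_sites_measurable:
  "on_sites \<in> line_noise p m \<rightarrow>\<^sub>M marks_on p (sites \<times> UNIV)"
proof (rule measurable_to_marks_on)
  fix j :: "(int ^ 'd) \<times> nat" assume j: "j \<in> sites \<times> UNIV"
  then have "the_inv_into {..<m} site (fst j) < m"
    by (auto simp: sites_def the_inv_into_f_f inj_on_subset[OF inj_site])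
  then show "(\<lambda>W. on_sites W j) \<in> line_noise p m \<rightarrow>\<^sub>M marks p"
    using j by (auto simp: on_sites_def intro!: measurable_mark)
qed (simp add: on_sites_def)

lemma distr_on_sites:
  "distr (line_noise p m) (marks_on p (sites \<times> UNIV)) on_sites = marks_on p (sites \<times> UNIV)"
proof -
  let ?f = "\<lambda>j. (the_inv_into {..<m} site (fst j), snd j) :: nat \<times> nat"
  have inv: "the_inv_into {..<m} site (site k) = k" if "k < m" for k
    using that by (simp add: the_inv_into_f_f inj_on_subset[OF inj_site])
  have "inj_on ?f (sites \<times> UNIV)" "?f \<in> sites \<times> UNIV \<rightarrow> line_index m"
    by (auto simp: inj_on_def sites_def inv)
  from distr_PiM_reindex[OF _ this, of "\<lambda>_. marks p"] show ?thesis
    unfolding marks_on_def on_sites_def[abs_def] by (simp add: prob_space_marks)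
qed

text \<open>Clocks on the line are independent of those off it: Fubini for the split noise, with the
  sites of the line relabelled by numbers.\<close>

lemma nn_integral_join:
  assumes f: "f \<in> borel_measurable (noise_measure p)"
  shows "(\<integral>\<^sup>+ \<omega>. f \<omega> \<partial>noise_measure p) =
    (\<integral>\<^sup>+ \<rho>. \<integral>\<^sup>+ W. f (join \<rho> W) \<partial>line_noise p m \<partial>marks_on p env_index)"
proof -
  interpret S: prob_space "marks_on p (sites \<times> (UNIV :: nat set))" by (rule prob_space_marks_on)
  have merge: "merge env_index (sites \<times> UNIV) \<in> marks_on p env_index \<Otimes>\<^sub>M marks_on p (sites \<times> UNIV) \<rightarrow>\<^sub>M noise_measure p"
    unfolding noise_measure_eq index_split[symmetric] marks_on_def by (rule measurable_merge)
  note [measurable] = f merge on_sites_measurable[of p]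
  have "distr (marks_on p env_index \<Otimes>\<^sub>M marks_on p (sites \<times> UNIV)) (noise_measure p) (merge env_index (sites \<times> UNIV)) = noise_measure p"
    unfolding noise_measure_eq index_split[symmetric] by (rule distr_merge_marks_on) (auto simp: env_index_def)
  then have "(\<integral>\<^sup>+ \<omega>. f \<omega> \<partial>noise_measure p) = (\<integral>\<^sup>+ \<omega>. f \<omega> \<partial>distr (marks_on p env_index \<Otimes>\<^sub>M marks_on p (sites \<times> UNIV))
      (noise_measure p) (merge env_index (sites \<times> UNIV)))"
    by simp
  also have "\<dots> = (\<integral>\<^sup>+ x. f (merge env_index (sites \<times> UNIV) x) \<partial>(marks_on p env_index \<Otimes>\<^sub>M marks_on p (sites \<times> UNIV)))"
    using f by (intro nn_integral_distr[OF merge]) simp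
  also have "\<dots> = (\<integral>\<^sup>+ \<rho>. \<integral>\<^sup>+ V. f (merge env_index (sites \<times> UNIV) (\<rho>, V)) \<partial>marks_on p (sites \<times> UNIV) \<partial>marks_on p env_index)"
    by (rule S.nn_integral_fst[symmetric]) measurable
  also have "\<dots> = (\<integral>\<^sup>+ \<rho>. \<integral>\<^sup>+ W. f (join \<rho> W) \<partial>line_noise p m \<partial>marks_on p env_index)"
  proof (rule nn_integral_cong)
    fix \<rho> assume \<rho>: "\<rho> \<in> space (marks_on p env_index)"
    have "(\<lambda>V. f (merge env_index (sites \<times> UNIV) (\<rho>, V))) \<in> borel_measurable (marks_on p (sites \<times> UNIV))"
      by (rule measurable_compose[OF measurable_compose[OF measurable_Pair1'[OF \<rho>] merge] f])
    then show "(\<integral>\<^sup>+ V. f (merge env_index (sites \<times> UNIV) (\<rho>, V)) \<partial>marks_on p (sites \<times> UNIV)) =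
        (\<integral>\<^sup>+ W. f (join \<rho> W) \<partial>line_noise p m)"
      by (subst distr_on_sites[symmetric], subst nn_integral_distr[OF on_sites_measurable]) (auto simp: join_def)
  qed
  finally show ?thesis .
qed

text \<open>
  The predecessor \<open>site (k - 1)\<close> on the line is left out here, since \<^const>\<open>lspin\<close> accounts for it.
\<close>

definition env_legal :: "'d noise \<Rightarrow> real \<Rightarrow> nat \<Rightarrow> bool" where
  "env_legal \<rho> r k \<longleftrightarrow> (\<exists>e\<in>canon_basis. (e \<noteq> axis i 1 \<or> k = 0) \<and>
    extend (min_bc es) (\<lambda>y. spin_after es \<eta> \<rho> y (card {l. ring_time \<rho> y l < r})) (site k - e) = 0)"

text \<open>Sites below \<open>site k - e\<close> avoid the line. If \<open>e\<close> is
  transversal, their coordinate in that direction is less than the common value on the line; if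
  \<open>e\<close> points along the line, then \<open>k = 0\<close> and their coordinate
  \<open>i\<close> is at most that of \<open>z\<close>.\<close>

lemma env_agree:
  assumes "e \<in> canon_basis" "e \<noteq> axis i 1 \<or> k = 0" "y \<in> quadrant" "\<And>j. y $ j \<le> (site k - e) $ j"
  shows "join \<rho> W (y, l) = \<rho> (y, l)"
proof (rule join_env[OF assms(3)])
  from assms(1) obtain j where j: "e = axis j 1" by (auto simp: canon_basis_def)
  show "y \<notin> sites"
  proof
    assume "y \<in> sites"
    then obtain k' where k': "y = site k'" by (auto simp: sites_def)
    from assms(4)[of j] show False
      using assms(2) j by (auto simp: k' site_nth axis_def split: if_splits)
  qed
qed

lemma env_state_cong:
  assumes "e \<in> canon_basis" "e \<noteq> axis i 1 \<or> k = 0"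
  shows "extend (min_bc es) (\<lambda>y. spin_after es \<eta> (join \<rho> W) y (card {l. ring_time (join \<rho> W) y l < r})) (site k - e) =
    extend (min_bc es) (\<lambda>y. spin_after es \<eta> \<rho> y (card {l. ring_time \<rho> y l < r})) (site k - e)"
proof (cases "site k - e \<in> quadrant")
  case True
  have "ring_time (join \<rho> W) (site k - e) l = ring_time \<rho> (site k - e) l" for l
    unfolding ring_time_def by (intro sum.cong refl arg_cong[where f = fst] env_agree[OF assms True]) simp
  moreover have "spin_after es \<eta> (join \<rho> W) (site k - e) n = spin_after es \<eta> \<rho> (site k - e) n" for n
    by (intro spin_after_cong True env_agree[OF assms])
  ultimately show ?thesis by (simp add: extend_def)
qed (simp add: extend_def)

lemma ring_time_site: "k < m \<Longrightarrow> ring_time (join \<rho> W) (site k) l = lring W k l"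
  by (simp add: ring_time_def lring_def join_site)

text \<open>The neighbours of a line site are its predecessor on the line and sites whose history is
  a function of \<open>\<rho>\<close> alone, so the lattice recursion becomes that of
  \<open>lspin\<close>. For \<open>k = 0\<close> the predecessor also belongs to the
  environment.\<close>

lemma spin_after_site:
  assumes "k < m"
  shows "spin_after es \<eta> (join \<rho> W) (site k) l = lspin (env_legal \<rho>) 0 (\<lambda>k. \<eta> (site k)) W k l"
  using assms
proof (induction k arbitrary: l rule: less_induct)
  case (less k)
  show ?case
  proof (induction l)
    case (Suc l)
    let ?state = "\<lambda>e. extend (min_bc es) (\<lambda>y. spin_after es \<eta> (join \<rho> W) y
        (card {j. ring_time (join \<rho> W) y j < ring_time (join \<rho> W) (site k) l})) (site k - e)"
    have "(\<exists>e\<in>canon_basis. ?state e = 0) \<longleftrightarrow>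
      (\<exists>e\<in>canon_basis. (e \<noteq> axis i 1 \<or> k = 0) \<and> ?state e = 0) \<or> (0 < k \<and> ?state (axis i 1) = 0)"
    proof -
      have "(\<exists>e\<in>B. P e) \<longleftrightarrow> (\<exists>e\<in>B. (e \<noteq> a \<or> k = 0) \<and> P e) \<or> (0 < k \<and> P a)"
        if "a \<in> B" for a :: "int ^ 'd" and B P
        using that by (cases "k = 0") auto
      from this[of "axis i 1" canon_basis] show ?thesis by (simp add: canon_basis_def)
    qed
    also have "(\<exists>e\<in>canon_basis. (e \<noteq> axis i 1 \<or> k = 0) \<and> ?state e = 0) \<longleftrightarrow> env_legal \<rho> (lring W k l) k"
      unfolding env_legal_def using less.prems
      by (intro bex_cong refl conj_cong) (simp add: env_state_cong ring_time_site)
    also have "0 < k \<and> ?state (axis i 1) = 0 \<longleftrightarrow>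
      0 < k \<and> lspin (env_legal \<rho>) 0 (\<lambda>k. \<eta> (site k)) W (k - 1) (card {j. lring W (k - 1) j < lring W k l}) = 0"
    proof (cases k)
      case (Suc k')
      then show ?thesis
        using less.IH[of k'] less.prems
        by (simp add: site_minus extend_def site_quadrant ring_time_site)
    qed simp
    finally show ?case
      using Suc less.prems by (simp add: coin_def join_site)
  qed simp
qed

lemma east_site:
  "k < m \<Longrightarrow> east es \<eta> (join \<rho> W) t (site k) = lstate (env_legal \<rho>) 0 (\<lambda>k. \<eta> (site k)) W t k"
  by (simp add: east_def lstate_def spin_after_site ring_time_site)

lemma env_legal_measurable: "Measurable.pred borel (\<lambda>r. env_legal \<rho> r k)"
proof -
  have nb: "Measurable.pred borel (\<lambda>r. extend (min_bc es) (\<lambda>y. spin_after es \<eta> \<rho> y (card {l. ring_time \<rho> y l < r})) y = 0)" for y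
  proof (cases "y \<in> quadrant")
    case True
    have "(\<lambda>r. spin_after es \<eta> \<rho> y (card {l. ring_time \<rho> y l < r})) \<in> borel \<rightarrow>\<^sub>M count_space UNIV"
      by (rule measurable_compose_countable[where g = "\<lambda>r. card {l. ring_time \<rho> y l < r}"]) measurable
    then show ?thesis by (simp add: extend_def True)
  qed (simp add: extend_def)
  have "Measurable.pred borel (\<lambda>r. \<exists>e\<in>{e \<in> canon_basis. e \<noteq> axis i 1 \<or> k = 0}.
      extend (min_bc es) (\<lambda>y. spin_after es \<eta> \<rho> y (card {l. ring_time \<rho> y l < r})) (site k - e) = 0)"
    by (rule pred_intros_finite(4)[OF _ nb]) (simp add: canon_basis_def)
  moreover have "(\<lambda>r. env_legal \<rho> r k) = (\<lambda>r. \<exists>e\<in>{e \<in> canon_basis. e \<noteq> axis i 1 \<or> k = 0}.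
      extend (min_bc es) (\<lambda>y. spin_after es \<eta> \<rho> y (card {l. ring_time \<rho> y l < r})) (site k - e) = 0)"
    unfolding env_legal_def by (intro ext) blast
  ultimately show ?thesis by (simp only:)
qed

end

section \<open>Iteration over the coordinates\<close>

lemma occupation_time_measurable_pred:
  "x \<in> quadrant \<Longrightarrow> Measurable.pred (noise_measure p) (\<lambda>\<omega>. occupation_time es \<eta> t x \<omega> \<le> a)"
  using borel_measurable_le[OF measurable_occupation_time borel_measurable_const] by (simp add: pred_def)

lemma noise_prob_le_1: "noise_prob p S \<le> 1"
  unfolding noise_prob_def by (rule prob_space.prob_le_1[OF prob_space_noise_measure])

lemma noise_prob_mono:
  assumes "Measurable.pred (noise_measure p) R" "\<And>\<omega>. S \<omega> \<Longrightarrow> R \<omega>"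
  shows "noise_prob p S \<le> noise_prob p R"
proof -
  interpret prob_space "noise_measure p" by (rule prob_space_noise_measure)
  show ?thesis unfolding noise_prob_def
    using predE[OF assms(1)] assms(2) by (intro finite_measure_mono) auto
qed

lemma noise_prob_split:
  assumes "Measurable.pred (noise_measure p) R" "Measurable.pred (noise_measure p) S"
  shows "noise_prob p R \<le> noise_prob p S + noise_prob p (\<lambda>\<omega>. \<not> S \<omega> \<and> R \<omega>)"
proof -
  interpret prob_space "noise_measure p" by (rule prob_space_noise_measure)
  let ?M = "noise_measure p"
  have R: "{\<omega> \<in> space ?M. R \<omega>} \<in> events" and S: "{\<omega> \<in> space ?M. S \<omega>} \<in> events"
    using assms by (auto dest: predE)
  have SR: "{\<omega> \<in> space ?M. \<not> S \<omega> \<and> R \<omega>} \<in> events"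
    using sets.Diff[OF R S] by (rule back_subst[of "\<lambda>X. X \<in> events"]) auto
  have "measure ?M {\<omega> \<in> space ?M. R \<omega>} \<le> measure ?M ({\<omega> \<in> space ?M. S \<omega>} \<union> {\<omega> \<in> space ?M. \<not> S \<omega> \<and> R \<omega>})"
    using S SR by (intro finite_measure_mono) auto
  also have "\<dots> \<le> measure ?M {\<omega> \<in> space ?M. S \<omega>} + measure ?M {\<omega> \<in> space ?M. \<not> S \<omega> \<and> R \<omega>}"
    by (rule measure_Un_le[OF S SR])
  finally show ?thesis by (simp add: noise_prob_def)
qed

section \<open>One line: from the time of the seed to the occupation time of the last site\<close>

context lattice_line
begin

text \<open>Exponential Markov inequality with the environment fixed. The event \<open>S\<close> may
  involve all clocks, but it forces a lower bound on a seed time that depends on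
  \<open>\<rho>\<close> only; for such \<open>\<rho>\<close> the decay on the line applies.\<close>

lemma stage:
  assumes p: "0 < p" "p < 1" and t: "0 \<le> t" and c: "coercive p c" and \<eta>: "\<eta> \<in> configs"
    and S: "Measurable.pred (noise_measure p) S"
    and S_seed: "\<And>\<rho> W. S (join \<rho> W) \<Longrightarrow> \<delta> * t \<le> integral {0..t} (\<lambda>r. of_bool (env_legal \<rho> r 0))"
  shows "noise_prob p (\<lambda>\<omega>. S \<omega> \<and> occupation_time es \<eta> t (site (m - 1)) \<omega> \<le> \<epsilon> * t) \<le>
    (1 / min p (1 - p)) ^ m * exp (\<epsilon> * t - c * (\<delta> * t))"
proof -
  interpret N: prob_space "noise_measure p" by (rule prob_space_noise_measure)
  interpret E: prob_space "marks_on p env_index" by (rule prob_space_marks_on)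
  interpret line_process p "env_legal \<rho>" m t for \<rho>
    using p m t env_legal_measurable by unfold_locales auto
  define B where "B = (1 / min p (1 - p)) ^ m * exp (\<epsilon> * t - c * (\<delta> * t))"
  define occ where "occ = occupation_time es \<eta> t (site (m - 1))"
  have occ [measurable]: "occ \<in> borel_measurable (noise_measure p)"
    unfolding occ_def by (rule measurable_occupation_time[OF site_quadrant])
  have weight: "weight \<rho> 0 (\<lambda>k. \<eta> (site k)) W = exp (- occ (join \<rho> W))" for \<rho> W
    using m by (simp add: weight_def occ_def occupation_time_def set_lebesgue_integral_def east_site)
  define f where "f \<omega> = ennreal (of_bool (S \<omega>) * (exp (\<epsilon> * t) * exp (- occ \<omega>)))" for \<omega>
  note [measurable] = S
  have f [measurable]: "f \<in> borel_measurable (noise_measure p)" unfolding f_def by measurable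
  have "{\<omega> \<in> space (noise_measure p). S \<omega> \<and> occ \<omega> \<le> \<epsilon> * t} \<in> sets (noise_measure p)" by measurable
  then have "ennreal (noise_prob p (\<lambda>\<omega>. S \<omega> \<and> occ \<omega> \<le> \<epsilon> * t)) =
    (\<integral>\<^sup>+ \<omega>. indicator {\<omega> \<in> space (noise_measure p). S \<omega> \<and> occ \<omega> \<le> \<epsilon> * t} \<omega> \<partial>noise_measure p)"
    by (simp add: noise_prob_def N.emeasure_eq_measure)
  also have "\<dots> \<le> (\<integral>\<^sup>+ \<omega>. f \<omega> \<partial>noise_measure p)"
  proof (rule nn_integral_mono)
    fix \<omega>
    have "1 \<le> exp (\<epsilon> * t) * exp (- occ \<omega>)" if "occ \<omega> \<le> \<epsilon> * t"
      using that by (simp flip: exp_add)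
    then show "indicator {\<omega> \<in> space (noise_measure p). S \<omega> \<and> occ \<omega> \<le> \<epsilon> * t} \<omega> \<le> f \<omega>"
      by (auto simp: f_def indicator_def)
  qed
  also have "\<dots> = (\<integral>\<^sup>+ \<rho>. \<integral>\<^sup>+ W. f (join \<rho> W) \<partial>line_noise p m \<partial>marks_on p env_index)"
    by (rule nn_integral_join[OF f])
  also have "\<dots> \<le> (\<integral>\<^sup>+ \<rho>. ennreal B \<partial>marks_on p env_index)"
  proof (rule nn_integral_mono)
    fix \<rho>
    show "(\<integral>\<^sup>+ W. f (join \<rho> W) \<partial>line_noise p m) \<le> ennreal B"
    proof (cases "\<delta> * t \<le> integral {0..t} (\<lambda>r. of_bool (env_legal \<rho> r 0))")
      case True
      have "(\<integral>\<^sup>+ W. f (join \<rho> W) \<partial>line_noise p m) \<le>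
          (\<integral>\<^sup>+ W. ennreal (exp (\<epsilon> * t)) * ennreal (weight \<rho> 0 (\<lambda>k. \<eta> (site k)) W) \<partial>line_noise p m)"
        by (intro nn_integral_mono) (simp add: f_def weight ennreal_mult')
      also have "\<dots> = ennreal (exp (\<epsilon> * t)) * ennreal (g \<rho> 0 (\<lambda>k. \<eta> (site k)))"
        using weight_measurable'[of \<rho> 0 "\<lambda>k. \<eta> (site k)"] by (simp add: nn_integral_cmult ennreal_g)
      also have "\<dots> = ennreal (exp (\<epsilon> * t) * g \<rho> 0 (\<lambda>k. \<eta> (site k)))"
        by (simp add: ennreal_mult' g_bounds)
      also have "\<dots> \<le> ennreal B"
      proof (rule ennreal_leI)
        have "g \<rho> 0 (\<lambda>k. \<eta> (site k)) \<le> (1 / min p (1 - p)) ^ m *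
            exp (- c * integral {0..t} (\<lambda>r. of_bool (env_legal \<rho> r 0)))"
          unfolding g_def using c m \<eta> site_quadrant
          by (intro weight_decay) (auto simp: configs_def PiE_def Pi_iff)
        also have "\<dots> \<le> (1 / min p (1 - p)) ^ m * exp (- (c * (\<delta> * t)))"
          using True c p by (intro mult_left_mono) (auto simp: coercive_def)
        finally have "exp (\<epsilon> * t) * g \<rho> 0 (\<lambda>k. \<eta> (site k)) \<le> exp (\<epsilon> * t) * ((1 / min p (1 - p)) ^ m * exp (- (c * (\<delta> * t))))"
          by (intro mult_left_mono) auto
        also have "\<dots> = B" by (simp add: B_def exp_diff exp_minus field_simps)
        finally show "exp (\<epsilon> * t) * g \<rho> 0 (\<lambda>k. \<eta> (site k)) \<le> B" .
      qed
      finally show ?thesis .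
    next
      \<comment> \<open>Here \<open>S\<close> fails for every line noise, so the inner integral
        vanishes.\<close>
      case False
      then have "f (join \<rho> W) = 0" for W using S_seed by (auto simp: f_def)
      then show ?thesis by simp
    qed
  qed
  also have "\<dots> = ennreal B" by (simp add: E.emeasure_space_1)
  finally show ?thesis
    using p by (subst (asm) ennreal_le_iff) (auto simp: B_def occ_def)
qed

lemma env_legal_integrable: "set_integrable lborel {0..t} (\<lambda>r. of_bool (env_legal \<rho> r 0) :: real)"
  "integral {0..t} (\<lambda>r. of_bool (env_legal \<rho> r 0) :: real) = (LBINT r:{0..t}. of_bool (env_legal \<rho> r 0))"
proof -
  note [measurable] = env_legal_measurable
  show *: "set_integrable lborel {0..t} (\<lambda>r. of_bool (env_legal \<rho> r 0) :: real)"
    by (rule integrable_on_bounded(2)[where B = 1]) auto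
  show "integral {0..t} (\<lambda>r. of_bool (env_legal \<rho> r 0) :: real) = (LBINT r:{0..t}. of_bool (env_legal \<rho> r 0))"
    by (rule set_borel_integral_eq_integral(2)[OF *, symmetric])
qed

text \<open>A zero at \<open>z\<close> frees the first site of the line. The path counts the rings
  of \<open>z\<close> up to and including \<open>s\<close>, the constraint those strictly before;
  the two differ only at the countably many ring times of \<open>z\<close>.\<close>

lemma occupation_time_le_seed:
  assumes z: "z \<in> quadrant"
  shows "occupation_time es \<eta> t z (join \<rho> W) \<le> integral {0..t} (\<lambda>r. of_bool (env_legal \<rho> r 0))"
proof -
  have e: "axis i 1 \<in> canon_basis" by (simp add: canon_basis_def)
  have agree: "join \<rho> W (y, l) = \<rho> (y, l)" if "y \<in> quadrant" "\<And>j. y $ j \<le> z $ j" for y l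
    using env_agree[OF e, of 0 y] that by (simp add: site_minus)
  have ring: "ring_time (join \<rho> W) z l = ring_time \<rho> z l" for l
    unfolding ring_time_def by (intro sum.cong refl arg_cong[where f = fst] agree z) simp
  have spin: "spin_after es \<eta> (join \<rho> W) z n = spin_after es \<eta> \<rho> z n" for n
    by (intro spin_after_cong z agree)
  have legal: "env_legal \<rho> s 0" if "s \<notin> range (ring_time \<rho> z)" "east es \<eta> (join \<rho> W) s z = 0" for s
  proof -
    have "{l. ring_time \<rho> z l \<le> s} = {l. ring_time \<rho> z l < s}" using that(1) by force
    then show ?thesis
      using that(2) z unfolding env_legal_def
      by (intro bexI[OF _ e]) (simp add: east_def spin ring site_minus extend_def)
  qed
  have "(\<lambda>s. spin_after es \<eta> \<rho> z (card {l. ring_time \<rho> z l \<le> s})) \<in> borel \<rightarrow>\<^sub>M count_space UNIV"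
    by (rule measurable_compose_countable[where g = "\<lambda>s. card {l. ring_time \<rho> z l \<le> s}"]) measurable
  then have [measurable]: "(\<lambda>s. east es \<eta> (join \<rho> W) s z) \<in> borel \<rightarrow>\<^sub>M count_space UNIV"
    by (simp add: east_def spin ring)
  have int: "set_integrable lborel {0..t} (\<lambda>s. of_bool (east es \<eta> (join \<rho> W) s z = 0) :: real)"
    by (rule integrable_on_bounded(2)[where B = 1]) auto
  have "AE s in lborel. s \<notin> range (ring_time \<rho> z)"
    by (intro AE_not_in countable_imp_null_set_lborel) simp
  then have "(LBINT s:{0..t}. of_bool (east es \<eta> (join \<rho> W) s z = 0) :: real) \<le> (LBINT s:{0..t}. of_bool (env_legal \<rho> s 0))"
    unfolding set_lebesgue_integral_def
  proof (intro integral_mono_AE)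
    assume "AE s in lborel. s \<notin> range (ring_time \<rho> z)"
    then show "AE s in lborel. indicator {0..t} s *\<^sub>R of_bool (east es \<eta> (join \<rho> W) s z = 0) \<le>
        indicator {0..t} s *\<^sub>R (of_bool (env_legal \<rho> s 0) :: real)"
      by (rule eventually_mono) (use legal in \<open>auto simp: indicator_def\<close>)
  qed (use int env_legal_integrable(1)[of t \<rho>] in \<open>auto simp: set_integrable_def\<close>)
  then show ?thesis by (simp add: occupation_time_def env_legal_integrable(2))
qed

text \<open>A line behind the boundary site \<open>- es\<close> has a seed that is at zero for
  ever.\<close>

lemma seed_boundary:
  assumes "z = - es" "es = axis i 1" "0 \<le> t"
  shows "integral {0..t} (\<lambda>r. of_bool (env_legal \<rho> r 0)) = t"
proof -
  have e: "axis i 1 \<in> canon_basis" by (simp add: canon_basis_def)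
  have "- axis i 1 \<notin> (quadrant :: (int ^ 'd) set)"
    by (auto simp: quadrant_def axis_def intro!: exI[of _ i])
  moreover have "- axis i 1 + axis i 1 \<in> (quadrant :: (int ^ 'd) set)" by (simp add: quadrant_def)
  ultimately have es: "- es \<notin> quadrant" "- es \<in> boundary"
    using e unfolding boundary_def assms(2) by blast+
  have site0: "site 0 - axis i 1 = - es" by (rule trans[OF site_minus(2) assms(1)])
  have "env_legal \<rho> r 0" for r
    unfolding env_legal_def
    by (rule bexI[OF _ e]) (unfold site0 extend_def min_bc_def, use es in simp)
  then show ?thesis using assms by simp
qed

end

section \<open>Induction over the coordinates\<close>

lemma axis_nonneg_quadrant:
  assumes "x \<in> quadrant" shows "x + axis i (int (Suc k)) \<in> quadrant"
  using assms by (auto simp: quadrant_def axis_def)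

text \<open>The induction runs over a set containing the nonzero coordinates of \<open>x\<close>. A
  new coordinate \<open>i\<close> adds a line in direction \<open>i\<close>, from the point where
  this coordinate is set to 0, and one summand to the union bound.\<close>

lemma occupation_tail:
  fixes es :: "int ^ 'd"
  assumes es: "es \<in> canon_basis" and p: "0 < p" "p < 1" and c: "coercive p c" and \<eta>: "\<eta> \<in> configs" and t: "0 \<le> t"
    and F: "finite (F :: 'd set)" and x: "x \<in> quadrant" "\<And>i. i \<notin> F \<Longrightarrow> x $ i = 0"
  shows "noise_prob p (\<lambda>\<omega>. occupation_time es \<eta> t x \<omega> \<le> (c / 2) ^ (1 + card F) * t) \<le>
    real (1 + card F) * (1 / min p (1 - p)) ^ (nat (l1_norm x) + 1) * exp (- ((c / 2) ^ (1 + card F) * t))"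
  using F x
proof (induction F arbitrary: x rule: finite_induct)
  case empty
  obtain i where i: "es = axis i 1" using es by (auto simp: canon_basis_def)
  have x0: "x = 0" using empty by (simp add: vec_eq_iff)
  interpret lattice_line es \<eta> "- es" i 1
  proof
    show "- es + axis i (int (Suc k)) \<in> quadrant" for k
      by (auto simp: quadrant_def axis_def i)
  qed simp
  have site: "site 0 = 0" using site_minus(2) by (simp add: i)
  have "noise_prob p (\<lambda>\<omega>. True \<and> occupation_time es \<eta> t (site (1 - 1)) \<omega> \<le> c / 2 * t) \<le>
    (1 / min p (1 - p)) ^ 1 * exp (c / 2 * t - c * (1 * t))"
  proof (rule stage[OF p t c \<eta>])
    show "1 * t \<le> integral {0..t} (\<lambda>r. of_bool (env_legal \<rho> r 0))" for \<rho>
      using seed_boundary[OF refl i t, of \<rho>] by (simp only: mult_1 order_refl)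
  qed simp
  moreover have "c / 2 * t - c * (1 * t) = - (c / 2 * t)" by simp
  ultimately show ?case by (simp add: site x0 l1_norm_def)
next
  case (insert i F)
  define K where "K = 1 / min p (1 - p)"
  have K: "1 \<le> K" using p by (simp add: K_def)
  \<comment> \<open>A seed at zero for time \<open>a * t\<close> gives a factor
    \<open>exp (- c * (a * t))\<close>. Since \<open>b = c / 2 * a\<close>, half of the exponent
    pays for \<open>exp (b * t)\<close> from Markov's inequality and half remains.\<close>
  define a b where "a = (c / 2) ^ (1 + card F)" and "b = (c / 2) ^ (1 + card (insert i F))"
  have ab: "b = c / 2 * a" "0 < a" "b \<le> a"
    using insert.hyps c by (auto simp: a_def b_def coercive_def mult_le_cancel_right2)
  define z where "z = x - axis i (x $ i)"
  have zi: "z $ j = (if j = i then 0 else x $ j)" for j by (simp add: z_def axis_def)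
  have z: "z \<in> quadrant" using insert.prems(1) by (auto simp: quadrant_def zi)
  have xi: "0 \<le> x $ i" using insert.prems(1) by (simp add: quadrant_def)
  have norm: "l1_norm x = l1_norm z + x $ i"
  proof -
    have "l1_norm x = (\<Sum>j\<in>UNIV. \<bar>z $ j\<bar> + (if j = i then x $ i else 0))"
      unfolding l1_norm_def using xi by (intro sum.cong) (auto simp: zi)
    then show ?thesis by (simp add: l1_norm_def sum.distrib)
  qed
  have norm_z: "0 \<le> l1_norm z" by (simp add: l1_norm_def sum_nonneg)
  have IH: "noise_prob p (\<lambda>\<omega>. occupation_time es \<eta> t z \<omega> \<le> a * t) \<le>
      real (1 + card F) * K ^ (nat (l1_norm z) + 1) * exp (- (a * t))"
    unfolding a_def K_def using insert.prems by (intro insert.IH z) (auto simp: zi)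
  also have "\<dots> \<le> real (1 + card F) * K ^ (nat (l1_norm x) + 1) * exp (- (b * t))"
    using K ab t norm xi by (intro mult_mono power_increasing) (auto intro: mult_right_mono)
  finally have IH': "noise_prob p (\<lambda>\<omega>. occupation_time es \<eta> t z \<omega> \<le> a * t) \<le>
      real (1 + card F) * K ^ (nat (l1_norm x) + 1) * exp (- (b * t))" .
  have "noise_prob p (\<lambda>\<omega>. occupation_time es \<eta> t x \<omega> \<le> b * t) \<le>
      real (1 + card F) * K ^ (nat (l1_norm x) + 1) * exp (- (b * t)) + K ^ (nat (l1_norm x) + 1) * exp (- (b * t))"
  proof (cases "x $ i = 0")
    case True
    then have "z = x" by (simp add: z_def axis_def vec_eq_iff)
    have "noise_prob p (\<lambda>\<omega>. occupation_time es \<eta> t x \<omega> \<le> b * t) \<le> noise_prob p (\<lambda>\<omega>. occupation_time es \<eta> t x \<omega> \<le> a * t)"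
      using ab t insert.prems(1)
      by (intro noise_prob_mono occupation_time_measurable_pred) (auto intro: order_trans mult_right_mono)
    also have "\<dots> \<le> real (1 + card F) * K ^ (nat (l1_norm x) + 1) * exp (- (b * t))"
      using IH' \<open>z = x\<close> by simp
    also have "\<dots> \<le> \<dots> + K ^ (nat (l1_norm x) + 1) * exp (- (b * t))" using K by simp
    finally show ?thesis .
  next
    case False
    define m where "m = nat (x $ i)"
    have m_pos: "0 < m" and int_m: "int m = x $ i" using False xi by (auto simp: m_def)
    interpret lattice_line es \<eta> z i m
      using m_pos z by unfold_locales (auto intro: axis_nonneg_quadrant simp del: of_nat_Suc)
    have site: "site (m - 1) = x"
    proof -
      have "Suc (m - 1) = m" using m_pos by simp
      then have "site (m - 1) = z + axis i (int m)" by (simp only: site_def)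
      then show ?thesis by (simp add: int_m z_def)
    qed
    \<comment> \<open>Either the seed spends little time at zero, or the last site does so in spite
      of a good seed.\<close>
    have "noise_prob p (\<lambda>\<omega>. occupation_time es \<eta> t x \<omega> \<le> b * t) \<le>
      noise_prob p (\<lambda>\<omega>. occupation_time es \<eta> t z \<omega> \<le> a * t) +
      noise_prob p (\<lambda>\<omega>. \<not> occupation_time es \<eta> t z \<omega> \<le> a * t \<and> occupation_time es \<eta> t x \<omega> \<le> b * t)"
      using z insert.prems(1) by (intro noise_prob_split occupation_time_measurable_pred)
    moreover have "noise_prob p (\<lambda>\<omega>. \<not> occupation_time es \<eta> t z \<omega> \<le> a * t \<and> occupation_time es \<eta> t x \<omega> \<le> b * t) \<le>
      K ^ m * exp (b * t - c * (a * t))"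
      unfolding K_def site[symmetric]
    proof (rule stage[OF p t c \<eta>])
      show "Measurable.pred (noise_measure p) (\<lambda>\<omega>. \<not> occupation_time es \<eta> t z \<omega> \<le> a * t)"
        by (intro pred_intros_logic(2) occupation_time_measurable_pred z)
      fix \<rho> W assume "\<not> occupation_time es \<eta> t z (join \<rho> W) \<le> a * t"
      then show "a * t \<le> integral {0..t} (\<lambda>r. of_bool (env_legal \<rho> r 0))"
        using occupation_time_le_seed[OF z, of t \<rho> W] by simp
    qed
    moreover have "K ^ m * exp (b * t - c * (a * t)) \<le> K ^ (nat (l1_norm x) + 1) * exp (- (b * t))"
    proof (intro mult_mono power_increasing)
      show "m \<le> nat (l1_norm x) + 1" using norm norm_z by (simp add: m_def)
      show "exp (b * t - c * (a * t)) \<le> exp (- (b * t))" by (simp add: ab(1))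
    qed (use K in auto)
    ultimately show ?thesis using IH' by linarith
  qed
  also have "\<dots> = real (1 + card (insert i F)) * K ^ (nat (l1_norm x) + 1) * exp (- (b * t))"
    using insert.hyps by (simp add: algebra_simps)
  finally show ?case unfolding b_def K_def .
qed

section \<open>Short times at the origin\<close>

lemma east_measurable_time: "(\<lambda>s. east es \<eta> \<omega> s x) \<in> borel \<rightarrow>\<^sub>M count_space UNIV"
  unfolding east_def
  by (rule measurable_compose_countable[where g = "\<lambda>s. card {l. ring_time \<omega> x l \<le> s}"]) measurable

lemma occupation_integrable:
  "set_integrable lborel {0..t} (\<lambda>s. of_bool (east es \<eta> \<omega> s x = 0) :: real)"
proof -
  note [measurable] = east_measurable_time[of es \<eta> \<omega> x]
  show ?thesis by (rule integrable_on_bounded(2)[where B = 1]) auto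
qed

lemma spin_origin_after_first_ring:
  assumes es: "es \<in> canon_basis"
  shows "spin_after es \<eta> \<omega> 0 (Suc 0) = coin \<omega> 0 0"
proof -
  obtain i where i: "es = axis i 1" using es by (auto simp: canon_basis_def)
  have "0 - es \<notin> quadrant" by (auto simp: quadrant_def axis_def i intro!: exI[of _ i])
  moreover have "0 - es + es \<in> quadrant" by (simp add: quadrant_def)
  ultimately have b: "0 - es \<notin> quadrant" "0 - es \<in> boundary"
    using es unfolding boundary_def by blast+
  have "extend (min_bc es) (\<lambda>y. spin_after es \<eta> \<omega> y (card {k. ring_time \<omega> y k < ring_time \<omega> 0 0})) (0 - es) = 0"
    using b by (simp add: extend_def min_bc_def)
  with es have "\<exists>e\<in>canon_basis. extend (min_bc es)
      (\<lambda>y. spin_after es \<eta> \<omega> y (card {k. ring_time \<omega> y k < ring_time \<omega> 0 0})) (0 - e) = 0"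
    by (rule bexI[rotated])
  then show ?thesis by (simp only: spin_after.simps if_True)
qed

text \<open>The first ring comes by time \<open>t / 2\<close> and sets the origin to zero, and the
  second waiting time alone exceeds \<open>t\<close>, so the zero persists until
  \<open>t\<close>.\<close>

lemma occupation_time_origin:
  assumes es: "es \<in> canon_basis" and nonneg: "\<And>k. 0 \<le> fst (\<omega> (0, k))"
    and first: "fst (\<omega> (0, 0)) \<le> t / 2" "\<not> snd (\<omega> (0, 0))" and second: "t < fst (\<omega> (0, 1))"
  shows "t / 2 \<le> occupation_time es \<eta> t 0 \<omega>"
proof -
  define w where "w = fst (\<omega> (0, 0))"
  have w: "0 \<le> w" "w \<le> t / 2" using nonneg first by (auto simp: w_def)
  have zero: "east es \<eta> \<omega> s 0 = 0" if s: "s \<in> {w..t}" for s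
  proof -
    have "s < ring_time \<omega> 0 (Suc k)" for k
    proof -
      have "(\<Sum>j\<in>{1}. fst (\<omega> (0, j))) \<le> ring_time \<omega> 0 (Suc k)"
        unfolding ring_time_def using nonneg by (intro sum_mono2) auto
      then show ?thesis using second s by simp
    qed
    then have "k = 0" if "ring_time \<omega> 0 k \<le> s" for k
      using that by (cases k) (auto simp: not_le[symmetric])
    moreover have "ring_time \<omega> 0 0 \<le> s" using s by (simp add: ring_time_def w_def)
    ultimately have "{k. ring_time \<omega> 0 k \<le> s} = {0}" by auto
    then have "east es \<eta> \<omega> s 0 = coin \<omega> 0 0"
      using spin_origin_after_first_ring[OF es] by (simp add: east_def)
    then show ?thesis using first by (simp add: coin_def)
  qed
  have "t / 2 \<le> t - w" using w by simp
  also have "\<dots> = (LINT s|lborel. indicator {w..t} s :: real)" using w by simp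
  also have "\<dots> \<le> occupation_time es \<eta> t 0 \<omega>"
    unfolding occupation_time_def set_lebesgue_integral_def
  proof (rule Bochner_Integration.integral_mono)
    show "integrable lborel (indicat_real {w..t})" by (intro integrable_real_indicator) (auto simp: emeasure_lborel_Icc_eq)
    show "integrable lborel (\<lambda>s. indicator {0..t} s *\<^sub>R (of_bool (east es \<eta> \<omega> s 0 = 0) :: real))"
      using occupation_integrable[of t es \<eta> \<omega> 0] by (simp only: set_integrable_def)
  qed (use w zero in \<open>auto simp: indicator_def\<close>)
  finally show ?thesis .
qed

lemma emeasure_marks_Times:
  assumes "A \<in> sets borel"
  shows "emeasure (marks p) (A \<times> B) =
    emeasure (density lborel (exponential_density 1)) A * emeasure (measure_pmf (bernoulli_pmf p)) B"
  unfolding marks_def using assms by (intro measure_pmf.emeasure_pair_measure_Times) auto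

lemma exponential_probabilities:
  assumes "0 \<le> (a::real)"
  shows "emeasure (density lborel (exponential_density 1)) {a<..} = ennreal (exp (- a))"
    "emeasure (density lborel (exponential_density 1)) {0..a} = ennreal (1 - exp (- a))"
proof -
  interpret D: prob_space "density lborel (exponential_density 1)"
    by (rule prob_space_exponential_density) simp
  have dist: "distributed (density lborel (exponential_density 1)) lborel (\<lambda>x. x) (exponential_density 1)"
    by (simp add: distributed_def distr_id2)
  have gt: "measure (density lborel (exponential_density 1)) {a<..} = exp (- a)"
    using D.exponential_distributedD_gt[OF dist assms zero_less_one] by (simp add: greaterThan_def)
  then show "emeasure (density lborel (exponential_density 1)) {a<..} = ennreal (exp (- a))"
    by (simp add: D.emeasure_eq_measure)
  have le: "measure (density lborel (exponential_density 1)) {..a} = 1 - exp (- a)"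
    using D.exponential_distributedD_le[OF dist assms zero_less_one] by (simp add: atMost_def)
  have "AE x in density lborel (exponential_density 1). 0 \<le> x"
    by (subst AE_density) (auto simp: exponential_density_def)
  then have "measure (density lborel (exponential_density 1)) {0..a} = measure (density lborel (exponential_density 1)) {..a}"
    by (intro measure_eq_AE) auto
  with le show "emeasure (density lborel (exponential_density 1)) {0..a} = ennreal (1 - exp (- a))"
    by (simp add: D.emeasure_eq_measure)
qed

text \<open>The complementary event contains an early first ring with coin zero followed by a long
  wait, three independent requirements. Its probability is of order \<open>t\<close> for small
  \<open>t\<close>, as a bound \<open>exp (- (lam * t))\<close> without prefactor demands.\<close>

lemma short_time:
  fixes es :: "int ^ 'd"
  assumes es: "es \<in> canon_basis" and p: "0 < p" "p < 1" and t: "0 < t" and \<epsilon>: "\<epsilon> < 1 / 2"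
  shows "noise_prob p (\<lambda>\<omega>. occupation_time es \<eta> t 0 \<omega> \<le> \<epsilon> * t) \<le> 1 - (1 - exp (- (t / 2))) * (1 - p) * exp (- t)"
proof -
  let ?M = "noise_measure p :: 'd noise measure"
  interpret N: prob_space ?M by (rule prob_space_noise_measure)
  have 0: "(0 :: int ^ 'd) \<in> quadrant" by (simp add: quadrant_def)
  define J :: "((int ^ 'd) \<times> nat) set" where "J = {(0, 0), (0, 1)}"
  define X :: "(int ^ 'd) \<times> nat \<Rightarrow> (real \<times> bool) set" where
    "X j = (if j = (0, 0) then {0..t / 2} \<times> {False} else {t<..} \<times> UNIV)" for j
  define E where "E = {\<omega> \<in> space ?M. \<forall>j\<in>J. \<omega> j \<in> X j}"
  have X: "X j \<in> sets (marks p)" for j by (auto simp: X_def sets_marks)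
  interpret M: prob_space "marks p" by (rule prob_space_marks)
  interpret P: product_prob_space "\<lambda>_. marks p" "quadrant \<times> UNIV :: ((int ^ 'd) \<times> nat) set" by unfold_locales
  have E_eq: "E = {\<omega> \<in> space (Pi\<^sub>M (quadrant \<times> UNIV) (\<lambda>_. marks p)). \<forall>j\<in>J. \<omega> j \<in> X j}"
    by (simp add: E_def noise_measure_eq marks_on_def)
  have "emeasure ?M E = (\<Prod>j\<in>J. emeasure (marks p) (X j))"
    unfolding E_eq noise_measure_eq marks_on_def using 0 X
    by (intro P.emeasure_PiM_Collect) (auto simp: J_def)
  also have "\<dots> = ennreal (1 - exp (- (t / 2))) * ennreal (1 - p) * ennreal (exp (- t))"
  proof -
    have "emeasure (measure_pmf (bernoulli_pmf p)) {False} = ennreal (1 - p)"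
      using p by (simp add: emeasure_pmf_single)
    moreover have "emeasure (measure_pmf (bernoulli_pmf p)) UNIV = 1"
      using measure_pmf.emeasure_space_1[of "bernoulli_pmf p"] by simp
    ultimately show ?thesis
      using t by (simp add: J_def X_def emeasure_marks_Times exponential_probabilities)
  qed
  also have "\<dots> = ennreal ((1 - exp (- (t / 2))) * (1 - p) * exp (- t))"
    using t p by (simp add: ennreal_mult)
  finally have E: "measure ?M E = (1 - exp (- (t / 2))) * (1 - p) * exp (- t)"
    using t p by (simp add: measure_def)
  have Es: "E \<in> N.events"
    unfolding E_eq noise_measure_eq marks_on_def using 0 X
    by (intro sets.sets_Collect_finite_All' sets.sets_Collect_finite_All) (auto simp: J_def)
  have "AE \<omega> in ?M. \<forall>k\<in>UNIV. 0 \<le> fst (\<omega> (0, k :: nat))"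
    unfolding noise_measure_eq using 0 p
    by (intro AE_ball_countable' AE_marks_on_component AE_marks_nonneg) auto
  then have "AE \<omega> in ?M. \<omega> \<in> {\<omega> \<in> space ?M. occupation_time es \<eta> t 0 \<omega> \<le> \<epsilon> * t} \<longrightarrow> \<omega> \<in> space ?M - E"
  proof (rule eventually_mono, intro impI)
    fix \<omega> assume nn: "\<forall>k\<in>UNIV. 0 \<le> fst (\<omega> (0, k :: nat))"
      and occ: "\<omega> \<in> {\<omega> \<in> space ?M. occupation_time es \<eta> t 0 \<omega> \<le> \<epsilon> * t}"
    have "\<omega> \<notin> E"
    proof
      assume "\<omega> \<in> E"
      then have "\<omega> (0, 0) \<in> {0..t / 2} \<times> {False}" "\<omega> (0, 1) \<in> {t<..} \<times> UNIV"
        by (auto simp: E_def J_def X_def)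
      then have "t / 2 \<le> occupation_time es \<eta> t 0 \<omega>"
        using nn by (intro occupation_time_origin[OF es]) (auto simp: mem_Times_iff)
      moreover have "\<epsilon> * t < 1 / 2 * t" using t \<epsilon> by (intro mult_strict_right_mono)
      ultimately show False using occ by simp
    qed
    with occ show "\<omega> \<in> space ?M - E" by simp
  qed
  then have "measure ?M {\<omega> \<in> space ?M. occupation_time es \<eta> t 0 \<omega> \<le> \<epsilon> * t} \<le> measure ?M (space ?M - E)"
    using Es by (intro N.finite_measure_mono_AE) auto
  also have "\<dots> = 1 - measure ?M E" by (rule N.prob_compl[OF Es])
  finally show ?thesis by (simp add: noise_prob_def E)
qed

text \<open>For \<open>t\<close> at least \<open>\<kappa>\<close>, half of the exponent swallows the
  prefactor. Below this threshold the hypothesis on \<open>t\<close> leaves only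
  \<open>x = 0\<close>, where the estimate for short times applies.\<close>

lemma occupation_exponential_bound:
  fixes es :: "int ^ 'd"
  assumes es: "es \<in> canon_basis" and p: "0 < p" "p < 1"
  obtains \<kappa> lam \<epsilon> :: real where "0 < \<kappa>" "0 < lam" "0 < \<epsilon>" "\<epsilon> < 1"
    "\<And>\<eta> x t. \<eta> \<in> configs \<Longrightarrow> x \<in> quadrant \<Longrightarrow> \<kappa> * real_of_int (l1_norm x) \<le> t \<Longrightarrow>
      noise_prob p (\<lambda>\<omega>. occupation_time es \<eta> t x \<omega> \<le> \<epsilon> * t) \<le> exp (- (lam * t))"
proof -
  interpret bernoulli_param p using p by unfold_locales
  obtain c where c: "coercive p c" by (rule uniform_coercivity)
  define D where "D = 1 + CARD('d)"
  define \<epsilon> where "\<epsilon> = (c / 2) ^ D"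
  have D: "2 \<le> D" using zero_less_card_finite[where 'a = 'd] by (simp add: D_def)
  have \<epsilon>: "0 < \<epsilon>" "\<epsilon> < 1 / 2"
  proof -
    have c': "0 < c / 2" "c / 2 \<le> 1 / 2" using c by (auto simp: coercive_def)
    then show "0 < \<epsilon>" by (simp add: \<epsilon>_def)
    have "\<epsilon> \<le> (1 / 2) ^ D" unfolding \<epsilon>_def using c' by (intro power_mono) auto
    also have "\<dots> \<le> (1 / 2) ^ 2" using D by (intro power_decreasing) auto
    finally show "\<epsilon> < 1 / 2" by (simp add: power2_eq_square)
  qed
  define K where "K = 1 / min p (1 - p)"
  have K: "1 < K" using p by (simp add: K_def)
  \<comment> \<open>Chosen so that \<open>ln D + (N + 1) * ln K\<close> is at most
    \<open>b * max 1 N\<close>; by the choice of \<open>\<kappa>\<close> this is at most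
    \<open>\<epsilon> / 2 * t\<close>.\<close>
  define b where "b = ln (real D) + 2 * ln K"
  have b: "0 < b" using D K by (simp add: b_def add_nonneg_pos)
  define \<kappa> where "\<kappa> = 2 / \<epsilon> * b"
  have \<kappa>: "0 < \<kappa>" using \<epsilon> b by (simp add: \<kappa>_def)
  \<comment> \<open>Lower bound, uniform in \<open>0 < t < \<kappa>\<close>, for the probability of
    the good event at the origin divided by \<open>t\<close>.\<close>
  define \<mu> where "\<mu> = (1 - p) / 2 * exp (- (\<kappa> / 2)) * exp (- \<kappa>)"
  have \<mu>: "0 < \<mu>" using p by (simp add: \<mu>_def)
  define lam where "lam = min (\<epsilon> / 2) \<mu>"
  have lam: "0 < lam" using \<epsilon> \<mu> by (simp add: lam_def)
  have long: "noise_prob p (\<lambda>\<omega>. occupation_time es \<eta> t x \<omega> \<le> \<epsilon> * t) \<le> exp (- (lam * t))"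
    if \<eta>: "\<eta> \<in> configs" and x: "x \<in> quadrant" and t: "\<kappa> * real_of_int (l1_norm x) \<le> t" "\<kappa> \<le> t" for \<eta> x t
  proof -
    have t0: "0 \<le> t" using t \<kappa> by simp
    define N where "N = nat (l1_norm x)"
    have N: "real_of_int (l1_norm x) = real N" by (simp add: N_def l1_norm_def sum_nonneg)
    have "noise_prob p (\<lambda>\<omega>. occupation_time es \<eta> t x \<omega> \<le> \<epsilon> * t) \<le> real D * K ^ (N + 1) * exp (- (\<epsilon> * t))"
      unfolding \<epsilon>_def D_def K_def N_def by (rule occupation_tail[OF es p c \<eta> t0 finite x]) simp
    also have "\<dots> = exp (ln (real D) + (real N + 1) * ln K - \<epsilon> * t)"
    proof -
      have "K ^ (N + 1) = exp ((real N + 1) * ln K)"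
        using K exp_of_nat_mult[of "N + 1" "ln K"] by (simp add: add.commute)
      moreover have "real D = exp (ln (real D))" using D by simp
      ultimately show ?thesis by (simp add: exp_add exp_diff exp_minus field_simps)
    qed
    also have "\<dots> \<le> exp (- (lam * t))"
    proof -
      have "ln (real D) + (real N + 1) * ln K \<le> \<epsilon> / 2 * t"
      proof (cases "N = 0")
        case True
        have "ln (real D) + ln K \<le> b" using K by (simp add: b_def)
        also have "b = \<epsilon> / 2 * \<kappa>" using \<epsilon> by (simp add: \<kappa>_def)
        also have "\<dots> \<le> \<epsilon> / 2 * t" using t \<epsilon> by (intro mult_left_mono) auto
        finally show ?thesis using True by simp
      next
        case False
        have "ln (real D) + (real N + 1) * ln K \<le> real N * ln (real D) + (real N + real N) * ln K"
          using False D K by (intro add_mono mult_right_mono) (auto simp: mult_le_cancel_right1)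
        also have "\<dots> = real N * b" by (simp add: b_def algebra_simps)
        also have "\<dots> = \<epsilon> / 2 * (\<kappa> * real N)" using \<epsilon> by (simp add: \<kappa>_def)
        also have "\<dots> \<le> \<epsilon> / 2 * t" using t N \<epsilon> by (intro mult_left_mono) auto
        finally show ?thesis .
      qed
      moreover have "lam * t \<le> \<epsilon> / 2 * t" using t0 by (intro mult_right_mono) (auto simp: lam_def)
      ultimately show ?thesis by simp
    qed
    finally show ?thesis .
  qed
  have short: "noise_prob p (\<lambda>\<omega>. occupation_time es \<eta> t 0 \<omega> \<le> \<epsilon> * t) \<le> exp (- (lam * t))"
    if t: "0 \<le> t" "t < \<kappa>" for \<eta> t
  proof (cases "t = 0")
    case True
    then show ?thesis using noise_prob_le_1 by simp
  next
    case False
    have "lam * t \<le> (1 - exp (- (t / 2))) * (1 - p) * exp (- t)"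
    proof -
      have "t / 2 * exp (- (t / 2)) \<le> 1 - exp (- (t / 2))"
      proof -
        have "(1 + t / 2) * exp (- (t / 2)) \<le> exp (t / 2) * exp (- (t / 2))"
          by (intro mult_right_mono exp_ge_add_one_self) auto
        then show ?thesis by (simp add: algebra_simps flip: exp_add)
      qed
      moreover have "t / 2 * exp (- (\<kappa> / 2)) \<le> t / 2 * exp (- (t / 2))"
        using t by (intro mult_left_mono) auto
      ultimately have 1: "t / 2 * exp (- (\<kappa> / 2)) \<le> 1 - exp (- (t / 2))" by linarith
      have "lam * t \<le> \<mu> * t" using t by (intro mult_right_mono) (auto simp: lam_def)
      also have "\<dots> = (t / 2 * exp (- (\<kappa> / 2))) * (1 - p) * exp (- \<kappa>)" by (simp add: \<mu>_def)
      also have "\<dots> \<le> (1 - exp (- (t / 2))) * (1 - p) * exp (- t)"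
        using 1 p t by (intro mult_mono) auto
      finally show ?thesis .
    qed
    then have "1 - (1 - exp (- (t / 2))) * (1 - p) * exp (- t) \<le> exp (- (lam * t))"
      using exp_ge_add_one_self[of "- (lam * t)"] by linarith
    with short_time[OF es p _ \<epsilon>(2), of t \<eta>] t False show ?thesis by simp
  qed
  show thesis
  proof
    show "0 < \<kappa>" "0 < lam" "0 < \<epsilon>" "\<epsilon> < 1" using \<kappa> lam \<epsilon> by auto
    fix \<eta> :: "int ^ 'd \<Rightarrow> nat" and x :: "int ^ 'd" and t :: real
    assume \<eta>: "\<eta> \<in> configs" and x: "x \<in> quadrant" and t: "\<kappa> * real_of_int (l1_norm x) \<le> t"
    have norm: "0 \<le> l1_norm x" by (simp add: l1_norm_def sum_nonneg)
    show "noise_prob p (\<lambda>\<omega>. occupation_time es \<eta> t x \<omega> \<le> \<epsilon> * t) \<le> exp (- (lam * t))"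
    proof (cases "\<kappa> \<le> t")
      case False
      then have "\<kappa> * real_of_int (l1_norm x) < \<kappa> * 1" using t by simp
      then have "l1_norm x = 0" using \<kappa> norm by (subst (asm) mult_less_cancel_left_pos) auto
      then have "x = 0" by (simp add: l1_norm_def sum_nonneg_eq_0_iff vec_eq_iff)
      with short[of t \<eta>] False t \<open>l1_norm x = 0\<close> show ?thesis by simp
    qed (use long[OF \<eta> x t] in simp)
  qed
qed

text \<open>The spin is nonzero on all of \<open>[0, t)\<close>; it may vanish at the endpoint
  \<open>t\<close>, which is a null set.\<close>

lemma hitting_time_ge_imp_occupation_time:
  assumes "ereal t \<le> hitting_time es \<eta> x \<omega>"
  shows "occupation_time es \<eta> t x \<omega> = 0"
proof -
  have no_zero: "east es \<eta> \<omega> s x \<noteq> 0" if "0 \<le> s" "s < t" for s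
  proof
    assume "east es \<eta> \<omega> s x = 0"
    then have "hitting_time es \<eta> x \<omega> \<le> ereal s"
      unfolding hitting_time_def using that by (intro Inf_lower) auto
    with assms have "ereal t \<le> ereal s" by (rule order_trans)
    with that show False by simp
  qed
  have "AE s in lborel. indicator {0..t} s *\<^sub>R (of_bool (east es \<eta> \<omega> s x = 0) :: real) = 0"
    using no_zero by (intro eventually_mono[OF AE_lborel_singleton[of t]]) (auto simp: indicator_def)
  then show ?thesis
    unfolding occupation_time_def set_lebesgue_integral_def by (rule integral_eq_zero_AE)
qed

theorem theorem4p6:
  fixes es :: "int ^ 'd" and p q :: real
  assumes "es \<in> canon_basis" and "p = 1 - q" and "0 < p" and "p < 1"
  shows "\<exists>\<kappa> lam \<delta> :: real. 0 < \<kappa> \<and> 0 < lam \<and> 0 < \<delta> \<and> \<delta> < 1 \<and>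
    (\<forall>x \<in> quadrant. \<forall>t \<ge> \<kappa> * real_of_int (l1_norm x).
      (SUP \<eta> \<in> configs. noise_prob p (\<lambda>\<omega>. occupation_time es \<eta> t x \<omega> \<le> \<delta> ^ CARD('d) * t))
        \<le> real CARD('d) * exp (- lam * \<delta> * t) \<and>
      (SUP \<eta> \<in> configs. noise_prob p (\<lambda>\<omega>. ereal t \<le> hitting_time es \<eta> x \<omega>))
        \<le> real CARD('d) * exp (- lam * \<delta> * t))"
proof -
  obtain \<kappa> lam \<epsilon> :: real where const: "0 < \<kappa>" "0 < lam" "0 < \<epsilon>" "\<epsilon> < 1"
    and bound: "\<And>\<eta> x t. \<eta> \<in> configs \<Longrightarrow> x \<in> quadrant \<Longrightarrow> \<kappa> * real_of_int (l1_norm x) \<le> t \<Longrightarrow>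
      noise_prob p (\<lambda>\<omega>. occupation_time es \<eta> t x \<omega> \<le> \<epsilon> * t) \<le> exp (- (lam * t))"
    using occupation_exponential_bound[OF assms(1,3,4)] by blast
  have d: "1 \<le> CARD('d)" using zero_less_card_finite[where 'a = 'd] by simp
  \<comment> \<open>With \<open>\<delta> = \<epsilon>\<close> the bound already obtained is the
    stronger one: \<open>\<epsilon> ^ d \<le> \<epsilon>\<close>, the prefactor \<open>d\<close> is
    at least 1, and \<open>\<epsilon> < 1\<close> only weakens the exponent.\<close>
  have \<epsilon>d: "\<epsilon> ^ CARD('d) \<le> \<epsilon>" using power_decreasing[OF d, of \<epsilon>] const by simp
  have ne: "(configs :: (int ^ 'd \<Rightarrow> nat) set) \<noteq> {}" by (simp add: configs_def PiE_eq_empty_iff)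
  have "(SUP \<eta> \<in> configs. noise_prob p (\<lambda>\<omega>. occupation_time es \<eta> t x \<omega> \<le> \<epsilon> ^ CARD('d) * t))
        \<le> real CARD('d) * exp (- lam * \<epsilon> * t) \<and>
      (SUP \<eta> \<in> configs. noise_prob p (\<lambda>\<omega>. ereal t \<le> hitting_time es \<eta> x \<omega>))
        \<le> real CARD('d) * exp (- lam * \<epsilon> * t)"
    if x: "x \<in> quadrant" and t: "\<kappa> * real_of_int (l1_norm x) \<le> t" for x t
  proof -
    have "0 \<le> \<kappa> * real_of_int (l1_norm x)" using const by (simp add: l1_norm_def sum_nonneg)
    with t have t0: "0 \<le> t" by simp
    have "lam * \<epsilon> * t \<le> lam * 1 * t" using const t0 by (intro mult_right_mono mult_left_mono) auto
    then have "exp (- (lam * t)) \<le> exp (- lam * \<epsilon> * t)" by simp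
    also have "\<dots> \<le> real CARD('d) * exp (- lam * \<epsilon> * t)" using d by simp
    finally have le: "exp (- (lam * t)) \<le> real CARD('d) * exp (- lam * \<epsilon> * t)" .
    have occ: "noise_prob p S \<le> real CARD('d) * exp (- lam * \<epsilon> * t)"
      if "\<eta> \<in> configs" "\<And>\<omega>. S \<omega> \<Longrightarrow> occupation_time es \<eta> t x \<omega> \<le> \<epsilon> * t" for S \<eta>
    proof -
      have "noise_prob p S \<le> noise_prob p (\<lambda>\<omega>. occupation_time es \<eta> t x \<omega> \<le> \<epsilon> * t)"
        by (rule noise_prob_mono[OF occupation_time_measurable_pred[OF x] that(2)])
      also have "\<dots> \<le> exp (- (lam * t))" by (rule bound[OF that(1) x t])
      finally show ?thesis using le by simp
    qed
    have "\<epsilon> ^ CARD('d) * t \<le> \<epsilon> * t" using \<epsilon>d t0 by (rule mult_right_mono)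
    then show ?thesis
      using const t0 hitting_time_ge_imp_occupation_time[of t es _ x]
      by (intro conjI cSUP_least[OF ne] occ) (auto intro: order_trans)
  qed
  with const show ?thesis by blast
qed

end
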